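(* Let $T>0$, let $B^H$ be a fractional Brownian motion with Hurst parameter $H\in\left(\frac12,1\right)$, let $S(t)=e^{B^H(t)}$, and for $s\in[0,T]$ put $$G(s)=\exp\left(\frac1T\int_0^s \log S(u)\,du\right)S(s)^{\frac{T-s}{T}}.$$ Let $f:\mathbb{R}\to\mathbb{R}$ be a convex function with left derivative $f'_-$. Then it holds almost surely that $$f\left(\exp\left(\frac1T\int_0^T B^H(s)\,ds\right)\right)=f(S(0))+\int_0^T\frac{T-s}{T}f'_-\left(G(s)\right)G(s)\,dB^H(s),$$ where the stochastic integral is understood in the sense of the generalized Lebesgue-Stieltjes integral.
   Context: Setting: $(\Omega,\mathcal{F},(\mathcal{F}_t)_{t\ge0},\mathbb{P})$ is a complete filtered probability space. Fractional Brownian motion $(B^H(t))_{t\ge0}$ is a Gaussian process with $\mathbb{E}B^H(t)=B^H(0)$ (a constant) and $\mathrm{Cov}(B^H(t),B^H(s))=\frac12\left(t^{2H}+s^{2H}-|t-s|^{2H}\right)$; its trajectories on $[0,T]$ belong almost surely to the space $W_1^\beta([0,T])$ defined below for every $0<\beta<H$ (in particular they are continuous). Fractional Besov spaces: for $\beta\in(0,1)$ and measurable $f:[0,T]\to\mathbb{R}$, $f\in W_1^\beta([0,T])$ iff $\|f\|_{1,\beta}=\sup_{0\le s<t\le T}\left(\frac{|f(t)-f(s)|}{(t-s)^\beta}+\int_s^t\frac{|f(u)-f(s)|}{(u-s)^{\beta+1}}du\right)<\infty$, and $f\in W_2^\beta([0,T])$ iff $\|f\|_{2,\beta}=\int_0^T\frac{|f(t)|}{t^\beta}dt+\int_0^T\int_0^t\frac{|f(t)-f(s)|}{(t-s)^{\beta+1}}ds\,dt<\infty$.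 Fractional derivatives on $[0,t]$: for $\alpha\in(0,1)$, $(D^\alpha_{0+}f)(x)=\frac{1}{\Gamma(1-\alpha)}\frac{d}{dx}\int_0^x f(s)(x-s)^{-\alpha}ds$ and $(D^\alpha_{t-}f)(x)=\frac{-1}{\Gamma(1-\alpha)}\frac{d}{dx}\int_x^t f(s)(s-x)^{-\alpha}ds$. Generalized Lebesgue-Stieltjes integral: if for some $\beta\in(0,1)$ one has $f\in W_2^\beta([0,T])$ and $g\in W_1^{1-\beta}([0,T])$, then for $t\in(0,T]$ the Lebesgue integral $\int_0^t f\,dg:=\int_0^t (D^\beta_{0+}f)(x)\,(D^{1-\beta}_{t-}g_{t-})(x)\,dx$, with $g_{t-}(x)=g(t-)-g(x)$, exists and is called the generalized Lebesgue-Stieltjes integral of $f$ with respect to $g$; its value is the same for all admissible $\beta$. Stochastic integrals with respect to $B^H$ are taken pathwise in this sense. *)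

theory Defs
  imports "HOL-Probability.Probability"
begin

locale complete_filtered_prob_space = prob_space M + complete_measure M
  for M :: "'a measure" +
  fixes F :: "real \<Rightarrow> 'a measure"
  assumes subalgebra_filtration: "\<And>t. 0 \<le> t \<Longrightarrow> subalgebra M (F t)"
    and filtration_mono: "\<And>s t. 0 \<le> s \<Longrightarrow> s \<le> t \<Longrightarrow> sets (F s) \<subseteq> sets (F t)"
    and filtration_null_sets: "\<And>t. 0 \<le> t \<Longrightarrow> null_sets M \<subseteq> sets (F t)"

(* Degenerate (almost surely constant) Gaussian variables are included. *)
definition gaussian_rv :: "'a measure \<Rightarrow> ('a \<Rightarrow> real) \<Rightarrow> bool" where
  "gaussian_rv M X \<longleftrightarrow> X \<in> borel_measurable M \<and>
     (\<exists>\<mu>. (AE \<omega> in M. X \<omega> = \<mu>) \<or>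
           (\<exists>\<sigma>>0. distributed M lborel X (normal_density \<mu> \<sigma>)))"

(* Processes are indexed by real numbers; only the times t >= 0 matter. *)
definition gaussian_process :: "'a measure \<Rightarrow> (real \<Rightarrow> 'a \<Rightarrow> real) \<Rightarrow> bool" where
  "gaussian_process M X \<longleftrightarrow>
     (\<forall>J a. finite J \<and> J \<subseteq> {0..} \<longrightarrow> gaussian_rv M (\<lambda>\<omega>. \<Sum>t\<in>J. a t * X t \<omega>))"

definition covariance :: "'a measure \<Rightarrow> ('a \<Rightarrow> real) \<Rightarrow> ('a \<Rightarrow> real) \<Rightarrow> real" where
  "covariance M X Y =
     (LINT \<omega>|M. (X \<omega> - (LINT \<omega>'|M. X \<omega>')) * (Y \<omega> - (LINT \<omega>'|M. Y \<omega>')))"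

definition fractional_brownian_motion ::
    "'a measure \<Rightarrow> real \<Rightarrow> (real \<Rightarrow> 'a \<Rightarrow> real) \<Rightarrow> bool" where
  "fractional_brownian_motion M H B \<longleftrightarrow>
     gaussian_process M B \<and>
     (\<exists>c. (AE \<omega> in M. B 0 \<omega> = c) \<and> (\<forall>t\<ge>0. (LINT \<omega>|M. B t \<omega>) = c)) \<and>
     (\<forall>t\<ge>0. \<forall>s\<ge>0. covariance M (B t) (B s) =
        (t powr (2 * H) + s powr (2 * H) - \<bar>t - s\<bar> powr (2 * H)) / 2)"

(* The two norms below are extended-valued, so that finiteness is meaningful without
   presupposing any integrability. *)
definition besov1_norm :: "real \<Rightarrow> real \<Rightarrow> (real \<Rightarrow> real) \<Rightarrow> ennreal" where
  "besov1_norm \<beta> T f =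
     (SUP (s, t) \<in> {(s, t). 0 \<le> s \<and> s < t \<and> t \<le> T}.
        ennreal (\<bar>f t - f s\<bar> / (t - s) powr \<beta>) +
        (\<integral>\<^sup>+u\<in>{s..t}. ennreal (\<bar>f u - f s\<bar> / (u - s) powr (\<beta> + 1)) \<partial>lebesgue))"

definition besov1 :: "real \<Rightarrow> real \<Rightarrow> (real \<Rightarrow> real) set" where
  "besov1 \<beta> T = {f. set_borel_measurable lebesgue {0..T} f \<and> besov1_norm \<beta> T f < \<infinity>}"

definition besov2_norm :: "real \<Rightarrow> real \<Rightarrow> (real \<Rightarrow> real) \<Rightarrow> ennreal" where
  "besov2_norm \<beta> T f =
     (\<integral>\<^sup>+t\<in>{0..T}. ennreal (\<bar>f t\<bar> / t powr \<beta>) \<partial>lebesgue) +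
     (\<integral>\<^sup>+t\<in>{0..T}. (\<integral>\<^sup>+s\<in>{0..t}. ennreal (\<bar>f t - f s\<bar> / (t - s) powr (\<beta> + 1)) \<partial>lebesgue)
        \<partial>lebesgue)"

definition besov2 :: "real \<Rightarrow> real \<Rightarrow> (real \<Rightarrow> real) set" where
  "besov2 \<beta> T = {f. set_borel_measurable lebesgue {0..T} f \<and> besov2_norm \<beta> T f < \<infinity>}"

definition frac_deriv_left :: "real \<Rightarrow> (real \<Rightarrow> real) \<Rightarrow> real \<Rightarrow> real" where
  "frac_deriv_left \<alpha> f x =
     1 / Gamma (1 - \<alpha>) * deriv (\<lambda>y. LINT s:{0..y}|lebesgue. f s * (y - s) powr (- \<alpha>)) x"

definition frac_deriv_right :: "real \<Rightarrow> real \<Rightarrow> (real \<Rightarrow> real) \<Rightarrow> real \<Rightarrow> real" where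
  "frac_deriv_right \<alpha> t f x =
     - 1 / Gamma (1 - \<alpha>) * deriv (\<lambda>y. LINT s:{y..t}|lebesgue. f s * (s - y) powr (- \<alpha>)) x"

(* The integral over {0..t} of f with respect to g, for f and g considered on {0..T},
   exists and equals I. By the classical theory I does not depend on the choice of the
   admissible \<beta>. The term Lim (at_left t) g is the left limit g(t-). *)
definition has_gls_integral ::
    "(real \<Rightarrow> real) \<Rightarrow> (real \<Rightarrow> real) \<Rightarrow> real \<Rightarrow> real \<Rightarrow> real \<Rightarrow> bool" where
  "has_gls_integral f g T t I \<longleftrightarrow>
     (\<exists>\<beta>. 0 < \<beta> \<and> \<beta> < 1 \<and> f \<in> besov2 \<beta> T \<and> g \<in> besov1 (1 - \<beta>) T \<and>
        (let h = (\<lambda>x. frac_deriv_left \<beta> f x *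
                      frac_deriv_right (1 - \<beta>) t (\<lambda>y. Lim (at_left t) g - g y) x)
         in set_integrable lebesgue {0..t} h \<and> (LINT x:{0..t}|lebesgue. h x) = I))"

definition left_deriv :: "(real \<Rightarrow> real) \<Rightarrow> real \<Rightarrow> real" where
  "left_deriv f x = vector_derivative f (at_left x)"

end

(*
Write S = exp B, let Y = log G, so that dY = ((T - s) / T) dB, and D = f'_-, a subgradient of f.

Probabilistic part.  Since the covariances of B are nonnegative, every Riemann approximation of Y_s
is Gaussian with standard deviation at least a multiple of s^H; hence the law of Y_s is at most
c s^(-H) times Lebesgue measure.  For a bounded monotone v the integral of v(x + d) - v(x - d) over
the line is O(d), so the expectation of the time integral of v(Y_t + d) - v(Y_t - d) is O(d), and
summing over d = 2^(-n) bounds this time integral almost surely by C d^k for every k < 1.  With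
v = D o exp, cut off outside the range of Y, and the Hoelder continuity of Y this shows that the
discontinuous integrand X lies in W_2^a for some a > 1 - H.

Pathwise part.  The operator D^a_{0+} X agrees almost everywhere with Marchaud's formula W by
Lebesgue differentiation, and Abel inversion recovers X from W.  For the mollified integrators
g_e(x) = e^(-1) times the integral of g over [x, x + e] the generalized integral is therefore the
ordinary integral of X g_e', and letting e tend to 0 the integral of X against g becomes the limit of
the averages of X_s (g(s + e) - g(s)) / e.  The subgradient inequalities
  0 <= f(G') - f(G) - D(G) (G' - G) <= (D(G') - D(G)) (G' - G)
and the bound C d^k make this limit equal to that of the averages of (f(G(s + e)) - f(G(s))) / e,
which is f(G(T)) - f(G(0)).
*)
theory Submission
  imports Defs
begin

text \<open>The obstacle is that \<open>left_deriv f\<close> may jump: the integrand is then not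
  Hoelder continuous, and neither Young's estimate nor the smooth change of variables applies. What
  replaces regularity is the short time that the path spends near a jump, and this is controlled
  only on average over \<open>\<omega>\<close>. The exponents fit together through a single
  inequality. Let \<open>\<gamma>\<close> be the Hoelder exponent of the path and
  \<open>r powr (\<gamma> * \<kappa>)\<close> the rate of the time-averaged oscillation at lag
  \<open>r\<close>. The integrand asks for \<open>a < \<gamma> * \<kappa>\<close>, the integrator
  for \<open>1 - \<gamma> < a\<close>, and the main remainder of the chain rule is of order
  \<open>e powr (\<gamma> + \<gamma> * \<kappa> - 1)\<close>. All three can be met if and only if
  \<open>1 < \<gamma> * (1 + \<kappa>)\<close>; as \<open>\<kappa>\<close> must stay below 1, this
  is where \<open>H > 1 / 2\<close> enters. The integrand of the generalized integral is a product
  of two pointwise derivatives known only almost everywhere, and no chain rule acts on it directly.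
  Abel inversion serves to trade both fractional derivatives for difference quotients of the
  integrator, to which subgradient inequalities can be applied.\<close>

section \<open>Lebesgue differentiation on the line\<close>

text \<open>A Vitali covering argument. On a bounded interval, outer regularity of the measure with
  density \<open>\<bar>f\<bar> + \<bar>p\<bar>\<close> encloses the points with
  \<open>f \<le> p\<close> in an open set with little excess mass. An interval with average above
  \<open>q\<close> places mass at least \<open>q - p\<close> times its length into that excess, so
  disjoint bad intervals have small total length.\<close>

lemma negligible_upper_density_gt:
  fixes f :: "real \<Rightarrow> real"
  assumes f: "integrable lborel f" and pq: "p < q"
  shows "negligible {x. f x \<le> p \<and>
    (\<forall>d>0. \<exists>a b. a \<le> x \<and> x \<le> b \<and> a < b \<and> b - a < d \<and> q * (b - a) < (LINT u:{a..b}|lborel. f u))}"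
    (is "negligible ?S")
proof -
  have [measurable]: "f \<in> borel_measurable borel"
    using f by auto
  have bounded: "negligible (?S \<inter> {- real N<..<real N})" for N :: nat
    unfolding negligible_outer_le
  proof (intro allI impI)
    fix e :: real assume e: "0 < e"
    \<comment> \<open>The 5 is the enlargement factor of the covering lemma and \<open>q - p\<close>
      the gap between the averages; with this choice the enlarged balls have total length at most
      \<open>e\<close>.\<close>
    define eps where "eps = e * (q - p) / 5"
    have eps: "0 < eps" using e pq by (simp add: eps_def)
    define I where "I = {- real N<..<real N}"
    \<comment> \<open>Adding \<open>\<bar>p\<bar>\<close> makes the density dominate
      \<open>f - p\<close>, the excess of \<open>f\<close> over \<open>p\<close> off
      \<open>A\<close>.\<close>
    define \<phi> where "\<phi> = (\<lambda>u. ennreal ((\<bar>f u\<bar> + \<bar>p\<bar>) * indicator I u))"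
    have [measurable]: "I \<in> sets borel" "\<phi> \<in> borel_measurable borel"
      unfolding I_def \<phi>_def by measurable
    define \<nu> where "\<nu> = density lborel \<phi>"
    have sets_\<nu>[measurable_cong]: "sets \<nu> = sets borel" by (simp add: \<nu>_def)
    have int_\<phi>: "integrable lborel (\<lambda>u. (\<bar>f u\<bar> + \<bar>p\<bar>) * indicator I u)"
    proof -
      have "integrable lborel (\<lambda>u. \<bar>f u\<bar> * indicator I u)"
        using f by (intro integrable_real_mult_indicator) auto
      moreover have "integrable lborel (\<lambda>u. \<bar>p\<bar> * indicator I u)"
        unfolding I_def by (intro integrable_mult_right integrable_real_indicator) auto
      ultimately show ?thesis by (simp add: distrib_right)
    qed
    have fin: "emeasure \<nu> X < \<infinity>" for X
    proof (cases "X \<in> sets borel")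
      case True
      have "emeasure \<nu> X \<le> emeasure \<nu> UNIV" by (intro emeasure_mono) (auto simp: sets_\<nu>)
      also have "\<dots> = (\<integral>\<^sup>+u. \<phi> u \<partial>lborel)"
        by (simp add: \<nu>_def emeasure_density)
      also have "\<dots> < \<infinity>"
        using int_\<phi> unfolding \<phi>_def by (subst nn_integral_eq_integral) auto
      finally show ?thesis .
    qed (simp add: \<nu>_def emeasure_notin_sets)
    define A where "A = {x \<in> I. f x \<le> p}"
    have [measurable]: "A \<in> sets borel" unfolding A_def by measurable
    have "emeasure \<nu> A < emeasure \<nu> A + ennreal eps"
      using fin[of A] eps by (simp add: ennreal_add_left_cancel_less)
    moreover have "emeasure \<nu> A = (INF U\<in>{U. A \<subseteq> U \<and> open U}. emeasure \<nu> U)"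
      by (intro outer_regular) (use fin[of "space \<nu>"] in \<open>auto simp: sets_\<nu>\<close>)
    ultimately obtain U where U: "A \<subseteq> U" "open U" "emeasure \<nu> U < emeasure \<nu> A + ennreal eps"
      by (auto simp: INF_less_iff)
    have [measurable]: "U \<in> sets borel" using U by auto
    have "emeasure \<nu> (U - A) = emeasure \<nu> U - emeasure \<nu> A"
      using U fin[of A] by (intro emeasure_Diff) (auto simp: sets_\<nu>)
    also have "\<dots> \<le> ennreal eps"
      using U(3) eps by (auto simp: ennreal_minus_le_iff less_imp_le)
    finally have small: "emeasure \<nu> (U - A) \<le> ennreal eps" .
    define V where "V = U \<inter> I"
    have openV: "open V" using U by (auto simp: V_def I_def)
    \<comment> \<open>The radii are capped at 1 for the covering lemma; the balls stay inside
      \<open>V\<close> so that their part outside \<open>A\<close> is charged to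
      \<open>U - A\<close>.\<close>
    define K where "K = {(c, r). 0 < r \<and> r \<le> 1 \<and> cball c r \<subseteq> V \<and> q * (2 * r) < (LINT u:cball c r|lborel. f u)}"
    have main: "ennreal (10 * r) \<le> ennreal (5 / (q - p)) * emeasure \<nu> (cball c r - A)" if "(c, r) \<in> K" for c r
    proof -
      have r: "0 < r" "cball c r \<subseteq> V" "q * (2 * r) < (LINT u:cball c r|lborel. f u)"
        using that by (auto simp: K_def)
      have c1: "cball c r = {c-r..c+r}" by (simp add: cball_eq_atLeastAtMost)
      have int1: "integrable lborel (\<lambda>u. p * indicator (cball c r) u)"
        by (intro integrable_mult_right integrable_real_indicator) (use r in \<open>auto simp: c1\<close>)
      have int2: "integrable lborel (\<lambda>u. (\<bar>f u\<bar> + \<bar>p\<bar>) * indicator I u * indicator (cball c r - A) u)"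
        by (intro integrable_real_mult_indicator int_\<phi>) auto
      have "(LINT u:cball c r|lborel. f u) \<le>
          (LINT u|lborel. p * indicator (cball c r) u + (\<bar>f u\<bar> + \<bar>p\<bar>) * indicator I u * indicator (cball c r - A) u)"
        unfolding set_lebesgue_integral_def
      proof (intro integral_mono)
        show "integrable lborel (\<lambda>u. indicat_real (cball c r) u *\<^sub>R f u)"
          using integrable_real_mult_indicator[OF _ f, of "cball c r"] by (simp add: mult.commute)
        show "integrable lborel (\<lambda>u. p * indicator (cball c r) u + (\<bar>f u\<bar> + \<bar>p\<bar>) * indicator I u * indicator (cball c r - A) u)"
          by (intro Bochner_Integration.integrable_add int1 int2)
        show "indicat_real (cball c r) u *\<^sub>R f u \<le> p * indicator (cball c r) u + (\<bar>f u\<bar> + \<bar>p\<bar>) * indicator I u * indicator (cball c r - A) u" for u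
        proof (cases "u \<in> cball c r")
          case True
          then have "u \<in> I" using r by (auto simp: V_def)
          with True show ?thesis by (cases "f u \<le> p") (auto simp: A_def)
        qed auto
      qed
      also have "\<dots> = p * (2 * r) + (LINT u|lborel. (\<bar>f u\<bar> + \<bar>p\<bar>) * indicator I u * indicator (cball c r - A) u)"
        using r by (subst Bochner_Integration.integral_add[OF int1 int2]) (simp add: c1)
      finally have "(q - p) * (2 * r) \<le> (LINT u|lborel. (\<bar>f u\<bar> + \<bar>p\<bar>) * indicator I u * indicator (cball c r - A) u)"
        using r by (simp add: algebra_simps)
      moreover have "emeasure \<nu> (cball c r - A) = ennreal (LINT u|lborel. (\<bar>f u\<bar> + \<bar>p\<bar>) * indicator I u * indicator (cball c r - A) u)"
        unfolding \<nu>_def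
        by (subst emeasure_density, simp, simp, subst nn_integral_eq_integral[symmetric, OF int2])
          (auto intro!: nn_integral_cong simp: \<phi>_def indicator_def)
      ultimately have "ennreal ((q - p) * (2 * r)) \<le> emeasure \<nu> (cball c r - A)"
        by (simp add: ennreal_leI)
      then have "ennreal (5 / (q - p)) * ennreal ((q - p) * (2 * r)) \<le> ennreal (5 / (q - p)) * emeasure \<nu> (cball c r - A)"
        by (intro mult_left_mono) auto
      moreover have "ennreal (5 / (q - p)) * ennreal ((q - p) * (2 * r)) = ennreal (10 * r)"
        using pq r by (simp add: ennreal_mult[symmetric])
      ultimately show ?thesis by simp
    qed
    have cover: "?S \<inter> I \<subseteq> (\<Union>i\<in>K. cball (fst i) (snd i))"
    proof
      fix x assume x: "x \<in> ?S \<inter> I"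
      then have "x \<in> V" using U by (auto simp: V_def A_def)
      then obtain d where d: "0 < d" "ball x d \<subseteq> V" using openV openE by blast
      obtain a b where ab: "a \<le> x" "x \<le> b" "a < b" "b - a < min d 1" "q * (b - a) < (LINT u:{a..b}|lborel. f u)"
        using x d by (auto dest!: spec[of _ "min d 1"])
      have cb: "cball ((a + b) / 2) ((b - a) / 2) = {a..b}"
        by (simp add: cball_eq_atLeastAtMost field_simps)
      have "{a..b} \<subseteq> ball x d" using ab by (auto simp: dist_real_def)
      then have "((a + b) / 2, (b - a) / 2) \<in> K"
        unfolding K_def using ab d by (simp add: cb) (simp add: algebra_simps)
      then show "x \<in> (\<Union>i\<in>K. cball (fst i) (snd i))"
        by (rule UN_I) (use ab cb in simp)
    qed
    have K: "0 < snd i \<and> snd i \<le> 1" if "i \<in> K" for i using that by (auto simp: K_def)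
    obtain C where C: "countable C" "C \<subseteq> K"
      "pairwise (\<lambda>i j. disjnt (cball (fst i) (snd i)) (cball (fst j) (snd j))) C"
      "?S \<inter> I \<subseteq> (\<Union>i\<in>C. cball (fst i) (5 * snd i))"
      by (rule Vitali_covering_lemma_cballs[where a=fst and r=snd and B=1 and K=K and S="?S \<inter> I",
            OF cover K]; (rule that; assumption)?)
    define T where "T = (\<Union>i\<in>C. cball (fst i) (5 * snd i))"
    have [measurable]: "T \<in> sets borel" unfolding T_def using C(1) by (intro sets.countable_UN') auto
    have "emeasure lborel T \<le> (\<integral>\<^sup>+i. emeasure lborel (cball (fst i) (5 * snd i)) \<partial>count_space C)"
    proof -
      have "emeasure lborel T = (\<integral>\<^sup>+x. indicator T x \<partial>lborel)" by simp
      also have "\<dots> \<le> (\<integral>\<^sup>+x. (\<integral>\<^sup>+i. indicator (cball (fst i) (5 * snd i)) x \<partial>count_space C) \<partial>lborel)"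
      proof (intro nn_integral_mono)
        fix x
        show "indicator T x \<le> (\<integral>\<^sup>+i. indicator (cball (fst i) (5 * snd i)) x \<partial>count_space C)"
        proof (cases "x \<in> T")
          case True
          then obtain j where j: "j \<in> C" "x \<in> cball (fst j) (5 * snd j)" by (auto simp: T_def)
          then have "(1::ennreal) = indicator (cball (fst j) (5 * snd j)) x" by simp
          also have "\<dots> \<le> (\<integral>\<^sup>+i. indicator (cball (fst i) (5 * snd i)) x \<partial>count_space C)"
            by (rule nn_integral_ge_point) (rule j)
          finally show ?thesis using True by simp
        qed simp
      qed
      also have "\<dots> = (\<integral>\<^sup>+i. (\<integral>\<^sup>+x. indicator (cball (fst i) (5 * snd i)) x \<partial>lborel) \<partial>count_space C)"
        using C(1) by (intro nn_integral_count_space_nn_integral borel_measurable_indicator) auto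
      finally show ?thesis by simp
    qed
    also have "\<dots> \<le> (\<integral>\<^sup>+i. ennreal (5 / (q - p)) * emeasure \<nu> (cball (fst i) (snd i) - A) \<partial>count_space C)"
    proof (intro nn_integral_mono)
      fix i assume "i \<in> space (count_space C)"
      then have i: "(fst i, snd i) \<in> K" using C by auto
      have "emeasure lborel (cball (fst i) (5 * snd i)) = ennreal (10 * snd i)"
        using i by (auto simp: cball_eq_atLeastAtMost K_def)
      with main[OF i] show "emeasure lborel (cball (fst i) (5 * snd i)) \<le> ennreal (5 / (q - p)) * emeasure \<nu> (cball (fst i) (snd i) - A)"
        by simp
    qed
    also have "\<dots> = ennreal (5 / (q - p)) * (\<integral>\<^sup>+i. emeasure \<nu> (cball (fst i) (snd i) - A) \<partial>count_space C)"
      by (intro nn_integral_cmult) auto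
    also have "(\<integral>\<^sup>+i. emeasure \<nu> (cball (fst i) (snd i) - A) \<partial>count_space C) = emeasure \<nu> (\<Union>i\<in>C. cball (fst i) (snd i) - A)"
    proof (rule emeasure_UN_countable[symmetric])
      show "disjoint_family_on (\<lambda>i. cball (fst i) (snd i) - A) C"
        using C(3) unfolding disjoint_family_on_def pairwise_def disjnt_def by blast
    qed (use C(1) in \<open>auto simp: sets_\<nu>\<close>)
    also have "\<dots> \<le> emeasure \<nu> (U - A)"
    proof (intro emeasure_mono)
      have "cball (fst i) (snd i) \<subseteq> U" if "i \<in> C" for i
        using C(2) that by (force simp: K_def V_def)
      then show "(\<Union>i\<in>C. cball (fst i) (snd i) - A) \<subseteq> U - A" by blast
    qed (simp add: sets_\<nu>)
    also have "\<dots> \<le> ennreal eps" by (rule small)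
    also have "ennreal (5 / (q - p)) * ennreal eps = ennreal e"
      using pq e by (simp add: eps_def ennreal_mult[symmetric])
    finally have T: "emeasure lborel T \<le> ennreal e"
      by (simp add: mult_left_mono)
    have "T \<in> lmeasurable" "measure lebesgue T \<le> e"
    proof -
      have "emeasure lebesgue T \<le> ennreal e" using T by simp
      then show "T \<in> lmeasurable" 
        by (intro fmeasurableI) (auto simp: less_top[symmetric] top_unique)
      show "measure lebesgue T \<le> e"
        using \<open>emeasure lebesgue T \<le> ennreal e\<close> e by (simp add: measure_def enn2real_leI)
    qed
    then show "\<exists>T. ?S \<inter> {- real N<..<real N} \<subseteq> T \<and> T \<in> lmeasurable \<and> measure lebesgue T \<le> e"
      using C(4) by (auto simp: T_def I_def)
  qed
  have "?S \<subseteq> (\<Union>N. ?S \<inter> {- real N<..<real N})"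
  proof
    fix x assume x: "x \<in> ?S"
    obtain N :: nat where "\<bar>x\<bar> < real N" using reals_Archimedean2 by blast
    then show "x \<in> (\<Union>N. ?S \<inter> {- real N<..<real N})" using x by (intro UN_I[of N]) auto
  qed
  moreover have "negligible (\<Union>N. ?S \<inter> {- real N<..<real N})"
    by (intro negligible_countable_Union) (use bounded in auto)
  ultimately show ?thesis by (rule negligible_subset[rotated])
qed


lemma AE_lborel_of_negligible:
  assumes "negligible {x. \<not> P x}"
  shows "AE x in lborel. P x"
proof -
  have "AE x in lebesgue. P x"
    using assms by (intro AE_I'[of "{x. \<not> P x}"]) (auto simp: negligible_iff_null_sets)
  then show ?thesis by (simp only: AE_completion_iff)
qed

text \<open>Rational \<open>p < q\<close> between \<open>f x\<close> and \<open>f x + e\<close> turn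
  the exceptional sets into one countable union. The intervals contain \<open>x\<close> without
  being centred at it, which covers both one-sided difference quotients of the primitive.\<close>

lemma AE_eventually_average_le:
  fixes f :: "real \<Rightarrow> real"
  assumes f: "integrable lborel f"
  shows "AE x in lborel. \<forall>e>0. \<exists>d>0. \<forall>a b. a \<le> x \<longrightarrow> x \<le> b \<longrightarrow> a < b \<longrightarrow> b - a < d \<longrightarrow>
           (LINT u:{a..b}|lborel. f u) \<le> (f x + e) * (b - a)"
proof -
  define P where "P = (\<lambda>q x. \<exists>d>0. \<forall>a b. a \<le> x \<longrightarrow> x \<le> b \<longrightarrow> a < b \<longrightarrow> b - a < d \<longrightarrow>
           (LINT u:{a..b}|lborel. f u) \<le> q * (b - a))"
  have "AE x in lborel. f x \<le> p \<longrightarrow> p < q \<longrightarrow> P q x" if "p \<in> \<rat>" "q \<in> \<rat>" for p q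
  proof (cases "p < q")
    case True
    show ?thesis
      by (rule AE_lborel_of_negligible,
          rule negligible_subset[OF negligible_upper_density_gt[OF f True]])
        (auto simp: P_def not_le)
  qed simp
  then have "AE x in lborel. \<forall>p\<in>\<rat>. \<forall>q\<in>\<rat>. f x \<le> p \<longrightarrow> p < q \<longrightarrow> P q x"
    by (intro AE_ball_countable' countable_rat)
  then show ?thesis
  proof (rule AE_mp, intro AE_I2 impI allI)
    fix x and e :: real
    assume *: "\<forall>p\<in>\<rat>. \<forall>q\<in>\<rat>. f x \<le> p \<longrightarrow> p < q \<longrightarrow> P q x" and e: "0 < e"
    obtain p where p: "p \<in> \<rat>" "f x < p" "p < f x + e" using Rats_dense_in_real[of "f x" "f x + e"] e by auto
    obtain q where q: "q \<in> \<rat>" "p < q" "q < f x + e" using Rats_dense_in_real[of p "f x + e"] p by auto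
    have "P q x" using * p q by auto
    then obtain d where d: "0 < d" "\<And>a b. a \<le> x \<Longrightarrow> x \<le> b \<Longrightarrow> a < b \<Longrightarrow> b - a < d \<Longrightarrow>
           (LINT u:{a..b}|lborel. f u) \<le> q * (b - a)" unfolding P_def by blast
    have "(LINT u:{a..b}|lborel. f u) \<le> (f x + e) * (b - a)" if "a \<le> x" "x \<le> b" "a < b" "b - a < d" for a b
      using order_trans[OF d(2)[OF that] mult_right_mono[of q "f x + e" "b - a"]] q that by simp
    then show "\<exists>d>0. \<forall>a b. a \<le> x \<longrightarrow> x \<le> b \<longrightarrow> a < b \<longrightarrow> b - a < d \<longrightarrow>
           (LINT u:{a..b}|lborel. f u) \<le> (f x + e) * (b - a)" using d(1) by blast
  qed
qed

text \<open>The upper bound for averages is used for \<open>f\<close> and for \<open>- f\<close>.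
  The point lies to the right of \<open>c\<close> because for \<open>y < c\<close> the set integral
  is 0 and not the signed integral.\<close>

theorem lebesgue_differentiation:
  fixes f :: "real \<Rightarrow> real"
  assumes f: "integrable lborel f"
  shows "AE x in lborel. c < x \<longrightarrow> ((\<lambda>y. LINT u:{c..y}|lborel. f u) has_real_derivative f x) (at x)"
proof -
  have "integrable lborel (\<lambda>x. - f x)" using f by simp
  from AE_eventually_average_le[OF this] AE_eventually_average_le[OF f]
  show ?thesis
  proof eventually_elim
    case (elim x)
    show ?case
    proof
      assume c: "c < x"
      have quot: "norm (z /\<^sub>R norm w - 0) = \<bar>z\<bar> / \<bar>w\<bar>" for z w :: real
        by (simp add: abs_mult divide_inverse_commute)
      have int: "set_integrable lborel {a..b} f" for a b
        unfolding set_integrable_def using integrable_real_mult_indicator[OF _ f, of "{a..b}"] by (simp add: mult.commute)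
      have split: "(LINT u:{c..y}|lborel. f u) = (LINT u:{c..z}|lborel. f u) + (LINT u:{z..y}|lborel. f u)"
        if "c \<le> z" "z \<le> y" for y z
      proof -
        have "{c..y} = {c..z} \<union> {z..y}" using that by auto
        moreover have "AE u in lborel. \<not> (u \<in> {c..z} \<and> u \<in> {z..y})"
          using AE_lborel_singleton[of z] by eventually_elim auto
        ultimately show ?thesis
          using set_integral_Un_AE[OF _ _ _ int[of c z] int[of z y]] by simp
      qed
      show "((\<lambda>y. LINT u:{c..y}|lborel. f u) has_real_derivative f x) (at x)"
        unfolding has_field_derivative_def has_derivative_at_within
      proof (intro conjI bounded_linear_mult_right, rule LIM_I)
        fix e :: real assume e: "0 < e"
        obtain d1 where d1: "0 < d1" "\<And>a b. a \<le> x \<Longrightarrow> x \<le> b \<Longrightarrow> a < b \<Longrightarrow> b - a < d1 \<Longrightarrow>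
           (LINT u:{a..b}|lborel. f u) \<le> (f x + e/2) * (b - a)" using elim(2) e half_gt_zero by blast
        obtain d2 where d2: "0 < d2" "\<And>a b. a \<le> x \<Longrightarrow> x \<le> b \<Longrightarrow> a < b \<Longrightarrow> b - a < d2 \<Longrightarrow>
           (LINT u:{a..b}|lborel. - f u) \<le> (- f x + e/2) * (b - a)" using elim(1) e half_gt_zero by blast
        have key: "\<bar>(LINT u:{a..b}|lborel. f u) - f x * (b - a)\<bar> \<le> e/2 * (b - a)"
          if "a \<le> x" "x \<le> b" "a < b" "b - a < min d1 d2" for a b
        proof -
          have "(LINT u:{a..b}|lborel. - f u) = - (LINT u:{a..b}|lborel. f u)"
            by (simp add: set_lebesgue_integral_def)
          then show ?thesis
            using d1(2)[of a b] d2(2)[of a b] that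
            unfolding abs_le_iff distrib_right by simp
        qed
        show "\<exists>s>0. \<forall>y. y \<noteq> x \<and> norm (y - x) < s \<longrightarrow>
          norm (((LINT u:{c..y}|lborel. f u) - (LINT u:{c..x}|lborel. f u) - f x * (y - x)) /\<^sub>R norm (y - x) - 0) < e"
        proof (intro exI[of _ "min (min d1 d2) (x - c)"] conjI allI impI)
          fix y assume y: "y \<noteq> x \<and> norm (y - x) < min (min d1 d2) (x - c)"
          have "\<bar>(LINT u:{c..y}|lborel. f u) - (LINT u:{c..x}|lborel. f u) - f x * (y - x)\<bar> \<le> e / 2 * \<bar>y - x\<bar>"
          proof (cases "x < y")
            case True
            then show ?thesis using key[of x y] split[of x y] y c by simp
          next
            case False
            then have "y < x" "c < y" using y by auto
            then show ?thesis using key[of y x] split[of y x] y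
              unfolding abs_le_iff by (simp add: algebra_simps)
          qed
          then have "\<bar>(LINT u:{c..y}|lborel. f u) - (LINT u:{c..x}|lborel. f u) - f x * (y - x)\<bar> / \<bar>y - x\<bar> \<le> e / 2"
            using y by (simp add: divide_le_eq)
          then show "norm (((LINT u:{c..y}|lborel. f u) - (LINT u:{c..x}|lborel. f u) - f x * (y - x)) /\<^sub>R norm (y - x) - 0) < e"
            unfolding quot using e by linarith
        qed (use d1 d2 c in auto)
      qed
    qed
  qed
qed

section \<open>Power kernels and integrals over triangles\<close>

text \<open>For a nonnegative function, a gauge integral obtained from the fundamental theorem
  already is a Lebesgue integral; in this way the power kernels are integrated up to their
  singularity.\<close>

lemma nonneg_has_integral_lborel:
  fixes f :: "real \<Rightarrow> real"
  assumes [measurable]: "f \<in> borel_measurable borel"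
    and nonneg: "\<And>x. x \<in> {a..b} \<Longrightarrow> 0 \<le> f x" and I: "(f has_integral I) {a..b}"
  shows "(\<integral>\<^sup>+x\<in>{a..b}. ennreal (f x) \<partial>lborel) = ennreal I"
    and "set_integrable lborel {a..b} f" and "(LINT x:{a..b}|lborel. f x) = I"
proof -
  have "((\<lambda>x. if x \<in> {a..b} then f x else 0) has_integral I) UNIV"
    using I by (simp only: has_integral_restrict_UNIV)
  then have "(\<integral>\<^sup>+x. ennreal (if x \<in> {a..b} then f x else 0) \<partial>lborel) = ennreal I"
    using nonneg by (intro nn_integral_has_integral_lborel) auto
  also have "(\<integral>\<^sup>+x. ennreal (if x \<in> {a..b} then f x else 0) \<partial>lborel) = (\<integral>\<^sup>+x. ennreal (f x) * indicator {a..b} x \<partial>lborel)"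
    by (intro nn_integral_cong) (auto simp: indicator_def)
  finally show nn: "(\<integral>\<^sup>+x\<in>{a..b}. ennreal (f x) \<partial>lborel) = ennreal I" .
  have nn': "(\<integral>\<^sup>+x. ennreal (indicator {a..b} x *\<^sub>R f x) \<partial>lborel) = ennreal I"
    unfolding nn[symmetric] by (intro nn_integral_cong) (auto simp: indicator_def)
  have pos: "AE x in lborel. 0 \<le> indicator {a..b} x *\<^sub>R f x"
    using nonneg by (auto simp: indicator_def)
  show "set_integrable lborel {a..b} f"
    unfolding set_integrable_def
    by (intro integrableI_nonneg pos) (use nn' in auto)
  have "0 \<le> I" using I nonneg by (rule has_integral_nonneg)
  then show "(LINT x:{a..b}|lborel. f x) = I"
    unfolding set_lebesgue_integral_def
    by (subst integral_eq_nn_integral[OF _ pos]) (use nn' in auto)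
qed

lemma has_integral_powr_left:
  fixes b s y :: real
  assumes "0 < b" "s \<le> y"
  shows "((\<lambda>x. (x - s) powr (b - 1)) has_integral (y - s) powr b / b) {s..y}"
proof -
  have "((\<lambda>x. (x - s) powr (b - 1)) has_integral (y - s) powr b / b - (s - s) powr b / b) {s..y}"
  proof (rule fundamental_theorem_of_calculus_interior)
    show "continuous_on {s..y} (\<lambda>x. (x - s) powr b / b)"
      using assms by (intro continuous_on_minus continuous_on_divide continuous_on_powr' continuous_on_diff continuous_intros) auto
    show "((\<lambda>x. (x - s) powr b / b) has_vector_derivative (x - s) powr (b - 1)) (at x)" if "x \<in> {s<..<y}" for x
      unfolding has_real_derivative_iff_has_vector_derivative[symmetric]
      using that assms by (auto intro!: derivative_eq_intros)
  qed fact
  then show ?thesis using assms by simp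
qed

lemma has_integral_powr_right:
  fixes b s y :: real
  assumes "0 < b" "s \<le> y"
  shows "((\<lambda>x. (y - x) powr (b - 1)) has_integral (y - s) powr b / b) {s..y}"
proof -
  have "((\<lambda>x. (y - x) powr (b - 1)) has_integral - ((y - y) powr b / b) - (- ((y - s) powr b / b))) {s..y}"
  proof (rule fundamental_theorem_of_calculus_interior)
    show "continuous_on {s..y} (\<lambda>x. - ((y - x) powr b / b))"
      using assms by (intro continuous_on_minus continuous_on_divide continuous_on_powr' continuous_on_diff continuous_intros) auto
    show "((\<lambda>x. - ((y - x) powr b / b)) has_vector_derivative (y - x) powr (b - 1)) (at x)" if "x \<in> {s<..<y}" for x
      unfolding has_real_derivative_iff_has_vector_derivative[symmetric]
      using that assms by (auto intro!: derivative_eq_intros)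
  qed fact
  then show ?thesis using assms by simp
qed

lemma powr_left_lborel:
  fixes b s y :: real
  assumes "0 < b" "s \<le> y"
  shows "(\<integral>\<^sup>+x\<in>{s..y}. ennreal ((x - s) powr (b - 1)) \<partial>lborel) = ennreal ((y - s) powr b / b)"
    and "set_integrable lborel {s..y} (\<lambda>x. (x - s) powr (b - 1))"
    and "(LINT x:{s..y}|lborel. (x - s) powr (b - 1)) = (y - s) powr b / b"
  using nonneg_has_integral_lborel[OF _ _ has_integral_powr_left[OF assms]] by auto

lemma powr_right_lborel:
  fixes b s y :: real
  assumes "0 < b" "s \<le> y"
  shows "(\<integral>\<^sup>+x\<in>{s..y}. ennreal ((y - x) powr (b - 1)) \<partial>lborel) = ennreal ((y - s) powr b / b)"
    and "set_integrable lborel {s..y} (\<lambda>x. (y - x) powr (b - 1))"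
    and "(LINT x:{s..y}|lborel. (y - x) powr (b - 1)) = (y - s) powr b / b"
  using nonneg_has_integral_lborel[OF _ _ has_integral_powr_right[OF assms]] by auto

lemma has_integral_shifted_powr:
  fixes a e y s :: real
  assumes "0 < e" "s \<le> y"
  shows "((\<lambda>x. a * (x - s + e) powr (- a - 1)) has_integral e powr (- a) - (y - s + e) powr (- a)) {s..y}"
    and "((\<lambda>x. a * (y - x + e) powr (- a - 1)) has_integral e powr (- a) - (y - s + e) powr (- a)) {s..y}"
proof -
  have "((\<lambda>x. a * (x - s + e) powr (- a - 1)) has_integral - ((y - s + e) powr (- a)) - (- ((s - s + e) powr (- a)))) {s..y}"
  proof (rule fundamental_theorem_of_calculus_interior)
    show "continuous_on {s..y} (\<lambda>x. - ((x - s + e) powr (- a)))"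
      using assms by (intro continuous_intros) auto
    show "((\<lambda>x. - ((x - s + e) powr (- a))) has_vector_derivative a * (x - s + e) powr (- a - 1)) (at x)" if "x \<in> {s<..<y}" for x
      unfolding has_real_derivative_iff_has_vector_derivative[symmetric]
      using that assms by (auto intro!: derivative_eq_intros)
  qed fact
  then show "((\<lambda>x. a * (x - s + e) powr (- a - 1)) has_integral e powr (- a) - (y - s + e) powr (- a)) {s..y}" by simp
  have "((\<lambda>x. a * (y - x + e) powr (- a - 1)) has_integral (y - y + e) powr (- a) - (y - s + e) powr (- a)) {s..y}"
  proof (rule fundamental_theorem_of_calculus_interior)
    show "continuous_on {s..y} (\<lambda>x. (y - x + e) powr (- a))"
      using assms by (intro continuous_intros) auto
    show "((\<lambda>x. (y - x + e) powr (- a)) has_vector_derivative a * (y - x + e) powr (- a - 1)) (at x)" if "x \<in> {s<..<y}" for x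
      unfolding has_real_derivative_iff_has_vector_derivative[symmetric]
      using that assms by (auto intro!: derivative_eq_intros)
  qed fact
  then show "((\<lambda>x. a * (y - x + e) powr (- a - 1)) has_integral e powr (- a) - (y - s + e) powr (- a)) {s..y}" by simp
qed

lemma triangle_indicator:
  "indicator {0..y} x * indicator {0..x} s = (indicator {0..y} s * indicator {s..y} x :: 'b::{semiring_1,ab_semigroup_mult})"
  for x s y :: real
  by (auto simp: indicator_def)

lemma triangle_nn_swap:
  fixes F :: "real \<Rightarrow> real \<Rightarrow> ennreal"
  assumes [measurable]: "(\<lambda>(x, s). F x s) \<in> borel_measurable (lborel \<Otimes>\<^sub>M lborel)"
  shows "(\<integral>\<^sup>+x\<in>{0..y}. (\<integral>\<^sup>+s\<in>{0..x}. F x s \<partial>lborel) \<partial>lborel) =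
         (\<integral>\<^sup>+s\<in>{0..y}. (\<integral>\<^sup>+x\<in>{s..y}. F x s \<partial>lborel) \<partial>lborel)"
proof -
  have [measurable]: "(\<lambda>x. F x s) \<in> borel_measurable borel" "(\<lambda>s. F x s) \<in> borel_measurable borel" for x s
    using measurable_compose[OF measurable_Pair1' assms, of s] measurable_compose[OF measurable_Pair2' assms, of x] by auto
  have "(\<integral>\<^sup>+x\<in>{0..y}. (\<integral>\<^sup>+s\<in>{0..x}. F x s \<partial>lborel) \<partial>lborel) =
      (\<integral>\<^sup>+x. (\<integral>\<^sup>+s. F x s * (indicator {0..y} x * indicator {0..x} s) \<partial>lborel) \<partial>lborel)"
    by (subst nn_integral_multc[symmetric]) (simp_all add: ac_simps)
  also have "\<dots> = (\<integral>\<^sup>+s. (\<integral>\<^sup>+x. F x s * (indicator {0..y} x * indicator {0..x} s) \<partial>lborel) \<partial>lborel)"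
    by (rule lborel_pair.Fubini'[symmetric]) (simp add: indicator_def, measurable)
  also have "\<dots> = (\<integral>\<^sup>+s\<in>{0..y}. (\<integral>\<^sup>+x\<in>{s..y}. F x s \<partial>lborel) \<partial>lborel)"
    unfolding triangle_indicator
    by (subst nn_integral_multc[symmetric]) (simp_all add: ac_simps)
  finally show ?thesis .
qed

text \<open>A single indicator for the triangle \<open>0 \<le> s \<le> x \<le> y\<close>, outer
  variable first, so that Fubini on the plane yields both iterated integrals with variable
  limits.\<close>

abbreviation on_triangle :: "real \<Rightarrow> (real \<Rightarrow> real \<Rightarrow> real) \<Rightarrow> real \<times> real \<Rightarrow> real" where
  "on_triangle y F \<equiv> \<lambda>(x, s). indicator {0..y} x * indicator {0..x} s * F x s"

lemma triangle_integrable: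
  fixes F :: "real \<Rightarrow> real \<Rightarrow> real"
  assumes [measurable]: "(\<lambda>(x, s). F x s) \<in> borel_measurable (lborel \<Otimes>\<^sub>M lborel)"
    and fin: "(\<integral>\<^sup>+x\<in>{0..y}. (\<integral>\<^sup>+s\<in>{0..x}. ennreal \<bar>F x s\<bar> \<partial>lborel) \<partial>lborel) < \<infinity>"
  shows "integrable (lborel \<Otimes>\<^sub>M lborel) (on_triangle y F)"
proof (rule integrableI_bounded)
  show m[measurable]: "on_triangle y F \<in> borel_measurable (lborel \<Otimes>\<^sub>M lborel)"
    by (simp add: indicator_def)
  have "(\<integral>\<^sup>+z. ennreal (norm (on_triangle y F z)) \<partial>(lborel \<Otimes>\<^sub>M lborel))
      = (\<integral>\<^sup>+x. (\<integral>\<^sup>+s. ennreal \<bar>F x s\<bar> * indicator {0..x} s * indicator {0..y} x \<partial>lborel) \<partial>lborel)"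
    by (subst lborel.nn_integral_fst[symmetric])
      (auto intro!: nn_integral_cong simp: indicator_def)
  also have "\<dots> = (\<integral>\<^sup>+x\<in>{0..y}. (\<integral>\<^sup>+s\<in>{0..x}. ennreal \<bar>F x s\<bar> \<partial>lborel) \<partial>lborel)"
    by (subst nn_integral_multc) auto
  finally show "(\<integral>\<^sup>+z. ennreal (norm (on_triangle y F z)) \<partial>(lborel \<Otimes>\<^sub>M lborel)) < \<infinity>"
    using fin by simp
qed

lemma triangle_integral:
  fixes F :: "real \<Rightarrow> real \<Rightarrow> real"
  assumes "integrable (lborel \<Otimes>\<^sub>M lborel) (on_triangle y F)"
  shows "set_integrable lborel {0..y} (\<lambda>x. LINT s:{0..x}|lborel. F x s)"
    and "(LINT x:{0..y}|lborel. LINT s:{0..x}|lborel. F x s) =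
      (LINT z|(lborel \<Otimes>\<^sub>M lborel). on_triangle y F z)"
    and "set_integrable lborel {0..y} (\<lambda>s. LINT x:{s..y}|lborel. F x s)"
    and "(LINT x:{0..y}|lborel. LINT s:{0..x}|lborel. F x s) = (LINT s:{0..y}|lborel. LINT x:{s..y}|lborel. F x s)"
proof -
  let ?G = "on_triangle y F"
  have 1: "(LINT s|lborel. ?G (x, s)) = indicator {0..y} x *\<^sub>R (LINT s:{0..x}|lborel. F x s)" for x
    by (simp add: set_lebesgue_integral_def mult.assoc)
  have 2: "(LINT x|lborel. ?G (x, s)) = indicator {0..y} s *\<^sub>R (LINT x:{s..y}|lborel. F x s)" for s
    by (simp add: set_lebesgue_integral_def triangle_indicator mult.assoc)
  show "set_integrable lborel {0..y} (\<lambda>x. LINT s:{0..x}|lborel. F x s)"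
    unfolding set_integrable_def 1[symmetric]
    using lborel_pair.integrable_fst'[OF assms] by simp
  show "set_integrable lborel {0..y} (\<lambda>s. LINT x:{s..y}|lborel. F x s)"
    unfolding set_integrable_def 2[symmetric]
    using lborel_pair.integrable_snd[of "\<lambda>x s. ?G (x, s)"] assms by simp
  show eq: "(LINT x:{0..y}|lborel. LINT s:{0..x}|lborel. F x s) = (LINT z|(lborel \<Otimes>\<^sub>M lborel). ?G z)"
    using lborel_pair.integral_fst'[OF assms] unfolding set_lebesgue_integral_def[of lborel "{0..y}"] 1[symmetric] by simp
  have "(LINT s:{0..y}|lborel. LINT x:{s..y}|lborel. F x s) = (LINT z|(lborel \<Otimes>\<^sub>M lborel). ?G z)"
    using lborel_pair.integral_snd[of "\<lambda>x s. ?G (x, s)"] assms unfolding set_lebesgue_integral_def[of lborel "{0..y}"] 2[symmetric] by simp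
  with eq show "(LINT x:{0..y}|lborel. LINT s:{0..x}|lborel. F x s) = (LINT s:{0..y}|lborel. LINT x:{s..y}|lborel. F x s)" by simp
qed

section \<open>Fractional derivatives and Abel inversion\<close>

text \<open>Marchaud's formula for the left derivative of order \<open>a\<close>, multiplied by
  \<open>Gamma (1 - a)\<close>. Division by zero yields 0, so the boundary term vanishes at
  \<open>x = 0\<close> and the integrand at \<open>s = x\<close>.\<close>

definition marchaud :: "real \<Rightarrow> (real \<Rightarrow> real) \<Rightarrow> real \<Rightarrow> real" where
  "marchaud a X x = X x / x powr a + a * (LINT s:{0..x}|lborel. (X x - X s) / (x - s) powr (a + 1))"

lemma triangle_integrable_bounded:
  fixes F :: "real \<Rightarrow> real \<Rightarrow> real"
  assumes [measurable]: "(\<lambda>(x, s). F x s) \<in> borel_measurable (lborel \<Otimes>\<^sub>M lborel)"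
    and bound: "\<And>x s. 0 \<le> s \<Longrightarrow> s \<le> x \<Longrightarrow> x \<le> y \<Longrightarrow> \<bar>F x s\<bar> \<le> C"
  shows "integrable (lborel \<Otimes>\<^sub>M lborel) (on_triangle y F)"
proof (rule triangle_integrable)
  have "(\<integral>\<^sup>+x\<in>{0..y}. (\<integral>\<^sup>+s\<in>{0..x}. ennreal \<bar>F x s\<bar> \<partial>lborel) \<partial>lborel)
      \<le> (\<integral>\<^sup>+x\<in>{0..y}. (\<integral>\<^sup>+s\<in>{0..y}. ennreal C \<partial>lborel) \<partial>lborel)"
  proof (intro nn_integral_mono)
    fix x
    show "(\<integral>\<^sup>+s\<in>{0..x}. ennreal \<bar>F x s\<bar> \<partial>lborel) * indicator {0..y} x
        \<le> (\<integral>\<^sup>+s\<in>{0..y}. ennreal C \<partial>lborel) * indicator {0..y} x"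
    proof (cases "x \<in> {0..y}")
      case True
      have "(\<integral>\<^sup>+s\<in>{0..x}. ennreal \<bar>F x s\<bar> \<partial>lborel) \<le> (\<integral>\<^sup>+s\<in>{0..y}. ennreal C \<partial>lborel)"
        using True bound by (intro nn_integral_mono) (auto simp: indicator_def intro!: ennreal_leI)
      then show ?thesis by (rule mult_right_mono) simp
    qed simp
  qed
  also have "\<dots> < \<infinity>"
    by (simp add: nn_integral_cmult_indicator ennreal_mult_less_top emeasure_lborel_Icc_eq)
  finally show "(\<integral>\<^sup>+x\<in>{0..y}. (\<integral>\<^sup>+s\<in>{0..x}. ennreal \<bar>F x s\<bar> \<partial>lborel) \<partial>lborel) < \<infinity>" .
qed fact

text \<open>Replacing the singular kernel by a shifted one makes both halves of the double integral
  finite, and the two divergent contributions \<open>e powr (- a)\<close> cancel exactly.\<close>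

lemma shifted_kernel_identity:
  fixes X :: "real \<Rightarrow> real"
  assumes [measurable]: "X \<in> borel_measurable borel" and M: "\<And>x. \<bar>X x\<bar> \<le> M"
    and e: "0 < e" and a: "0 < a" and y: "0 \<le> y"
  shows "(LINT z|(lborel \<Otimes>\<^sub>M lborel). on_triangle y (\<lambda>x s. (X x - X s) * (a * (x - s + e) powr (- a - 1))) z) =
         (LINT s:{0..y}|lborel. X s * ((y - s + e) powr (- a) - (s + e) powr (- a)))"
proof -
  define k where "k = (\<lambda>r. a * (r + e) powr (- a - 1))"
  have [measurable]: "k \<in> borel_measurable borel" unfolding k_def by measurable
  have kb: "\<bar>k r\<bar> \<le> a * e powr (- a - 1)" if "0 \<le> r" for r
    unfolding k_def using that a e by (simp add: abs_mult powr_mono2')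
  have "0 \<le> M" using M[of 0] by linarith
  have i1: "integrable (lborel \<Otimes>\<^sub>M lborel) (on_triangle y (\<lambda>x s. X x * k (x - s)))"
    by (rule triangle_integrable_bounded[where C="M * (a * e powr (- a - 1))"], measurable)
      (auto simp: abs_mult intro!: mult_mono M kb \<open>0 \<le> M\<close>)
  have i2: "integrable (lborel \<Otimes>\<^sub>M lborel) (on_triangle y (\<lambda>x s. X s * k (x - s)))"
    by (rule triangle_integrable_bounded[where C="M * (a * e powr (- a - 1))"], measurable)
      (auto simp: abs_mult intro!: mult_mono M kb \<open>0 \<le> M\<close>)
  have kx: "(LINT s:{0..x}|lborel. k (x - s)) = e powr (- a) - (x + e) powr (- a)" if "0 \<le> x" for x
    unfolding k_def using that a has_integral_shifted_powr(2)[OF e that, of a]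
    by (intro nonneg_has_integral_lborel(3)) (auto simp: algebra_simps)
  have ks: "(LINT x:{s..y}|lborel. k (x - s)) = e powr (- a) - (y - s + e) powr (- a)" if "s \<le> y" for s
    unfolding k_def using that a has_integral_shifted_powr(1)[OF e that, of a]
    by (intro nonneg_has_integral_lborel(3)) (auto simp: algebra_simps)
  have j: "set_integrable lborel {0..y} (\<lambda>s. X s * g s)" if [measurable]: "g \<in> borel_measurable borel"
      and "\<And>s. s \<in> {0..y} \<Longrightarrow> \<bar>g s\<bar> \<le> c" for g c
    unfolding set_integrable_def
  proof (rule integrableI_bounded_set_indicator[where B="M * c"])
    show "AE x in lborel. x \<in> {0..y} \<longrightarrow> norm (X x * g x) \<le> M * c"
      using that M by (auto simp: abs_mult intro!: mult_mono \<open>0 \<le> M\<close>)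
  qed (auto simp: emeasure_lborel_Icc_eq)
  have p: "\<bar>e powr (- a) - (s + e) powr (- a)\<bar> \<le> e powr (-a)" if "0 \<le> s" for s
    using powr_mono2'[of "-a" e "s + e"] that a e by (simp add: abs_le_iff)
  have 1: "(LINT z|(lborel \<Otimes>\<^sub>M lborel). on_triangle y (\<lambda>x s. X x * k (x - s)) z) =
      (LINT s:{0..y}|lborel. X s * (e powr (- a) - (s + e) powr (- a)))"
    unfolding triangle_integral(2)[OF i1, symmetric]
    by (intro set_lebesgue_integral_cong) (auto simp: kx)
  have 2: "(LINT z|(lborel \<Otimes>\<^sub>M lborel). on_triangle y (\<lambda>x s. X s * k (x - s)) z) =
      (LINT s:{0..y}|lborel. X s * (e powr (- a) - (y - s + e) powr (- a)))"
    unfolding triangle_integral(2)[OF i2, symmetric] triangle_integral(4)[OF i2]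
    by (intro set_lebesgue_integral_cong) (auto simp: ks)
  have "(LINT z|(lborel \<Otimes>\<^sub>M lborel). on_triangle y (\<lambda>x s. (X x - X s) * (a * (x - s + e) powr (- a - 1))) z) =
      (LINT z|(lborel \<Otimes>\<^sub>M lborel). on_triangle y (\<lambda>x s. X x * k (x - s)) z
         - on_triangle y (\<lambda>x s. X s * k (x - s)) z)"
    by (intro Bochner_Integration.integral_cong) (auto simp: k_def algebra_simps)
  also have "\<dots> = (LINT s:{0..y}|lborel. X s * (e powr (- a) - (s + e) powr (- a))) -
      (LINT s:{0..y}|lborel. X s * (e powr (- a) - (y - s + e) powr (- a)))"
    by (subst Bochner_Integration.integral_diff[OF i1 i2]) (simp add: 1 2)
  also have "\<dots> = (LINT s:{0..y}|lborel. X s * (e powr (- a) - (s + e) powr (- a)) - X s * (e powr (- a) - (y - s + e) powr (- a)))"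
    by (intro set_integral_diff(2)[symmetric] j[where c="e powr (-a)"]) (auto intro!: p)
  finally show ?thesis by (simp add: algebra_simps)
qed

text \<open>The shifted identity is passed to the limit. The shift only decreases the kernel, so the
  double integral is dominated by the unshifted one, finite by \<open>fin\<close>; the single
  integral is dominated by two integrable singularities. The boundary term of
  \<open>marchaud\<close> then cancels \<open>s powr (- a)\<close> and leaves the fractional
  integral that the left derivative differentiates.\<close>

lemma marchaud_integral:
  fixes X :: "real \<Rightarrow> real"
  assumes [measurable]: "X \<in> borel_measurable borel" and M: "\<And>x. \<bar>X x\<bar> \<le> M"
    and a: "0 < a" "a < 1"
    and fin: "(\<integral>\<^sup>+t\<in>{0..T}. (\<integral>\<^sup>+s\<in>{0..t}. ennreal (\<bar>X t - X s\<bar> / (t - s) powr (a + 1)) \<partial>lborel) \<partial>lborel) < \<infinity>"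
    and y: "0 \<le> y" "y \<le> T"
  shows "set_integrable lborel {0..y} (marchaud a X)"
    and "(LINT x:{0..y}|lborel. marchaud a X x) = (LINT s:{0..y}|lborel. X s * (y - s) powr (- a))"
proof -
  have M0: "0 \<le> M" using M[of 0] by linarith
  define H where "H = (\<lambda>x s. (X x - X s) * (a * (x - s) powr (- a - 1)))"
  have H_eq: "H x s = a * ((X x - X s) / (x - s) powr (a + 1))" for x s
    using powr_minus_divide[of "x - s" "a + 1"] by (simp add: H_def)
  have Hm[measurable]: "(\<lambda>(x, s). H x s) \<in> borel_measurable (lborel \<Otimes>\<^sub>M lborel)"
    unfolding H_def by measurable
  have [measurable]: "(\<lambda>s. H x s) \<in> borel_measurable borel" for x
    unfolding H_def by measurable
  have tri: "integrable (lborel \<Otimes>\<^sub>M lborel) (on_triangle y H)"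
  proof (rule triangle_integrable[OF Hm])
    have "(\<integral>\<^sup>+x\<in>{0..y}. (\<integral>\<^sup>+s\<in>{0..x}. ennreal \<bar>H x s\<bar> \<partial>lborel) \<partial>lborel) \<le>
       (\<integral>\<^sup>+t\<in>{0..T}. ennreal a * (\<integral>\<^sup>+s\<in>{0..t}. ennreal (\<bar>X t - X s\<bar> / (t - s) powr (a + 1)) \<partial>lborel) \<partial>lborel)"
    proof (intro nn_integral_mono)
      fix x
      have "(\<integral>\<^sup>+s\<in>{0..x}. ennreal \<bar>H x s\<bar> \<partial>lborel) =
         (\<integral>\<^sup>+s. ennreal a * (ennreal (\<bar>X x - X s\<bar> / (x - s) powr (a + 1)) * indicator {0..x} s) \<partial>lborel)"
        using a by (intro nn_integral_cong) (auto simp: H_eq abs_mult ennreal_mult'[symmetric] indicator_def)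
      also have "\<dots> = ennreal a * (\<integral>\<^sup>+s\<in>{0..x}. ennreal (\<bar>X x - X s\<bar> / (x - s) powr (a + 1)) \<partial>lborel)"
        by (intro nn_integral_cmult) measurable
      finally show "(\<integral>\<^sup>+s\<in>{0..x}. ennreal \<bar>H x s\<bar> \<partial>lborel) * indicator {0..y} x \<le>
          ennreal a * (\<integral>\<^sup>+s\<in>{0..x}. ennreal (\<bar>X x - X s\<bar> / (x - s) powr (a + 1)) \<partial>lborel) * indicator {0..T} x"
        using y by (auto simp: indicator_def)
    qed
    also have "\<dots> = ennreal a * (\<integral>\<^sup>+t\<in>{0..T}. (\<integral>\<^sup>+s\<in>{0..t}. ennreal (\<bar>X t - X s\<bar> / (t - s) powr (a + 1)) \<partial>lborel) \<partial>lborel)"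
      by (subst nn_integral_cmult[symmetric]) (auto simp: mult.assoc indicator_def)
    also have "\<dots> < \<infinity>" using fin by (simp add: ennreal_mult_less_top)
    finally show "(\<integral>\<^sup>+x\<in>{0..y}. (\<integral>\<^sup>+s\<in>{0..x}. ennreal \<bar>H x s\<bar> \<partial>lborel) \<partial>lborel) < \<infinity>" .
  qed
  define e where "e = (\<lambda>n. 1 / real (Suc n))"
  have e: "0 < e n" for n by (simp add: e_def)
  have e0: "e \<longlonglongrightarrow> 0" unfolding e_def using LIMSEQ_inverse_real_of_nat by (simp add: inverse_eq_divide)
  have sing: "set_integrable lborel {0..y} (\<lambda>s. (y - s) powr (- a))" "set_integrable lborel {0..y} (\<lambda>s. s powr (- a))"
    using powr_right_lborel(2)[of "1 - a" 0 y] powr_left_lborel(2)[of "1 - a" 0 y] a y by auto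
  have dom: "set_integrable lborel {0..y} (\<lambda>s. M * ((y - s) powr (- a) + s powr (- a)))"
    by (intro set_integrable_mult_right set_integral_add(1) sing)
  let ?R = "\<lambda>n s. X s * ((y - s + e n) powr (- a) - (s + e n) powr (- a))"
  have lim1: "(\<lambda>n. LINT s:{0..y}|lborel. ?R n s) \<longlonglongrightarrow> (LINT s:{0..y}|lborel. X s * ((y - s) powr (- a) - s powr (- a)))"
    unfolding set_lebesgue_integral_def
  proof (rule integral_dominated_convergence)
    show "integrable lborel (\<lambda>s. indicator {0..y} s *\<^sub>R (M * ((y - s) powr (- a) + s powr (- a))))"
      using dom by (simp add: set_integrable_def)
    show "AE s in lborel. (\<lambda>n. indicator {0..y} s *\<^sub>R ?R n s) \<longlonglongrightarrow> indicator {0..y} s *\<^sub>R (X s * ((y - s) powr (- a) - s powr (- a)))"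
      using AE_lborel_singleton[of 0] AE_lborel_singleton[of y]
    proof eventually_elim
      case (elim s)
      have "(\<lambda>n. ?R n s) \<longlonglongrightarrow> X s * ((y - s + 0) powr (- a) - (s + 0) powr (- a))" 
        using elim by (intro tendsto_intros e0) auto
      then show ?case by (intro tendsto_scaleR tendsto_const) simp
    qed
    show "AE s in lborel. norm (indicator {0..y} s *\<^sub>R ?R n s) \<le> indicator {0..y} s *\<^sub>R (M * ((y - s) powr (- a) + s powr (- a)))" for n
      using AE_lborel_singleton[of 0] AE_lborel_singleton[of y]
    proof eventually_elim
      case (elim s)
      show ?case
      proof (cases "s \<in> {0..y}")
        case True
        have "(y - s + e n) powr (- a) \<le> (y - s) powr (- a)" "(s + e n) powr (- a) \<le> s powr (- a)"
          using True elim e[of n] a by (auto intro!: powr_mono2')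
        then have "\<bar>(y - s + e n) powr (- a) - (s + e n) powr (- a)\<bar> \<le> (y - s) powr (- a) + s powr (- a)"
          using powr_ge_zero[of "y - s + e n" "-a"] powr_ge_zero[of "s + e n" "-a"] by linarith
        then show ?thesis using True M M0 by (auto simp: abs_mult intro!: mult_mono)
      qed simp
    qed
  qed measurable
  let ?F = "\<lambda>n x s. (X x - X s) * (a * (x - s + e n) powr (- a - 1))"
  have lim2: "(\<lambda>n. LINT z|(lborel \<Otimes>\<^sub>M lborel). on_triangle y (?F n) z)
     \<longlonglongrightarrow> (LINT z|(lborel \<Otimes>\<^sub>M lborel). on_triangle y H z)"
  proof (rule integral_dominated_convergence)
    show "integrable (lborel \<Otimes>\<^sub>M lborel) (\<lambda>z. \<bar>on_triangle y H z\<bar>)"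
      using tri by (rule integrable_abs)
    show "(\<lambda>z. on_triangle y (?F n) z) \<in> borel_measurable (lborel \<Otimes>\<^sub>M lborel)" for n
      by (simp add: indicator_def)
    show "(\<lambda>z. on_triangle y H z) \<in> borel_measurable (lborel \<Otimes>\<^sub>M lborel)"
      using tri by (rule borel_measurable_integrable)
    show "AE z in lborel \<Otimes>\<^sub>M lborel. (\<lambda>n. on_triangle y (?F n) z)
        \<longlonglongrightarrow> on_triangle y H z"
    proof (intro AE_I2)
      fix z :: "real \<times> real"
      obtain x s where z: "z = (x, s)" by (cases z)
      \<comment> \<open>On the diagonal the shifted kernel blows up while \<open>0 powr _\<close> is
        0; the vanishing factor \<open>X x - X s\<close> makes the limit correct there.\<close>
      have "(\<lambda>n. ?F n x s) \<longlonglongrightarrow> H x s"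
      proof (cases "x = s")
        case False
        then have "(\<lambda>n. ?F n x s) \<longlonglongrightarrow> (X x - X s) * (a * (x - s + 0) powr (- a - 1))"
          by (intro tendsto_intros e0) auto
        then show ?thesis by (simp add: H_def)
      qed (simp add: H_def)
      then show "(\<lambda>n. on_triangle y (?F n) z)
        \<longlonglongrightarrow> on_triangle y H z"
        unfolding z prod.case by (intro tendsto_mult tendsto_const)
    qed
    show "AE z in lborel \<Otimes>\<^sub>M lborel. norm (on_triangle y (?F n) z)
        \<le> \<bar>on_triangle y H z\<bar>" for n
    proof (intro AE_I2)
      fix z :: "real \<times> real"
      obtain x s where z: "z = (x, s)" by (cases z)
      have "\<bar>?F n x s\<bar> \<le> \<bar>H x s\<bar>" if "s \<le> x"
      proof (cases "x = s")
        case False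
        then have "(x - s + e n) powr (- a - 1) \<le> (x - s) powr (- a - 1)"
          using that a e[of n] by (intro powr_mono2') auto
        then show ?thesis using a by (simp add: H_def abs_mult mult_left_mono)
      qed (simp add: H_def)
      then show "norm (on_triangle y (?F n) z)
        \<le> \<bar>on_triangle y H z\<bar>"
        unfolding z prod.case by (auto simp: indicator_def)
    qed
  qed
  have "(LINT z|(lborel \<Otimes>\<^sub>M lborel). on_triangle y H z) =
      (LINT s:{0..y}|lborel. X s * ((y - s) powr (- a) - s powr (- a)))"
    by (rule LIMSEQ_unique[OF lim2])
      (use lim1 in \<open>simp only: shifted_kernel_identity[OF assms(1) M e a(1) y(1)]\<close>)
  then have dbl: "(LINT x:{0..y}|lborel. LINT s:{0..x}|lborel. H x s) = (LINT s:{0..y}|lborel. X s * ((y - s) powr (- a) - s powr (- a)))"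
    by (simp only: triangle_integral(2)[OF tri])
  have m: "marchaud a X x = X x * x powr (- a) + (LINT s:{0..x}|lborel. H x s)" for x
  proof -
    have "X x / x powr a = X x * x powr (- a)" by (simp add: powr_minus_divide)
    then show ?thesis by (simp add: marchaud_def H_eq del: times_divide_eq_right)
  qed
  have Xint: "set_integrable lborel {0..y} (\<lambda>s. X s * g s)" if "set_integrable lborel {0..y} g" and [measurable]: "g \<in> borel_measurable borel" for g
    unfolding set_integrable_def
  proof (rule Bochner_Integration.integrable_bound)
    show "integrable lborel (\<lambda>s. M * (indicator {0..y} s *\<^sub>R g s))"
      using that unfolding set_integrable_def by (intro integrable_mult_right)
    show "AE s in lborel. norm (indicator {0..y} s *\<^sub>R (X s * g s)) \<le> norm (M * (indicator {0..y} s *\<^sub>R g s))"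
      using M M0 by (auto simp: abs_mult indicator_def intro!: mult_right_mono AE_I2)
  qed measurable
  have i1: "set_integrable lborel {0..y} (\<lambda>s. X s * s powr (- a))"
    and i2: "set_integrable lborel {0..y} (\<lambda>s. X s * (y - s) powr (- a))"
    using sing by (auto intro!: Xint)
  have tri1: "set_integrable lborel {0..y} (\<lambda>x. LINT s:{0..x}|lborel. H x s)"
    by (rule triangle_integral(1)[OF tri])
  show "set_integrable lborel {0..y} (marchaud a X)"
    unfolding m[abs_def] by (rule set_integral_add(1)[OF i1 tri1])
  have "(LINT x:{0..y}|lborel. marchaud a X x) =
     (LINT s:{0..y}|lborel. X s * s powr (- a)) + (LINT s:{0..y}|lborel. X s * ((y - s) powr (- a) - s powr (- a)))"
    unfolding m dbl[symmetric] by (rule set_integral_add(2)[OF i1 tri1])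
  also have "\<dots> = (LINT s:{0..y}|lborel. X s * (y - s) powr (- a))"
    unfolding right_diff_distrib set_integral_diff(2)[OF i2 i1] by simp
  finally show "(LINT x:{0..y}|lborel. marchaud a X x) = (LINT s:{0..y}|lborel. X s * (y - s) powr (- a))" .
qed


section \<open>Identification of the fractional derivatives almost everywhere\<close>

lemma set_lebesgue_integral_lebesgue:
  fixes f :: "real \<Rightarrow> real"
  assumes "set_borel_measurable lborel A f"
  shows "(LINT x:A|lebesgue. f x) = (LINT x:A|lborel. f x)"
  using assms unfolding set_lebesgue_integral_def set_borel_measurable_def by (rule integral_completion)

lemma AE_lborel_reflect:
  assumes "AE x in lborel. P x"
  shows "AE x in lborel. P (t - x :: real)"
proof -
  from assms obtain N where N: "N \<in> null_sets lborel" "{x. \<not> P x} \<subseteq> N"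
    by (auto simp: eventually_ae_filter)
  have [measurable]: "N \<in> sets borel" using N by auto
  have "AE x in lborel. x \<notin> N" using N by (intro AE_not_in)
  then have "AE x in lborel. t + (-1) * x \<notin> N"
    by (intro AE_borel_affine) auto
  then show ?thesis by eventually_elim (use N in auto)
qed

text \<open>Chosen so that both factors of the generalized integral are instances: the integrand
  with order \<open>a\<close>, and the reflected integrator with order \<open>1 - a\<close>.\<close>

locale fractional_integrand =
  fixes X :: "real \<Rightarrow> real" and a M T :: real
  assumes measurable_X [measurable]: "X \<in> borel_measurable borel"
    and bounded_X: "\<And>x. \<bar>X x\<bar> \<le> M"
    and exponent: "0 < a" "a < 1"
    and finite_X: "(\<integral>\<^sup>+t\<in>{0..T}. (\<integral>\<^sup>+s\<in>{0..t}.
        ennreal (\<bar>X t - X s\<bar> / (t - s) powr (a + 1)) \<partial>lborel) \<partial>lborel) < \<infinity>"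
begin

lemmas marchaud_integral = marchaud_integral[OF measurable_X bounded_X exponent finite_X]

text \<open>By \<open>marchaud_integral\<close> the fractional integral is a primitive of
  \<open>marchaud a X\<close>, so Lebesgue differentiation applies. This is what makes the
  \<open>deriv\<close> of the definitions a genuine derivative at almost every point.\<close>

lemma AE_has_derivative_frac_integral:
  "AE x in lborel. 0 < x \<longrightarrow> x < T \<longrightarrow>
     ((\<lambda>y. LINT s:{0..y}|lebesgue. X s * (y - s) powr (- a)) has_real_derivative marchaud a X x) (at x)"
proof (cases "0 < T")
  case True
  define f where "f = (\<lambda>x. indicator {0..T} x * marchaud a X x)"
  have "integrable lborel f"
    using marchaud_integral(1)[of T] True by (simp add: f_def set_integrable_def)
  from lebesgue_differentiation[OF this, of 0] show ?thesis
  proof eventually_elim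
    case (elim x)
    show ?case
    proof (intro impI)
      assume x: "0 < x" "x < T"
      have "((\<lambda>y. LINT u:{0..y}|lborel. f u) has_real_derivative marchaud a X x) (at x)"
        using elim x by (simp add: f_def)
      then show "((\<lambda>y. LINT s:{0..y}|lebesgue. X s * (y - s) powr (- a)) has_real_derivative marchaud a X x) (at x)"
      proof (rule has_field_derivative_transform_within_open[where S="{0<..<T}"])
        fix y assume y: "y \<in> {0<..<T}"
        have "(LINT u:{0..y}|lborel. f u) = (LINT u:{0..y}|lborel. marchaud a X u)"
          using y by (intro set_lebesgue_integral_cong) (auto simp: f_def)
        also have "\<dots> = (LINT s:{0..y}|lborel. X s * (y - s) powr (- a))"
          using y by (intro marchaud_integral(2)) auto
        also have "\<dots> = (LINT s:{0..y}|lebesgue. X s * (y - s) powr (- a))"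
          by (intro set_lebesgue_integral_lebesgue[symmetric]) (simp add: set_borel_measurable_def)
        finally show "(LINT u:{0..y}|lborel. f u) = (LINT s:{0..y}|lebesgue. X s * (y - s) powr (- a))" .
      qed (use x in auto)
    qed
  qed
qed auto

lemma AE_frac_deriv_left:
  "AE x in lborel. 0 < x \<longrightarrow> x < T \<longrightarrow> frac_deriv_left a X x = marchaud a X x / Gamma (1 - a)"
  using AE_has_derivative_frac_integral
  by eventually_elim (auto simp: frac_deriv_left_def dest!: DERIV_imp_deriv)

text \<open>The reflection at \<open>T / 2\<close> exchanges left and right fractional integrals;
  the sign that it produces is absorbed by the factor \<open>- 1\<close> in the definition of the
  right derivative.\<close>

lemma AE_frac_deriv_right:
  "AE x in lborel. 0 < x \<longrightarrow> x < T \<longrightarrow>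
     frac_deriv_right a T (\<lambda>s. X (T - s)) x = marchaud a X (T - x) / Gamma (1 - a)"
  using AE_lborel_reflect[OF AE_has_derivative_frac_integral, of T]
proof eventually_elim
  case (elim x)
  show ?case
  proof (intro impI)
    assume x: "0 < x" "x < T"
    let ?P = "\<lambda>y. LINT s:{0..y}|lebesgue. X s * (y - s) powr (- a)"
    have eq: "(LINT s:{y..T}|lebesgue. X (T - s) * (s - y) powr (- a)) = ?P (T - y)" for y
    proof -
      have "(LINT s:{y..T}|lebesgue. X (T - s) * (s - y) powr (- a)) = (LINT s:{y..T}|lborel. X (T - s) * (s - y) powr (- a))"
        by (intro set_lebesgue_integral_lebesgue) (simp add: set_borel_measurable_def)
      also have "\<dots> = (LINT s|lborel. indicator {0..T - y} s *\<^sub>R (X s * (T - y - s) powr (- a)))"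
        unfolding set_lebesgue_integral_def
        by (subst lborel_integral_real_affine[where c="-1" and t=T])
          (auto intro!: Bochner_Integration.integral_cong simp: indicator_def algebra_simps)
      also have "\<dots> = (LINT s:{0..T - y}|lborel. X s * (T - y - s) powr (- a))"
        by (simp add: set_lebesgue_integral_def)
      also have "\<dots> = ?P (T - y)"
        by (intro set_lebesgue_integral_lebesgue[symmetric]) (simp add: set_borel_measurable_def)
      finally show ?thesis .
    qed
    have "(?P has_real_derivative marchaud a X (T - x)) (at (T - x))"
      using elim x by simp
    then have "((\<lambda>y. ?P (T - y)) has_real_derivative marchaud a X (T - x) * (- 1)) (at x)"
      by (rule DERIV_chain2) (auto intro!: derivative_eq_intros)
    then show "frac_deriv_right a T (\<lambda>s. X (T - s)) x = marchaud a X (T - x) / Gamma (1 - a)"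
      by (simp add: frac_deriv_right_def eq DERIV_imp_deriv)
  qed
qed

end

section \<open>Abel inversion and its dual form\<close>

lemma Beta_kernel_lborel:
  fixes a b s y :: real
  assumes ab: "0 < a" "0 < b" and sy: "s < y"
  shows "(\<integral>\<^sup>+r\<in>{s..y}. ennreal ((r - s) powr (a - 1) * (y - r) powr (b - 1)) \<partial>lborel) =
           ennreal (Beta a b * (y - s) powr (a + b - 1))"
    and "(LINT r:{s..y}|lborel. (r - s) powr (a - 1) * (y - r) powr (b - 1)) = Beta a b * (y - s) powr (a + b - 1)"
proof -
  \<comment> \<open>The substitution \<open>r = s + d * t\<close> reduces everything to the unit
    interval. For \<open>a + b = 1\<close> the remaining power of \<open>d\<close> is 0, which makes
    the inner integral of Abel's inversion a constant.\<close>
  define d where "d = y - s"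
  have d: "0 < d" using sy by (simp add: d_def)
  have Beta0: "0 \<le> Beta a b" using ab by (simp add: Beta_def Gamma_real_pos less_imp_le)
  have "(\<integral>\<^sup>+r\<in>{s..y}. ennreal ((r - s) powr (a - 1) * (y - r) powr (b - 1)) \<partial>lborel) =
     ennreal \<bar>d\<bar> * (\<integral>\<^sup>+t. ennreal ((s + d * t - s) powr (a - 1) * (y - (s + d * t)) powr (b - 1)) * indicator {s..y} (s + d * t) \<partial>lborel)"
    using d by (intro nn_integral_real_affine) auto
  also have "(\<integral>\<^sup>+t. ennreal ((s + d * t - s) powr (a - 1) * (y - (s + d * t)) powr (b - 1)) * indicator {s..y} (s + d * t) \<partial>lborel)
     = (\<integral>\<^sup>+t. ennreal (d powr (a + b - 2)) * (ennreal (t powr (a - 1) * (1 - t) powr (b - 1)) * indicator {0..1} t) \<partial>lborel)"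
  proof (intro nn_integral_cong)
    fix t
    have ind: "indicator {s..y} (s + d * t) = (indicator {0..1} t :: ennreal)"
    proof -
      have "s \<le> s + d * t \<longleftrightarrow> 0 \<le> t" using d by (simp add: zero_le_mult_iff)
      moreover have "s + d * t \<le> y \<longleftrightarrow> t \<le> 1"
        using d mult_le_cancel_left_pos[of d t 1] by (simp add: d_def algebra_simps)
      ultimately show ?thesis by (simp add: indicator_def)
    qed
    show "ennreal ((s + d * t - s) powr (a - 1) * (y - (s + d * t)) powr (b - 1)) * indicator {s..y} (s + d * t) =
       ennreal (d powr (a + b - 2)) * (ennreal (t powr (a - 1) * (1 - t) powr (b - 1)) * indicator {0..1} t)"
    proof (cases "t \<in> {0..1}")
      case True
      have e: "y - (s + d * t) = d * (1 - t)" by (simp add: d_def algebra_simps)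
      have "(d * t) powr (a - 1) * (d * (1 - t)) powr (b - 1) = (d powr (a - 1) * d powr (b - 1)) * (t powr (a - 1) * (1 - t) powr (b - 1))"
        using d True by (simp add: powr_mult)
      also have "d powr (a - 1) * d powr (b - 1) = d powr (a + b - 2)"
        by (simp add: powr_add[symmetric])
      finally show ?thesis using True by (simp add: e ind ennreal_mult[symmetric])
    qed (simp add: ind)
  qed
  also have "\<dots> = ennreal (d powr (a + b - 2)) * (\<integral>\<^sup>+t\<in>{0..1}. ennreal (t powr (a - 1) * (1 - t) powr (b - 1)) \<partial>lborel)"
    by (intro nn_integral_cmult) measurable
  also have "(\<integral>\<^sup>+t\<in>{0..1}. ennreal (t powr (a - 1) * (1 - t) powr (b - 1)) \<partial>lborel) = ennreal (Beta a b)"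
    using has_integral_Beta_real[OF ab] by (intro nonneg_has_integral_lborel(1)) auto
  also have "ennreal \<bar>d\<bar> * (ennreal (d powr (a + b - 2)) * ennreal (Beta a b)) = ennreal (Beta a b * (y - s) powr (a + b - 1))"
  proof -
    have "d * d powr (a + b - 2) = d powr (a + b - 1)"
      using d powr_add[of d 1 "a + b - 2"] by simp
    then show ?thesis using d Beta0
      by (simp add: ennreal_mult[symmetric] mult.assoc[symmetric] d_def)
  qed
  finally show nn: "(\<integral>\<^sup>+r\<in>{s..y}. ennreal ((r - s) powr (a - 1) * (y - r) powr (b - 1)) \<partial>lborel) =
           ennreal (Beta a b * (y - s) powr (a + b - 1))" .
  have "(LINT r:{s..y}|lborel. (r - s) powr (a - 1) * (y - r) powr (b - 1)) =
      enn2real (\<integral>\<^sup>+r. ennreal (indicator {s..y} r *\<^sub>R ((r - s) powr (a - 1) * (y - r) powr (b - 1))) \<partial>lborel)"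
    unfolding set_lebesgue_integral_def by (intro integral_eq_nn_integral) auto
  also have "(\<integral>\<^sup>+r. ennreal (indicator {s..y} r *\<^sub>R ((r - s) powr (a - 1) * (y - r) powr (b - 1))) \<partial>lborel) =
      ennreal (Beta a b * (y - s) powr (a + b - 1))"
    unfolding nn[symmetric] by (intro nn_integral_cong) (auto simp: indicator_def)
  finally show "(LINT r:{s..y}|lborel. (r - s) powr (a - 1) * (y - r) powr (b - 1)) = Beta a b * (y - s) powr (a + b - 1)"
    using Beta0 by simp
qed

lemma AE_eq_if_antiderivatives_eq:
  fixes f g :: "real \<Rightarrow> real"
  assumes f: "set_integrable lborel {0..T} f" and g: "set_integrable lborel {0..T} g"
    and eq: "\<And>y. 0 \<le> y \<Longrightarrow> y \<le> T \<Longrightarrow> (LINT x:{0..y}|lborel. f x) = (LINT x:{0..y}|lborel. g x)"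
  shows "AE x in lborel. 0 < x \<longrightarrow> x < T \<longrightarrow> f x = g x"
proof -
  have eq': "(LINT x:{0..y}|lborel. indicator {0..T} x *\<^sub>R f x) = (LINT x:{0..y}|lborel. indicator {0..T} x *\<^sub>R g x)"
    if "0 \<le> y" "y \<le> T" for y
  proof -
    have "(LINT x:{0..y}|lborel. indicator {0..T} x *\<^sub>R h x) = (LINT x:{0..y}|lborel. h x)" for h :: "real \<Rightarrow> real"
      using that by (intro set_lebesgue_integral_cong) auto
    then show ?thesis using eq that by simp
  qed
  from lebesgue_differentiation[OF f[unfolded set_integrable_def], of 0]
    lebesgue_differentiation[OF g[unfolded set_integrable_def], of 0]
  show ?thesis
  proof eventually_elim
    case (elim x)
    show ?case
    proof (intro impI)
      assume x: "0 < x" "x < T"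
      have F: "((\<lambda>y. LINT u:{0..y}|lborel. indicator {0..T} u *\<^sub>R f u) has_real_derivative f x) (at x)"
        and G: "((\<lambda>y. LINT u:{0..y}|lborel. indicator {0..T} u *\<^sub>R g u) has_real_derivative g x) (at x)"
        using elim x by auto
      have "((\<lambda>y. LINT u:{0..y}|lborel. indicator {0..T} u *\<^sub>R g u) has_real_derivative f x) (at x)"
        by (rule has_field_derivative_transform_within_open[OF F, of "{0<..<T}"]) (use x eq' in auto)
      then show "f x = g x" using G by (rule DERIV_unique)
    qed
  qed
qed

text \<open>As \<open>f\<close> is only integrable, the kernel is integrated first: after the swap
  its inner integral is at most \<open>y powr b / b\<close>, uniformly in \<open>x\<close>. The
  bounded weight \<open>p\<close> is 1 for the inversion and later the derivative of a mollified
  integrator.\<close>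

lemma triangle_integrable_powr_kernel:
  fixes f p :: "real \<Rightarrow> real"
  assumes f: "integrable lborel f" and b: "0 < b" and [measurable]: "p \<in> borel_measurable borel"
    and p: "\<And>x. \<bar>p x\<bar> \<le> P"
  shows "integrable (lborel \<Otimes>\<^sub>M lborel)
     (on_triangle y (\<lambda>r x. f x * (p r * (r - x) powr (b - 1))))"
proof (rule triangle_integrable)
  have [measurable]: "f \<in> borel_measurable borel" using f by auto
  show "(\<lambda>(r, x). f x * (p r * (r - x) powr (b - 1))) \<in> borel_measurable (lborel \<Otimes>\<^sub>M lborel)"
    by measurable
  have P0: "0 \<le> P" using p[of 0] by linarith
  have "(\<integral>\<^sup>+r\<in>{0..y}. (\<integral>\<^sup>+x\<in>{0..r}. ennreal \<bar>f x * (p r * (r - x) powr (b - 1))\<bar> \<partial>lborel) \<partial>lborel) =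
     (\<integral>\<^sup>+x\<in>{0..y}. (\<integral>\<^sup>+r\<in>{x..y}. ennreal \<bar>f x * (p r * (r - x) powr (b - 1))\<bar> \<partial>lborel) \<partial>lborel)"
    by (rule triangle_nn_swap) measurable
  also have "\<dots> \<le> (\<integral>\<^sup>+x. ennreal \<bar>f x\<bar> * ennreal (P * (y powr b / b)) \<partial>lborel)"
  proof (intro nn_integral_mono)
    fix x
    show "(\<integral>\<^sup>+r\<in>{x..y}. ennreal \<bar>f x * (p r * (r - x) powr (b - 1))\<bar> \<partial>lborel) * indicator {0..y} x
        \<le> ennreal \<bar>f x\<bar> * ennreal (P * (y powr b / b))"
    proof (cases "x \<in> {0..y}")
      case True
      have "(\<integral>\<^sup>+r\<in>{x..y}. ennreal \<bar>f x * (p r * (r - x) powr (b - 1))\<bar> \<partial>lborel) \<le>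
          (\<integral>\<^sup>+r. ennreal (\<bar>f x\<bar> * P) * (ennreal ((r - x) powr (b - 1)) * indicator {x..y} r) \<partial>lborel)"
        using p P0 by (intro nn_integral_mono)
          (auto simp: indicator_def abs_mult ennreal_mult'[symmetric] mult.assoc intro!: ennreal_leI mult_left_mono mult_right_mono)
      also have "\<dots> = ennreal (\<bar>f x\<bar> * P) * ennreal ((y - x) powr b / b)"
        using True b by (subst nn_integral_cmult) (auto simp: powr_left_lborel(1))
      also have "\<dots> \<le> ennreal (\<bar>f x\<bar> * P) * ennreal (y powr b / b)"
        using True b by (intro mult_left_mono ennreal_leI divide_right_mono powr_mono2) auto
      finally show ?thesis using True P0 b
        by (simp add: ennreal_mult'[symmetric] mult.assoc)
    qed simp
  qed
  also have "\<dots> < \<infinity>"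
  proof -
    have "(\<integral>\<^sup>+x. ennreal \<bar>f x\<bar> \<partial>lborel) < \<infinity>" using f by (simp add: integrable_iff_bounded)
    then show ?thesis by (simp add: nn_integral_multc ennreal_mult_less_top)
  qed
  finally show "(\<integral>\<^sup>+r\<in>{0..y}. (\<integral>\<^sup>+x\<in>{0..r}. ennreal \<bar>f x * (p r * (r - x) powr (b - 1))\<bar> \<partial>lborel) \<partial>lborel) < \<infinity>" .
qed

context fractional_integrand
begin

lemma integrable_cut_marchaud: "integrable lborel (\<lambda>x. indicator {0..T} x * marchaud a X x)"
proof (cases "0 \<le> T")
  case True
  then show ?thesis using marchaud_integral(1)[of T] by (simp add: set_integrable_def)
qed (simp add: indicator_def)

text \<open>Abel's inversion after one more integration, which makes it valid for every
  \<open>y\<close>. The factor \<open>(y - x) powr a / a\<close> is written as an integral over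
  \<open>r\<close>, the inner primitive of \<open>marchaud\<close> is replaced by the fractional
  integral of \<open>X\<close>, and after a second swap the kernel integrates to
  \<open>Beta (1 - a) a\<close>.\<close>

lemma integral_marchaud_powr:
  assumes y: "0 \<le> y" "y \<le> T"
  shows "(LINT x:{0..y}|lborel. marchaud a X x * ((y - x) powr a / a)) =
         Gamma a * Gamma (1 - a) * (LINT s:{0..y}|lborel. X s)"
proof -
  define W where "W = (\<lambda>x. indicator {0..T} x * marchaud a X x)"
  have W: "integrable lborel W" unfolding W_def by (rule integrable_cut_marchaud)
  have [measurable]: "W \<in> borel_measurable borel" using W by auto
  have M0: "0 \<le> M" using bounded_X[of 0] by linarith
  have W_eq: "W x = marchaud a X x" if "0 \<le> x" "x \<le> y" for x using that y by (simp add: W_def)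
  have tri1: "integrable (lborel \<Otimes>\<^sub>M lborel) (on_triangle y (\<lambda>r x. W x * (y - r) powr (a - 1)))"
  proof (rule triangle_integrable)
    have "(\<integral>\<^sup>+r\<in>{0..y}. (\<integral>\<^sup>+x\<in>{0..r}. ennreal \<bar>W x * (y - r) powr (a - 1)\<bar> \<partial>lborel) \<partial>lborel) \<le>
       (\<integral>\<^sup>+r. (\<integral>\<^sup>+x. ennreal \<bar>W x\<bar> \<partial>lborel) * (ennreal ((y - r) powr (a - 1)) * indicator {0..y} r) \<partial>lborel)"
    proof (intro nn_integral_mono)
      fix r
      have "(\<integral>\<^sup>+x\<in>{0..r}. ennreal \<bar>W x * (y - r) powr (a - 1)\<bar> \<partial>lborel) \<le> (\<integral>\<^sup>+x. ennreal \<bar>W x\<bar> * ennreal ((y - r) powr (a - 1)) \<partial>lborel)"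
        by (intro nn_integral_mono) (auto simp: abs_mult ennreal_mult indicator_def)
      also have "\<dots> = (\<integral>\<^sup>+x. ennreal \<bar>W x\<bar> \<partial>lborel) * ennreal ((y - r) powr (a - 1))"
        by (intro nn_integral_multc) measurable
      finally show "(\<integral>\<^sup>+x\<in>{0..r}. ennreal \<bar>W x * (y - r) powr (a - 1)\<bar> \<partial>lborel) * indicator {0..y} r \<le>
        (\<integral>\<^sup>+x. ennreal \<bar>W x\<bar> \<partial>lborel) * (ennreal ((y - r) powr (a - 1)) * indicator {0..y} r)"
        by (simp add: indicator_def)
    qed
    also have "\<dots> = (\<integral>\<^sup>+x. ennreal \<bar>W x\<bar> \<partial>lborel) * ennreal ((y - 0) powr a / a)"
      using y exponent by (subst nn_integral_cmult) (auto simp: powr_right_lborel(1)[of a 0 y, simplified])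
    also have "\<dots> < \<infinity>"
      using W by (simp add: integrable_iff_bounded ennreal_mult_less_top)
    finally show "(\<integral>\<^sup>+r\<in>{0..y}. (\<integral>\<^sup>+x\<in>{0..r}. ennreal \<bar>W x * (y - r) powr (a - 1)\<bar> \<partial>lborel) \<partial>lborel) < \<infinity>" .
  qed measurable
  let ?K = "\<lambda>r s. X s * ((r - s) powr (- a) * (y - r) powr (a - 1))"
  have tri2: "integrable (lborel \<Otimes>\<^sub>M lborel) (on_triangle y ?K)"
  proof (rule triangle_integrable)
    have "(\<integral>\<^sup>+r\<in>{0..y}. (\<integral>\<^sup>+s\<in>{0..r}. ennreal \<bar>?K r s\<bar> \<partial>lborel) \<partial>lborel) =
       (\<integral>\<^sup>+s\<in>{0..y}. (\<integral>\<^sup>+r\<in>{s..y}. ennreal \<bar>?K r s\<bar> \<partial>lborel) \<partial>lborel)"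
      by (rule triangle_nn_swap) measurable
    also have "\<dots> \<le> (\<integral>\<^sup>+s. ennreal (M * Beta (1 - a) a) * indicator {0..y} s \<partial>lborel)"
    proof (rule nn_integral_mono_AE)
      show "AE s in lborel. (\<integral>\<^sup>+r\<in>{s..y}. ennreal \<bar>?K r s\<bar> \<partial>lborel) * indicator {0..y} s \<le> ennreal (M * Beta (1 - a) a) * indicator {0..y} s"
        using AE_lborel_singleton[of y]
      proof eventually_elim
        case (elim s)
        show ?case
        proof (cases "s \<in> {0..y}")
          case True
          have "(\<integral>\<^sup>+r\<in>{s..y}. ennreal \<bar>?K r s\<bar> \<partial>lborel) \<le>
            (\<integral>\<^sup>+r. ennreal M * (ennreal ((r - s) powr (1 - a - 1) * (y - r) powr (a - 1)) * indicator {s..y} r) \<partial>lborel)"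
            using bounded_X M0 by (intro nn_integral_mono)
              (auto simp: indicator_def abs_mult ennreal_mult'[symmetric] intro!: ennreal_leI mult_right_mono)
          also have "\<dots> = ennreal M * ennreal (Beta (1 - a) a * (y - s) powr (1 - a + a - 1))"
            using True exponent elim
            by (subst nn_integral_cmult, measurable, subst Beta_kernel_lborel(1)) auto
          also have "\<dots> = ennreal (M * Beta (1 - a) a)"
            using True elim M0 by (simp add: ennreal_mult'[symmetric])
          finally show ?thesis using True by simp
        qed simp
      qed
    qed
    also have "\<dots> < \<infinity>" by (simp add: nn_integral_cmult_indicator ennreal_mult_less_top emeasure_lborel_Icc_eq)
    finally show "(\<integral>\<^sup>+r\<in>{0..y}. (\<integral>\<^sup>+s\<in>{0..r}. ennreal \<bar>?K r s\<bar> \<partial>lborel) \<partial>lborel) < \<infinity>" .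
  qed measurable
  have "(LINT x:{0..y}|lborel. marchaud a X x * ((y - x) powr a / a)) = (LINT x:{0..y}|lborel. LINT r:{x..y}|lborel. W x * (y - r) powr (a - 1))"
    using exponent by (intro set_lebesgue_integral_cong) (auto simp: powr_right_lborel(3) W_eq)
  also have "\<dots> = (LINT r:{0..y}|lborel. LINT x:{0..r}|lborel. W x * (y - r) powr (a - 1))"
    by (rule triangle_integral(4)[OF tri1, symmetric])
  also have "\<dots> = (LINT r:{0..y}|lborel. LINT s:{0..r}|lborel. ?K r s)"
  proof (rule set_lebesgue_integral_cong, simp, intro allI impI)
    fix r assume r: "r \<in> {0..y}"
    have "(LINT x:{0..r}|lborel. W x) = (LINT x:{0..r}|lborel. marchaud a X x)"
      using r by (intro set_lebesgue_integral_cong) (auto simp: W_eq)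
    also have "\<dots> = (LINT s:{0..r}|lborel. X s * (r - s) powr (- a))"
      using r y by (intro marchaud_integral(2)) auto
    finally have "(LINT x:{0..r}|lborel. W x) = (LINT s:{0..r}|lborel. X s * (r - s) powr (- a))" .
    then show "(LINT x:{0..r}|lborel. W x * (y - r) powr (a - 1)) = (LINT s:{0..r}|lborel. ?K r s)"
      by (simp add: mult.assoc[symmetric])
  qed
  also have "\<dots> = (LINT s:{0..y}|lborel. LINT r:{s..y}|lborel. ?K r s)"
    by (rule triangle_integral(4)[OF tri2])
  also have "\<dots> = (LINT s:{0..y}|lborel. X s * Beta (1 - a) a)"
    unfolding set_lebesgue_integral_def[of _ "{0..y}"]
  proof (rule integral_cong_AE)
    show "AE s in lborel. indicator {0..y} s *\<^sub>R (LINT r:{s..y}|lborel. ?K r s) = indicator {0..y} s *\<^sub>R (X s * Beta (1 - a) a)"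
      using AE_lborel_singleton[of y]
    proof eventually_elim
      case (elim s)
      show ?case
      proof (cases "s \<in> {0..y}")
        case True
        then have "(LINT r:{s..y}|lborel. (r - s) powr (1 - a - 1) * (y - r) powr (a - 1)) = Beta (1 - a) a * (y - s) powr (1 - a + a - 1)"
          using exponent elim by (intro Beta_kernel_lborel(2)) auto
        then show ?thesis using True elim by simp
      qed simp
    qed
    show "(\<lambda>s. indicator {0..y} s *\<^sub>R (LINT r:{s..y}|lborel. ?K r s)) \<in> borel_measurable lborel"
      using triangle_integral(3)[OF tri2] by (auto simp: set_integrable_def)
  qed measurable
  also have "\<dots> = Beta (1 - a) a * (LINT s:{0..y}|lborel. X s)"
    by (simp add: mult.commute)
  also have "Beta (1 - a) a = Gamma a * Gamma (1 - a)"
    by (simp add: Beta_def)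
  finally show ?thesis .
qed

text \<open>By \<open>integral_marchaud_powr\<close> both sides have the same primitive on
  \<open>{0..T}\<close>, so they agree almost everywhere after differentiation.\<close>

lemma AE_abel_inversion:
  "AE r in lborel. 0 < r \<longrightarrow> r < T \<longrightarrow>
     (LINT x:{0..r}|lborel. marchaud a X x * (r - x) powr (a - 1)) = Gamma a * Gamma (1 - a) * X r"
proof -
  define W where "W = (\<lambda>x. indicator {0..T} x * marchaud a X x)"
  have W: "integrable lborel W" unfolding W_def by (rule integrable_cut_marchaud)
  have tri: "integrable (lborel \<Otimes>\<^sub>M lborel) (on_triangle y (\<lambda>r x. W x * (r - x) powr (a - 1)))" for y
    using triangle_integrable_powr_kernel[OF W exponent(1), of "\<lambda>_. 1" 1] by simp
  have q: "(LINT x:{0..r}|lborel. W x * (r - x) powr (a - 1)) = (LINT x:{0..r}|lborel. marchaud a X x * (r - x) powr (a - 1))"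
    if "r \<le> T" for r
    using that by (intro set_lebesgue_integral_cong) (auto simp: W_def)
  have "AE r in lborel. 0 < r \<longrightarrow> r < T \<longrightarrow>
     (LINT x:{0..r}|lborel. W x * (r - x) powr (a - 1)) = Gamma a * Gamma (1 - a) * X r"
  proof (rule AE_eq_if_antiderivatives_eq)
    show "set_integrable lborel {0..T} (\<lambda>r. LINT x:{0..r}|lborel. W x * (r - x) powr (a - 1))"
      by (rule triangle_integral(1)[OF tri])
    show "set_integrable lborel {0..T} (\<lambda>r. Gamma a * Gamma (1 - a) * X r)"
      unfolding set_integrable_def
      by (rule integrableI_bounded_set_indicator[where B="\<bar>Gamma a * Gamma (1 - a)\<bar> * M"])
        (use bounded_X in \<open>auto simp: emeasure_lborel_Icc_eq abs_mult intro!: mult_left_mono\<close>)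
    fix y assume y: "0 \<le> y" "y \<le> T"
    have "(LINT r:{0..y}|lborel. LINT x:{0..r}|lborel. W x * (r - x) powr (a - 1)) =
        (LINT x:{0..y}|lborel. LINT r:{x..y}|lborel. W x * (r - x) powr (a - 1))"
      by (rule triangle_integral(4)[OF tri])
    also have "\<dots> = (LINT x:{0..y}|lborel. marchaud a X x * ((y - x) powr a / a))"
      using y exponent by (intro set_lebesgue_integral_cong) (auto simp: powr_left_lborel(3) W_def)
    also have "\<dots> = Gamma a * Gamma (1 - a) * (LINT s:{0..y}|lborel. X s)"
      by (rule integral_marchaud_powr[OF y])
    finally show "(LINT r:{0..y}|lborel. LINT x:{0..r}|lborel. W x * (r - x) powr (a - 1)) =
       (LINT r:{0..y}|lborel. Gamma a * Gamma (1 - a) * X r)" by simp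
  qed
  then show ?thesis by eventually_elim (use q in auto)
qed

text \<open>Fractional integration by parts: exchanging the order of integration moves the
  fractional integral from \<open>p\<close> to \<open>marchaud a X\<close>, where the inversion
  removes it. For an integrator with derivative \<open>p\<close> this is the step from the
  generalized to the ordinary integral.\<close>

lemma integral_marchaud_times_powr_kernel:
  assumes [measurable]: "p \<in> borel_measurable borel" and p: "\<And>x. \<bar>p x\<bar> \<le> P"
  shows "(LINT x:{0..T}|lborel. marchaud a X x * (LINT r:{x..T}|lborel. p r * (r - x) powr (a - 1))) =
         Gamma a * Gamma (1 - a) * (LINT r:{0..T}|lborel. X r * p r)"
proof -
  define W where "W = (\<lambda>x. indicator {0..T} x * marchaud a X x)"
  have W: "integrable lborel W" unfolding W_def by (rule integrable_cut_marchaud)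
  have tri: "integrable (lborel \<Otimes>\<^sub>M lborel) (on_triangle T (\<lambda>r x. W x * (p r * (r - x) powr (a - 1))))"
    by (rule triangle_integrable_powr_kernel[OF W exponent(1) _ p]) measurable
  have "(LINT x:{0..T}|lborel. marchaud a X x * (LINT r:{x..T}|lborel. p r * (r - x) powr (a - 1))) =
     (LINT x:{0..T}|lborel. LINT r:{x..T}|lborel. W x * (p r * (r - x) powr (a - 1)))"
    by (intro set_lebesgue_integral_cong) (auto simp: W_def)
  also have "\<dots> = (LINT r:{0..T}|lborel. LINT x:{0..r}|lborel. W x * (p r * (r - x) powr (a - 1)))"
    by (rule triangle_integral(4)[OF tri, symmetric])
  also have "\<dots> = (LINT r:{0..T}|lborel. Gamma a * Gamma (1 - a) * (X r * p r))"
    unfolding set_lebesgue_integral_def[of _ "{0..T}"]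
  proof (rule integral_cong_AE)
    show "(\<lambda>r. indicator {0..T} r *\<^sub>R (LINT x:{0..r}|lborel. W x * (p r * (r - x) powr (a - 1)))) \<in> borel_measurable lborel"
      using triangle_integral(1)[OF tri] by (auto simp: set_integrable_def)
    show "AE r in lborel. indicator {0..T} r *\<^sub>R (LINT x:{0..r}|lborel. W x * (p r * (r - x) powr (a - 1))) =
        indicator {0..T} r *\<^sub>R (Gamma a * Gamma (1 - a) * (X r * p r))"
      using AE_abel_inversion AE_lborel_singleton[of 0] AE_lborel_singleton[of T]
    proof eventually_elim
      case (elim r)
      show ?case
      proof (cases "r \<in> {0..T}")
        case True
        have "(LINT x:{0..r}|lborel. W x * (p r * (r - x) powr (a - 1))) =
          (LINT x:{0..r}|lborel. p r * (marchaud a X x * (r - x) powr (a - 1)))"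
          using True by (intro set_lebesgue_integral_cong) (auto simp: W_def)
        also have "\<dots> = p r * (Gamma a * Gamma (1 - a) * X r)"
          using True elim by simp
        finally show ?thesis using True by simp
      qed simp
    qed
  qed measurable
  also have "\<dots> = Gamma a * Gamma (1 - a) * (LINT r:{0..T}|lborel. X r * p r)"
    by simp
  finally show ?thesis .
qed

end

section \<open>Hoelder continuous integrators\<close>

lemma continuous_on_if_holder:
  fixes g :: "real \<Rightarrow> real"
  assumes hol: "\<And>s t. \<bar>g t - g s\<bar> \<le> L * \<bar>t - s\<bar> powr \<gamma>" and \<gamma>: "0 < \<gamma>"
  shows "continuous_on UNIV g"
  unfolding continuous_on_eq_continuous_at[OF open_UNIV] isCont_def
proof
  fix s
  have "((\<lambda>t. \<bar>t - s\<bar> powr \<gamma>) \<longlongrightarrow> \<bar>s - s\<bar> powr \<gamma>) (at s)"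
    by (rule tendsto_powr'[OF tendsto_rabs[OF tendsto_diff[OF tendsto_ident_at tendsto_const]] tendsto_const])
      (use \<gamma> in simp)
  then have lim0: "((\<lambda>t. L * \<bar>t - s\<bar> powr \<gamma>) \<longlongrightarrow> 0) (at s)"
    using tendsto_mult_right_zero by simp
  have "((\<lambda>t. g t - g s) \<longlongrightarrow> 0) (at s)"
    by (rule Lim_null_comparison[OF always_eventually lim0]) (simp add: hol)
  then show "(g \<longlongrightarrow> g s) (at s)" by (simp add: LIM_zero_iff)
qed

text \<open>\<open>Gamma a\<close> times Marchaud's form of the right derivative of order
  \<open>1 - a\<close> at \<open>x\<close> of the function \<open>g T - g\<close>; the differences
  of that function have turned into \<open>g r - g x\<close>, and the order is expressed through
  \<open>a\<close>.\<close>

definition weyl :: "real \<Rightarrow> real \<Rightarrow> (real \<Rightarrow> real) \<Rightarrow> real \<Rightarrow> real" where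
  "weyl a T g x = (g T - g x) * (T - x) powr (a - 1) +
     (1 - a) * (LINT r:{x..T}|lborel. (g r - g x) * (r - x) powr (a - 2))"

lemma borel_measurable_weyl [measurable]:
  assumes [measurable]: "g \<in> borel_measurable borel"
  shows "weyl a T g \<in> borel_measurable borel"
proof -
  have "(\<lambda>x. LINT r:{x..T}|lborel. (g r - g x) * (r - x) powr (a - 2)) \<in> borel_measurable borel"
  proof -
    have "(\<lambda>(x, r). (if x \<le> r \<and> r \<le> T then 1 else 0) * ((g r - g x) * (r - x) powr (a - 2)))
        \<in> borel_measurable (borel \<Otimes>\<^sub>M lborel)"
      by measurable
    then have "(\<lambda>x. LINT r|lborel. (if x \<le> r \<and> r \<le> T then 1 else 0) * ((g r - g x) * (r - x) powr (a - 2)))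
        \<in> borel_measurable borel"
      by (rule lborel.borel_measurable_lebesgue_integral)
    then show ?thesis by (simp add: set_lebesgue_integral_def indicator_def)
  qed
  then show ?thesis unfolding weyl_def[abs_def] by measurable
qed

text \<open>The constant \<open>L\<close> is an explicit parameter because one and the same
  \<open>L\<close> has to serve a whole sequence of mollified functions.\<close>

locale holder_function =
  fixes g :: "real \<Rightarrow> real" and L \<gamma> :: real
  assumes holder: "\<And>s t. \<bar>g t - g s\<bar> \<le> L * \<bar>t - s\<bar> powr \<gamma>" and \<gamma>_pos: "0 < \<gamma>"
begin

lemma L_nonneg: "0 \<le> L" using holder[of 1 0] by simp

lemma continuous: "continuous_on UNIV g"
  using holder \<gamma>_pos by (rule continuous_on_if_holder)

lemma measurable_g [measurable]: "g \<in> borel_measurable borel"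
  using continuous by (rule borel_measurable_continuous_onI)

text \<open>The exponent is left in the form \<open>b - 1\<close> with
  \<open>b = \<gamma> + a - 1\<close>, as in \<open>powr_left_lborel\<close>; the condition
  \<open>1 < \<gamma> + a\<close> is then \<open>0 < b\<close>.\<close>

lemma kernel_le: "x \<le> r \<Longrightarrow> \<bar>(g r - g x) * (r - x) powr (a - 2)\<bar> \<le> L * (r - x) powr (\<gamma> + a - 1 - 1)"
proof -
  assume "x \<le> r"
  then have "\<bar>(g r - g x) * (r - x) powr (a - 2)\<bar> \<le> (L * (r - x) powr \<gamma>) * (r - x) powr (a - 2)"
    using holder[of r x] by (auto simp: abs_mult intro!: mult_right_mono)
  also have "\<dots> = L * (r - x) powr (\<gamma> + (a - 2))"
    by (simp add: powr_add)
  also have "\<gamma> + (a - 2) = \<gamma> + a - 1 - 1" by simp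
  finally show ?thesis .
qed

lemma set_integrable_kernel:
  assumes "1 < \<gamma> + a" "x \<le> T"
  shows "set_integrable lborel {x..T} (\<lambda>r. (g r - g x) * (r - x) powr (a - 2))"
  unfolding set_integrable_def
proof (rule Bochner_Integration.integrable_bound)
  show "integrable lborel (\<lambda>r. L * (indicator {x..T} r *\<^sub>R (r - x) powr (\<gamma> + a - 1 - 1)))"
    using powr_left_lborel(2)[of "\<gamma> + a - 1" x T] assms
    unfolding set_integrable_def by (intro integrable_mult_right) simp
  show "AE r in lborel. norm (indicator {x..T} r *\<^sub>R ((g r - g x) * (r - x) powr (a - 2)))
      \<le> norm (L * (indicator {x..T} r *\<^sub>R (r - x) powr (\<gamma> + a - 1 - 1)))"
    using kernel_le[of x _ a] L_nonneg by (auto simp: indicator_def abs_mult intro!: AE_I2)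
qed measurable

text \<open>The bound depends on \<open>g\<close> only through \<open>L\<close> and
  \<open>\<gamma>\<close>, so it serves as a dominating constant for all mollified integrators at
  once.\<close>

lemma abs_weyl_le:
  assumes "1 < \<gamma> + a" "a < 1" "0 \<le> x" "x \<le> T"
  shows "\<bar>weyl a T g x\<bar> \<le> L * T powr (\<gamma> + a - 1) * (1 + (1 - a) / (\<gamma> + a - 1))"
proof -
  define b where "b = \<gamma> + a - 1"
  have b: "0 < b" using assms by (simp add: b_def)
  have mono: "(T - x) powr b \<le> T powr b" using assms b by (intro powr_mono2) auto
  have "\<bar>(g T - g x) * (T - x) powr (a - 1)\<bar> \<le> (L * (T - x) powr \<gamma>) * (T - x) powr (a - 1)"
    using holder[of T x] assms by (auto simp: abs_mult intro!: mult_right_mono)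
  also have "\<dots> = L * (T - x) powr b" by (simp add: powr_add[symmetric] b_def add_diff_eq)
  also have "\<dots> \<le> L * T powr b" using mono L_nonneg by (intro mult_left_mono)
  finally have 1: "\<bar>(g T - g x) * (T - x) powr (a - 1)\<bar> \<le> L * T powr b" .
  have "\<bar>LINT r:{x..T}|lborel. (g r - g x) * (r - x) powr (a - 2)\<bar> \<le> (LINT r:{x..T}|lborel. L * (r - x) powr (b - 1))"
    unfolding set_lebesgue_integral_def real_norm_def[symmetric]
  proof (rule Bochner_Integration.integral_norm_bound_integral)
    show "integrable lborel (\<lambda>r. indicator {x..T} r *\<^sub>R ((g r - g x) * (r - x) powr (a - 2)))"
      using set_integrable_kernel[of a x T] assms by (simp add: set_integrable_def)
    show "integrable lborel (\<lambda>r. indicator {x..T} r *\<^sub>R (L * (r - x) powr (b - 1)))"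
      using b assms unfolding set_integrable_def[symmetric]
      by (intro set_integrable_mult_right powr_left_lborel(2)) auto
    show "norm (indicator {x..T} r *\<^sub>R ((g r - g x) * (r - x) powr (a - 2))) \<le> indicator {x..T} r *\<^sub>R (L * (r - x) powr (b - 1))" for r
      using kernel_le[of x r a] by (auto simp: indicator_def b_def)
  qed
  also have "\<dots> = L * ((T - x) powr b / b)"
    using b assms by (simp add: powr_left_lborel(3))
  also have "\<dots> \<le> L * (T powr b / b)"
    using mono L_nonneg b by (intro mult_left_mono divide_right_mono) auto
  finally have 2: "\<bar>LINT r:{x..T}|lborel. (g r - g x) * (r - x) powr (a - 2)\<bar> \<le> L * (T powr b / b)" .
  have "\<bar>weyl a T g x\<bar> \<le> \<bar>(g T - g x) * (T - x) powr (a - 1)\<bar> +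
     (1 - a) * \<bar>LINT r:{x..T}|lborel. (g r - g x) * (r - x) powr (a - 2)\<bar>"
    unfolding weyl_def using assms by (intro order_trans[OF abs_triangle_ineq]) (simp add: abs_mult)
  also have "\<dots> \<le> L * T powr b + (1 - a) * (L * (T powr b / b))"
    using assms by (intro add_mono 1 mult_left_mono 2) auto
  also have "\<dots> = L * T powr b * (1 + (1 - a) / b)" by (simp add: algebra_simps)
  finally show ?thesis by (simp add: b_def)
qed

end

text \<open>The common Hoelder constant dominates all kernels, so pointwise convergence of the
  integrators is enough.\<close>

lemma weyl_tendsto:
  fixes g :: "real \<Rightarrow> real" and G :: "nat \<Rightarrow> real \<Rightarrow> real"
  assumes lim: "\<And>x. (\<lambda>n. G n x) \<longlonglongrightarrow> g x" and hol: "\<And>n. holder_function (G n) L \<gamma>"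
    and [measurable]: "g \<in> borel_measurable borel"
    and a: "1 < \<gamma> + a" and x: "x \<le> T"
  shows "(\<lambda>n. weyl a T (G n) x) \<longlonglongrightarrow> weyl a T g x"
proof -
  note [measurable] = holder_function.measurable_g[OF hol]
  have "(\<lambda>n. LINT r:{x..T}|lborel. (G n r - G n x) * (r - x) powr (a - 2)) \<longlonglongrightarrow>
     (LINT r:{x..T}|lborel. (g r - g x) * (r - x) powr (a - 2))"
    unfolding set_lebesgue_integral_def
  proof (rule integral_dominated_convergence)
    show "integrable lborel (\<lambda>r. indicator {x..T} r *\<^sub>R (L * (r - x) powr (\<gamma> + a - 1 - 1)))"
      using a x unfolding set_integrable_def[symmetric]
      by (intro set_integrable_mult_right powr_left_lborel(2)) auto
    show "AE r in lborel. (\<lambda>n. indicator {x..T} r *\<^sub>R ((G n r - G n x) * (r - x) powr (a - 2)))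
        \<longlonglongrightarrow> indicator {x..T} r *\<^sub>R ((g r - g x) * (r - x) powr (a - 2))"
      by (intro AE_I2 tendsto_intros lim)
    show "AE r in lborel. norm (indicator {x..T} r *\<^sub>R ((G n r - G n x) * (r - x) powr (a - 2)))
        \<le> indicator {x..T} r *\<^sub>R (L * (r - x) powr (\<gamma> + a - 1 - 1))" for n
      using holder_function.kernel_le[OF hol, of x _ n a] by (auto simp: indicator_def intro!: AE_I2)
  qed measurable
  then show ?thesis unfolding weyl_def by (intro tendsto_intros lim)
qed

text \<open>Integration by parts with the product \<open>(g r - g x) * (r - x) powr (a - 1)\<close>.
  A bounded derivative makes \<open>g\<close> Lipschitz, so this product is continuous at
  \<open>r = x\<close> with value 0, and the fundamental theorem applies up to the singular
  endpoint.\<close>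

lemma weyl_of_C1:
  fixes g p :: "real \<Rightarrow> real"
  assumes der: "\<And>x. (g has_real_derivative p x) (at x)" and [measurable]: "p \<in> borel_measurable borel"
    and p: "\<And>x. \<bar>p x\<bar> \<le> P" and a: "0 < a" and x: "x \<le> T"
  shows "weyl a T g x = (LINT r:{x..T}|lborel. p r * (r - x) powr (a - 1))"
proof -
  have lip: "\<bar>g t - g s\<bar> \<le> P * \<bar>t - s\<bar>" for s t
    using field_differentiable_bound[of UNIV g p P t s] der p by (auto simp: has_field_derivative_at_within)
  interpret holder_function g P 1
    using lip by unfold_locales auto
  have ip: "set_integrable lborel {x..T} (\<lambda>r. p r * (r - x) powr (a - 1))"
    unfolding set_integrable_def
  proof (rule Bochner_Integration.integrable_bound)
    show "integrable lborel (\<lambda>r. P * (indicator {x..T} r *\<^sub>R (r - x) powr (a - 1)))"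
      using powr_left_lborel(2)[of a x T] a x
      unfolding set_integrable_def by (intro integrable_mult_right) simp
    show "AE r in lborel. norm (indicator {x..T} r *\<^sub>R (p r * (r - x) powr (a - 1)))
      \<le> norm (P * (indicator {x..T} r *\<^sub>R (r - x) powr (a - 1)))"
      using p L_nonneg by (auto simp: indicator_def abs_mult intro!: AE_I2 mult_right_mono)
  qed measurable
  have ik: "set_integrable lborel {x..T} (\<lambda>r. (g r - g x) * (r - x) powr (a - 2))"
    using a x by (intro set_integrable_kernel) auto
  have sum: "set_integrable lborel {x..T} (\<lambda>r. p r * (r - x) powr (a - 1) + (a - 1) * ((g r - g x) * (r - x) powr (a - 2)))"
    by (intro set_integral_add(1) set_integrable_mult_right ip ik)
  define F where "F = (\<lambda>r. (g r - g x) * (r - x) powr (a - 1))"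
  have "((\<lambda>r. p r * (r - x) powr (a - 1) + (a - 1) * ((g r - g x) * (r - x) powr (a - 2))) has_integral F T - F x) {x..T}"
  proof (rule fundamental_theorem_of_calculus_interior)
    show "x \<le> T" by (rule x)
    show "continuous_on {x..T} F"
      unfolding continuous_on_eq_continuous_within
    proof
      fix r assume r: "r \<in> {x..T}"
      show "continuous (at r within {x..T}) F"
      proof (cases "r = x")
        case True
        have "((\<lambda>t. \<bar>t - x\<bar> powr a) \<longlongrightarrow> \<bar>x - x\<bar> powr a) (at x within {x..T})"
          by (rule tendsto_powr'[OF tendsto_rabs[OF tendsto_diff[OF tendsto_ident_at tendsto_const]] tendsto_const])
            (use a in simp)
        then have lim0: "((\<lambda>t. P * \<bar>t - x\<bar> powr a) \<longlongrightarrow> 0) (at x within {x..T})"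
          using tendsto_mult_right_zero by simp
        have "norm (F t) \<le> P * \<bar>t - x\<bar> powr a" if "t \<in> {x..T}" for t
        proof -
          have "norm (F t) \<le> (P * \<bar>t - x\<bar>) * (t - x) powr (a - 1)"
            unfolding F_def using lip[of t x] by (auto simp: abs_mult intro!: mult_right_mono)
          also have "\<dots> = P * \<bar>t - x\<bar> powr a"
            using that by (cases "t = x") (auto simp: powr_diff)
          finally show ?thesis .
        qed
        then have "\<forall>\<^sub>F t in at x within {x..T}. norm (F t) \<le> P * \<bar>t - x\<bar> powr a"
          unfolding eventually_at_filter by (intro always_eventually) blast
        then have "(F \<longlongrightarrow> 0) (at x within {x..T})"
          using lim0 by (rule Lim_null_comparison)
        then show ?thesis using True by (simp add: continuous_within F_def)
      next
        case False
        then have "isCont F r"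
          unfolding F_def using r by (intro continuous_intros DERIV_isCont[OF der]) auto
        then show ?thesis by (rule continuous_at_imp_continuous_at_within)
      qed
    qed
    fix r assume r: "r \<in> {x<..<T}"
    show "(F has_vector_derivative p r * (r - x) powr (a - 1) + (a - 1) * ((g r - g x) * (r - x) powr (a - 2))) (at r)"
      unfolding has_real_derivative_iff_has_vector_derivative[symmetric] F_def
      using r by (auto intro!: derivative_eq_intros der)
  qed
  moreover have "((\<lambda>r. p r * (r - x) powr (a - 1) + (a - 1) * ((g r - g x) * (r - x) powr (a - 2))) has_integral
     (LINT r:{x..T}|lborel. p r * (r - x) powr (a - 1) + (a - 1) * ((g r - g x) * (r - x) powr (a - 2)))) {x..T}"
    unfolding set_borel_integral_eq_integral(2)[OF sum]
    using set_borel_integral_eq_integral(1)[OF sum] by (rule integrable_integral)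
  ultimately have "F T - F x = (LINT r:{x..T}|lborel. p r * (r - x) powr (a - 1) + (a - 1) * ((g r - g x) * (r - x) powr (a - 2)))"
    by (rule has_integral_unique)
  also have "\<dots> = (LINT r:{x..T}|lborel. p r * (r - x) powr (a - 1)) + (a - 1) * (LINT r:{x..T}|lborel. (g r - g x) * (r - x) powr (a - 2))"
    by (subst set_integral_add(2)) (auto intro: ip ik)
  finally show ?thesis by (simp add: weyl_def F_def algebra_simps)
qed

text \<open>The approximants are forward averages, because their derivatives are exactly the
  difference quotients in which the limit is to be expressed. An increment of an average is an
  average of increments, so \<open>L\<close> is preserved; this is proved by the mean value
  inequality in the length of the window.\<close>

lemma (in holder_function) C1_approximation:
  fixes e :: "nat \<Rightarrow> real"
  assumes e: "\<And>n. 0 < e n" "e \<longlonglongrightarrow> 0"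
  obtains G :: "nat \<Rightarrow> real \<Rightarrow> real" where
    "\<And>x. (\<lambda>n. G n x) \<longlonglongrightarrow> g x" "\<And>n. holder_function (G n) L \<gamma>"
    "\<And>n x. (G n has_real_derivative (g (x + e n) - g x) / e n) (at x)"
proof -
  obtain F where F: "\<And>x. (F has_real_derivative g x) (at x)"
    using einterval_antiderivative[of "-\<infinity>" "\<infinity>" g] continuous
    by (auto simp: continuous_on_eq_continuous_at has_real_derivative_iff_has_vector_derivative)
  define G where "G n x = (F (x + e n) - F x) / e n" for n x
  show thesis
  proof
    show "(\<lambda>n. G n x) \<longlonglongrightarrow> g x" for x
    proof -
      have "((\<lambda>h. (F (x + h) - F x) / h) \<longlongrightarrow> g x) (at 0)" using F[of x] by (rule DERIV_D)
      moreover have "filterlim e (at 0) sequentially"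
        using e by (auto simp: filterlim_at less_imp_neq[THEN not_sym] intro: always_eventually)
      ultimately show ?thesis unfolding G_def by (rule filterlim_compose)
    qed
    show "(G n has_real_derivative (g (x + e n) - g x) / e n) (at x)" for n x
      unfolding G_def using e(1)[of n]
      by (auto intro!: derivative_eq_intros DERIV_chain2[OF F] F)
    show "holder_function (G n) L \<gamma>" for n
    proof
      fix s t
      define K where "K u = F (t + u) - F (s + u)" for u
      have K: "(K has_real_derivative g (t + u) - g (s + u)) (at u)" for u
        unfolding K_def by (auto intro!: derivative_eq_intros DERIV_chain2[OF F])
      have bound: "\<bar>g (t + u) - g (s + u)\<bar> \<le> L * \<bar>t - s\<bar> powr \<gamma>" for u
        using holder[of "t + u" "s + u"] by simp
      have "norm (K (e n) - K 0) \<le> (L * \<bar>t - s\<bar> powr \<gamma>) * norm (e n - 0)"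
        using bound
        by (intro field_differentiable_bound[of UNIV K "\<lambda>u. g (t + u) - g (s + u)"])
          (auto intro: K has_field_derivative_at_within)
      moreover have "G n t - G n s = (K (e n) - K 0) / e n"
        by (simp add: G_def K_def diff_divide_distrib[symmetric])
      ultimately show "\<bar>G n t - G n s\<bar> \<le> L * \<bar>t - s\<bar> powr \<gamma>"
        using e(1)[of n] by (simp add: divide_le_eq)
    qed (rule \<gamma>_pos)
  qed
qed


section \<open>The generalized integral as a limit of difference quotients\<close>

lemma borel_measurable_lebesgue_cong_AE:
  fixes f g :: "real \<Rightarrow> real"
  assumes f: "f \<in> borel_measurable lebesgue" and eq: "AE x in lebesgue. f x = g x"
  shows "g \<in> borel_measurable lebesgue"
proof (rule measurableI)
  fix A :: "real set" assume "A \<in> sets borel"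
  then have m: "f -` A \<inter> space lebesgue \<in> sets lebesgue" using f by (rule measurable_sets[rotated])
  have ae: "AE x in lebesgue. x \<in> f -` A \<inter> space lebesgue \<longleftrightarrow> x \<in> g -` A \<inter> space lebesgue"
    using eq by eventually_elim auto
  show "g -` A \<inter> space lebesgue \<in> sets lebesgue"
    by (rule complete_measure.in_sets_AE[OF completion.complete_measure_axioms ae m]) simp
qed simp

text \<open>The integrand of the generalized integral is built from \<open>deriv\<close> and known
  only through an almost everywhere formula; completeness of \<open>lebesgue\<close> carries
  measurability and integrability over from that formula.\<close>

lemma set_integral_lebesgue_cong_AE:
  fixes f g :: "real \<Rightarrow> real"
  assumes f: "set_integrable lebesgue A f" and eq: "AE x in lebesgue. x \<in> A \<longrightarrow> f x = g x"
  shows "set_integrable lebesgue A g" and "(LINT x:A|lebesgue. g x) = (LINT x:A|lebesgue. f x)"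
proof -
  have eq': "AE x in lebesgue. indicator A x *\<^sub>R f x = indicator A x *\<^sub>R g x"
    using eq by eventually_elim (auto simp: indicator_def)
  have mf: "(\<lambda>x. indicator A x *\<^sub>R f x) \<in> borel_measurable lebesgue"
    using f unfolding set_integrable_def by (rule borel_measurable_integrable)
  have mg: "(\<lambda>x. indicator A x *\<^sub>R g x) \<in> borel_measurable lebesgue"
    using mf eq' by (rule borel_measurable_lebesgue_cong_AE)
  show "set_integrable lebesgue A g"
    using f unfolding set_integrable_def by (subst (asm) integrable_cong_AE[OF mf mg eq'])
  show "(LINT x:A|lebesgue. g x) = (LINT x:A|lebesgue. f x)"
    unfolding set_lebesgue_integral_def by (rule integral_cong_AE[OF mf mg eq', symmetric])
qed

text \<open>The integrator is extended from [0, T] by constants, so that the shifts \<open>s + e\<close> below never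
  produce boundary terms.\<close>

locale gls_pair = fractional_integrand X a M T + holder_function g L \<gamma>
  for X :: "real \<Rightarrow> real" and a M T :: real and g :: "real \<Rightarrow> real" and L \<gamma> :: real +
  assumes T_pos: "0 < T" and clamped: "\<And>s. g s = g (max 0 (min T s))" and exponents: "1 < \<gamma> + a"
begin

text \<open>Since \<open>reflected (T - y) = g T - g y\<close>, right derivatives of the integrator
  become left derivatives of a function that vanishes at 0.\<close>

definition reflected :: "real \<Rightarrow> real" where
  "reflected s = g T - g (T - s)"

lemma measurable_reflected [measurable]: "reflected \<in> borel_measurable borel"
  unfolding reflected_def[abs_def] by measurable

text \<open>A \<open>\<gamma>\<close>-Hoelder function has a finite double integral at every order
  below \<open>\<gamma>\<close>, and \<open>1 - a < \<gamma>\<close> is the assumption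
  \<open>exponents\<close>. Boundedness on the whole line comes from the clamping of
  \<open>g\<close>.\<close>

sublocale R: fractional_integrand reflected "1 - a" "L * T powr \<gamma>" T
proof
  show "\<bar>reflected s\<bar> \<le> L * T powr \<gamma>" for s
  proof -
    define u where "u = max 0 (min T (T - s))"
    have "\<bar>reflected s\<bar> = \<bar>g T - g u\<bar>" using clamped[of "T - s"] by (simp add: reflected_def u_def)
    also have "\<dots> \<le> L * \<bar>T - u\<bar> powr \<gamma>" by (rule holder)
    also have "\<dots> \<le> L * T powr \<gamma>"
      using T_pos L_nonneg \<gamma>_pos by (intro mult_left_mono powr_mono2) (auto simp: u_def)
    finally show ?thesis .
  qed
  define b where "b = \<gamma> + a - 1"
  have b: "0 < b" using exponents by (simp add: b_def)
  have "(\<integral>\<^sup>+t\<in>{0..T}. (\<integral>\<^sup>+s\<in>{0..t}. ennreal (\<bar>reflected t - reflected s\<bar> / (t - s) powr (1 - a + 1)) \<partial>lborel) \<partial>lborel)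
     \<le> (\<integral>\<^sup>+t\<in>{0..T}. ennreal (L * (T powr b / b)) \<partial>lborel)"
  proof (intro nn_integral_mono)
    fix t
    show "(\<integral>\<^sup>+s\<in>{0..t}. ennreal (\<bar>reflected t - reflected s\<bar> / (t - s) powr (1 - a + 1)) \<partial>lborel) * indicator {0..T} t
       \<le> ennreal (L * (T powr b / b)) * indicator {0..T} t"
    proof (cases "t \<in> {0..T}")
      case True
      have le: "\<bar>reflected t - reflected s\<bar> / (t - s) powr (1 - a + 1) \<le> L * (t - s) powr (b - 1)" if "s \<le> t" for s
      proof -
        have "\<bar>reflected t - reflected s\<bar> \<le> L * (t - s) powr \<gamma>"
          using holder[of "T - s" "T - t"] that by (simp add: reflected_def abs_minus_commute)
        then have "\<bar>reflected t - reflected s\<bar> / (t - s) powr (1 - a + 1) \<le> (L * (t - s) powr \<gamma>) / (t - s) powr (1 - a + 1)"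
          by (intro divide_right_mono) auto
        also have "\<dots> = L * (t - s) powr (b - 1)"
        proof -
          have "(t - s) powr (b - 1) = (t - s) powr \<gamma> / (t - s) powr (1 - a + 1)"
            unfolding powr_diff[symmetric] by (simp add: b_def algebra_simps)
          then show ?thesis by simp
        qed
        finally show ?thesis .
      qed
      have "(\<integral>\<^sup>+s\<in>{0..t}. ennreal (\<bar>reflected t - reflected s\<bar> / (t - s) powr (1 - a + 1)) \<partial>lborel)
        \<le> (\<integral>\<^sup>+s. ennreal L * (ennreal ((t - s) powr (b - 1)) * indicator {0..t} s) \<partial>lborel)"
        using L_nonneg le by (intro nn_integral_mono)
          (auto simp: indicator_def ennreal_mult'[symmetric] intro!: ennreal_leI)
      also have "\<dots> = ennreal L * ennreal ((t - 0) powr b / b)"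
        using True b by (subst nn_integral_cmult) (auto simp: powr_right_lborel(1)[of b 0 t, simplified])
      also have "\<dots> = ennreal (L * (t powr b / b))"
        using L_nonneg b by (simp add: ennreal_mult'[symmetric])
      also have "\<dots> \<le> ennreal (L * (T powr b / b))"
        using True L_nonneg b by (intro ennreal_leI mult_left_mono divide_right_mono powr_mono2) auto
      finally show ?thesis using True by simp
    qed simp
  qed
  also have "\<dots> < \<infinity>"
    by (simp add: nn_integral_cmult_indicator ennreal_mult_less_top emeasure_lborel_Icc_eq)
  finally show "(\<integral>\<^sup>+t\<in>{0..T}. (\<integral>\<^sup>+s\<in>{0..t}. ennreal (\<bar>reflected t - reflected s\<bar> / (t - s) powr (1 - a + 1)) \<partial>lborel) \<partial>lborel) < \<infinity>" .
qed (use exponent in auto)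

lemma marchaud_reflected:
  assumes "x < T"
  shows "marchaud (1 - a) reflected (T - x) = weyl a T g x"
proof -
  have "(LINT s:{0..T - x}|lborel. (reflected (T - x) - reflected s) / (T - x - s) powr (1 - a + 1)) =
      (LINT r|lborel. indicator {x..T} r *\<^sub>R ((g r - g x) / (r - x) powr (1 - a + 1)))"
    unfolding set_lebesgue_integral_def
    by (subst lborel_integral_real_affine[where c="-1" and t=T])
      (auto intro!: Bochner_Integration.integral_cong simp: indicator_def reflected_def algebra_simps)
  also have "\<dots> = (LINT r:{x..T}|lborel. (g r - g x) * (r - x) powr (a - 2))"
    unfolding set_lebesgue_integral_def
    by (intro Bochner_Integration.integral_cong) (auto simp: powr_minus_divide[symmetric] divide_inverse powr_minus[symmetric])
  finally show ?thesis
    by (simp add: marchaud_def weyl_def reflected_def divide_inverse powr_minus[symmetric])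
qed

text \<open>The integrand of \<open>has_gls_integral\<close> for \<open>\<beta> = a\<close>, with
  the left limit of the integrator at \<open>T\<close> already replaced by
  \<open>g T\<close>.\<close>

definition kernel :: "real \<Rightarrow> real" where
  "kernel x = frac_deriv_left a X x * frac_deriv_right (1 - a) T (\<lambda>y. g T - g y) x"

lemma AE_kernel:
  "AE x in lborel. 0 < x \<longrightarrow> x < T \<longrightarrow> kernel x = marchaud a X x * weyl a T g x / (Gamma a * Gamma (1 - a))"
  using AE_frac_deriv_left R.AE_frac_deriv_right
proof eventually_elim
  case (elim x)
  have "(\<lambda>s. reflected (T - s)) = (\<lambda>y. g T - g y)" by (simp add: reflected_def)
  then show ?case using elim by (auto simp: kernel_def marchaud_reflected)
qed

lemma integrable_marchaud_weyl: "integrable lborel (\<lambda>x. indicator {0..T} x * marchaud a X x * weyl a T g x)"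
proof (rule Bochner_Integration.integrable_bound)
  let ?C = "L * T powr (\<gamma> + a - 1) * (1 + (1 - a) / (\<gamma> + a - 1))"
  show "integrable lborel (\<lambda>x. ?C * (indicator {0..T} x * marchaud a X x))"
    by (intro integrable_mult_right integrable_cut_marchaud)
  show "AE x in lborel. norm (indicator {0..T} x * marchaud a X x * weyl a T g x)
     \<le> norm (?C * (indicator {0..T} x * marchaud a X x))"
  proof (intro AE_I2)
    fix x
    show "norm (indicator {0..T} x * marchaud a X x * weyl a T g x) \<le> norm (?C * (indicator {0..T} x * marchaud a X x))"
    proof (cases "x \<in> {0..T}")
      case True
      then have "\<bar>weyl a T g x\<bar> \<le> \<bar>?C\<bar>"
        using abs_weyl_le[of a x T] exponent exponents by (intro order_trans[OF _ abs_ge_self]) auto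
      then show ?thesis using True by (simp add: abs_mult mult.commute mult_left_mono)
    qed simp
  qed
  show "(\<lambda>x. indicator {0..T} x * marchaud a X x * weyl a T g x) \<in> borel_measurable lborel"
    using borel_measurable_integrable[OF integrable_cut_marchaud] by measurable
qed

text \<open>For each mollified integrator, \<open>weyl_of_C1\<close> and the dual inversion turn the
  product of fractional derivatives into the integral of \<open>X\<close> against a difference
  quotient. The factor \<open>marchaud a X\<close> stays fixed and integrable while
  \<open>weyl\<close> is bounded uniformly in \<open>n\<close>, so dominated convergence gives the
  limit.\<close>

lemma integral_marchaud_weyl_limit:
  assumes e: "\<And>n. 0 < e n" "e \<longlonglongrightarrow> 0"
  shows "(\<lambda>n. LINT s:{0..T}|lborel. X s * ((g (s + e n) - g s) / e n))
     \<longlonglongrightarrow> (LINT x|lborel. indicator {0..T} x * marchaud a X x * weyl a T g x) / (Gamma a * Gamma (1 - a))"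
proof -
  obtain G where G: "\<And>x. (\<lambda>n. G n x) \<longlonglongrightarrow> g x" "\<And>n. holder_function (G n) L \<gamma>"
    "\<And>n x. (G n has_real_derivative (g (x + e n) - g x) / e n) (at x)"
    using C1_approximation[OF e] by blast
  let ?C = "L * T powr (\<gamma> + a - 1) * (1 + (1 - a) / (\<gamma> + a - 1))"
  note [measurable] = holder_function.measurable_g[OF G(2)] borel_measurable_integrable[OF integrable_cut_marchaud]
  have "(\<lambda>n. LINT x|lborel. indicator {0..T} x * marchaud a X x * weyl a T (G n) x)
     \<longlonglongrightarrow> (LINT x|lborel. indicator {0..T} x * marchaud a X x * weyl a T g x)"
  proof (rule integral_dominated_convergence)
    show "integrable lborel (\<lambda>x. ?C * \<bar>indicator {0..T} x * marchaud a X x\<bar>)"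
      by (intro integrable_mult_right integrable_abs integrable_cut_marchaud)
    show "AE x in lborel. (\<lambda>n. indicator {0..T} x * marchaud a X x * weyl a T (G n) x)
       \<longlonglongrightarrow> indicator {0..T} x * marchaud a X x * weyl a T g x"
    proof (intro AE_I2)
      fix x
      show "(\<lambda>n. indicator {0..T} x * marchaud a X x * weyl a T (G n) x) \<longlonglongrightarrow> indicator {0..T} x * marchaud a X x * weyl a T g x"
      proof (cases "x \<le> T")
        case True
        show ?thesis
          by (intro tendsto_mult tendsto_const weyl_tendsto[OF G(1,2) measurable_g exponents True])
      qed simp
    qed
    show "AE x in lborel. norm (indicator {0..T} x * marchaud a X x * weyl a T (G n) x) \<le> ?C * \<bar>indicator {0..T} x * marchaud a X x\<bar>" for n
    proof (intro AE_I2)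
      fix x
      show "norm (indicator {0..T} x * marchaud a X x * weyl a T (G n) x) \<le> ?C * \<bar>indicator {0..T} x * marchaud a X x\<bar>"
      proof (cases "x \<in> {0..T}")
        case True
        then have "\<bar>weyl a T (G n) x\<bar> \<le> ?C"
          using holder_function.abs_weyl_le[OF G(2), of a x T n] exponent exponents by auto
        then show ?thesis using True by (simp add: abs_mult mult.commute mult_left_mono)
      qed simp
    qed
  qed measurable
  moreover have "(LINT x|lborel. indicator {0..T} x * marchaud a X x * weyl a T (G n) x) =
     Gamma a * Gamma (1 - a) * (LINT s:{0..T}|lborel. X s * ((g (s + e n) - g s) / e n))" for n
  proof -
    define p where "p x = (g (x + e n) - g x) / e n" for x
    have [measurable]: "p \<in> borel_measurable borel" unfolding p_def[abs_def] by measurable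
    have p: "\<bar>p x\<bar> \<le> L * e n powr \<gamma> / e n" for x
      using holder[of "x + e n" x] e(1)[of n] by (auto simp: p_def intro!: divide_right_mono)
    have "(LINT x|lborel. indicator {0..T} x * marchaud a X x * weyl a T (G n) x) =
       (LINT x:{0..T}|lborel. marchaud a X x * (LINT r:{x..T}|lborel. p r * (r - x) powr (a - 1)))"
      unfolding set_lebesgue_integral_def[of _ "{0..T}"]
      using weyl_of_C1[OF G(3)[of n, folded p_def] _ p exponent(1)]
      by (intro Bochner_Integration.integral_cong) (auto simp: indicator_def)
    also have "\<dots> = Gamma a * Gamma (1 - a) * (LINT s:{0..T}|lborel. X s * p s)"
      using p by (intro integral_marchaud_times_powr_kernel) measurable
    finally show ?thesis by (simp add: p_def)
  qed
  moreover have "Gamma a * Gamma (1 - a) \<noteq> 0"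
    using exponent Gamma_real_pos[of a] Gamma_real_pos[of "1 - a"] by (simp add: less_imp_neq[THEN not_sym])
  ultimately show ?thesis
    using tendsto_divide[OF _ tendsto_const, of _ _ sequentially "Gamma a * Gamma (1 - a)"] by fastforce
qed

theorem gls_limit:
  assumes e: "\<And>n. 0 < e n" "e \<longlonglongrightarrow> 0"
  shows "set_integrable lebesgue {0..T} kernel"
    and "(\<lambda>n. LINT s:{0..T}|lborel. X s * ((g (s + e n) - g s) / e n)) \<longlonglongrightarrow> (LINT x:{0..T}|lebesgue. kernel x)"
proof -
  define h where "h x = indicator {0..T} x * marchaud a X x * weyl a T g x / (Gamma a * Gamma (1 - a))" for x
  have h: "integrable lborel h"
    unfolding h_def[abs_def] by (intro integrable_divide_zero integrable_marchaud_weyl)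
  then have hb: "h \<in> borel_measurable lborel" by (rule borel_measurable_integrable)
  have h': "integrable lebesgue h"
    using h hb by (simp add: integrable_completion)
  have eq: "AE x in lebesgue. indicator {0..T} x *\<^sub>R kernel x = h x"
    unfolding AE_completion_iff
    using AE_kernel AE_lborel_singleton[of 0] AE_lborel_singleton[of T]
    by eventually_elim (auto simp: h_def indicator_def)
  have m: "(\<lambda>x. indicator {0..T} x *\<^sub>R kernel x) \<in> borel_measurable lebesgue"
    by (rule borel_measurable_lebesgue_cong_AE[OF borel_measurable_integrable[OF h']])
      (use eq in \<open>auto elim: eventually_mono\<close>)
  show "set_integrable lebesgue {0..T} kernel"
    unfolding set_integrable_def using h' eq m by (subst integrable_cong_AE[OF m _ eq]) auto
  have "(LINT x:{0..T}|lebesgue. kernel x) = (LINT x|lebesgue. h x)"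
    unfolding set_lebesgue_integral_def using m h' eq by (intro integral_cong_AE) auto
  also have "\<dots> = (LINT x|lborel. h x)" using hb by (rule integral_completion)
  also have "\<dots> = (LINT x|lborel. indicator {0..T} x * marchaud a X x * weyl a T g x) / (Gamma a * Gamma (1 - a))"
    by (simp add: h_def)
  finally show "(\<lambda>n. LINT s:{0..T}|lborel. X s * ((g (s + e n) - g s) / e n)) \<longlonglongrightarrow> (LINT x:{0..T}|lebesgue. kernel x)"
    using integral_marchaud_weyl_limit[OF e] by simp
qed

end

section \<open>The chain rule along a path\<close>

text \<open>The derivative at an interior \<open>x\<close> involves the integrals only for upper
  limits \<open>y\<close> near \<open>x\<close>, hence below \<open>T\<close>, and so only values on
  \<open>{0..T}\<close>.\<close>

lemma frac_deriv_left_cong: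
  assumes "\<And>s. s \<in> {0..T} \<Longrightarrow> f s = g s" and x: "0 < x" "x < T"
  shows "frac_deriv_left a f x = frac_deriv_left a g x"
proof -
  have "\<forall>\<^sub>F y in nhds x. y \<in> {0<..<T}" using x by (intro eventually_nhds_in_open) auto
  then have "\<forall>\<^sub>F y in nhds x. (LINT s:{0..y}|lebesgue. f s * (y - s) powr (- a)) = (LINT s:{0..y}|lebesgue. g s * (y - s) powr (- a))"
    by eventually_elim (use assms in \<open>auto intro!: set_lebesgue_integral_cong\<close>)
  then show ?thesis unfolding frac_deriv_left_def by (simp add: deriv_cong_ev)
qed

lemma frac_deriv_right_cong:
  assumes "\<And>s. s \<in> {0..T} \<Longrightarrow> f s = g s" and x: "0 < x" "x < T"
  shows "frac_deriv_right a T f x = frac_deriv_right a T g x"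
proof -
  have "\<forall>\<^sub>F y in nhds x. y \<in> {0<..<T}" using x by (intro eventually_nhds_in_open) auto
  then have "\<forall>\<^sub>F y in nhds x. (LINT s:{y..T}|lebesgue. f s * (s - y) powr (- a)) = (LINT s:{y..T}|lebesgue. g s * (s - y) powr (- a))"
    by eventually_elim (use assms in \<open>auto intro!: set_lebesgue_integral_cong\<close>)
  then show ?thesis unfolding frac_deriv_right_def by (simp add: deriv_cong_ev)
qed

text \<open>The logarithm of \<open>G\<close>, with the time integral of the path written through an
  antiderivative \<open>F\<close> defined on the whole line; increments are then accessible to the
  mean value inequality.\<close>

definition log_average :: "(real \<Rightarrow> real) \<Rightarrow> (real \<Rightarrow> real) \<Rightarrow> real \<Rightarrow> real \<Rightarrow> real" where
  "log_average F g T s = (F s - F 0) / T + (T - s) / T * g s"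

text \<open>The expansion is about the endpoint \<open>t\<close>: this is the term left over in an
  increment of \<open>log_average\<close>, and it also fits Riemann sums with right
  endpoints.\<close>

lemma (in holder_function) antiderivative_increment:
  assumes F: "\<And>x. (F has_real_derivative g x) (at x)"
  shows "\<bar>F t - F s - g t * (t - s)\<bar> \<le> L * \<bar>t - s\<bar> powr (1 + \<gamma>)"
proof -
  define K where "K u = F u - g t * u" for u
  have K: "(K has_real_derivative g u - g t) (at u)" for u
    unfolding K_def by (auto intro!: derivative_eq_intros F)
  have "norm (K t - K s) \<le> (L * \<bar>t - s\<bar> powr \<gamma>) * norm (t - s)"
  proof (rule field_differentiable_bound[of "closed_segment s t" K "\<lambda>u. g u - g t"])
    fix u assume "u \<in> closed_segment s t"
    then have "\<bar>u - t\<bar> \<le> \<bar>t - s\<bar>" by (auto simp: closed_segment_eq_real_ivl split: if_splits)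
    then have "L * \<bar>u - t\<bar> powr \<gamma> \<le> L * \<bar>t - s\<bar> powr \<gamma>"
      using L_nonneg \<gamma>_pos by (intro mult_left_mono powr_mono2) auto
    with holder[of u t] show "norm (g u - g t) \<le> L * \<bar>t - s\<bar> powr \<gamma>" by simp
  qed (auto intro: has_field_derivative_at_within K)
  also have "\<dots> = L * \<bar>t - s\<bar> powr (1 + \<gamma>)"
    by (simp add: powr_add mult.commute powr_one_gt_zero_iff)
  finally show ?thesis by (simp add: K_def algebra_simps)
qed

text \<open>One fixed path; \<open>occupation\<close> is the only trace of probability. The function
  \<open>v\<close> stands for \<open>D\<close> composed with \<open>exp\<close>, but only along the
  path, so that it can be bounded and monotone on the whole line.\<close>

locale averaged_path = holder_function g L \<gamma> for g :: "real \<Rightarrow> real" and L \<gamma> :: real +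
  fixes T a \<kappa> V C :: real and F f D v :: "real \<Rightarrow> real"
  assumes T_pos: "0 < T" and clamped: "\<And>s. g s = g (max 0 (min T s))"
    and F: "\<And>x. (F has_real_derivative g x) (at x)"
    and exponent: "0 < a" "a < 1" and exponent_bounds: "1 < \<gamma> + a" "a < \<gamma> * \<kappa>" "\<kappa> \<le> 1" "\<gamma> \<le> 1"
    and continuous_f: "continuous_on UNIV f"
    and subgradient: "\<And>x z. f x + D x * (z - x) \<le> f z"
    and mono_v: "mono v" and bounded_v: "\<And>x. \<bar>v x\<bar> \<le> V"
    and v_eq: "\<And>t. 0 \<le> t \<Longrightarrow> t \<le> T \<Longrightarrow> v (log_average F g T t) = D (exp (log_average F g T t))"
    and C_nonneg: "0 \<le> C"
    and occupation: "\<And>\<delta>. 0 < \<delta> \<Longrightarrow>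
       (\<integral>\<^sup>+t\<in>{0..T}. ennreal (v (log_average F g T t + \<delta>) - v (log_average F g T t - \<delta>)) \<partial>lborel)
         \<le> ennreal (C * \<delta> powr \<kappa>)"
begin

abbreviation clamp :: "real \<Rightarrow> real" where "clamp s \<equiv> max 0 (min T s)"

text \<open>Time is clamped so that \<open>G (s + e)\<close> is meaningful for \<open>s\<close> near
  \<open>T\<close> and constant beyond \<open>T\<close>.\<close>

definition y :: "real \<Rightarrow> real" where "y s = log_average F g T (clamp s)"
definition w :: "real \<Rightarrow> real" where "w s = (T - clamp s) / T"
definition G :: "real \<Rightarrow> real" where "G s = exp (y s)"
definition X :: "real \<Rightarrow> real" where "X s = w s * v (y s) * G s"
definition E :: real where "E = (SUP s\<in>{0..T}. G s)"

lemma V_nonneg: "0 \<le> V" using bounded_v[of 0] by linarith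

lemma clamp_in [simp]: "clamp s \<in> {0..T}" using T_pos by auto

lemma clamp_contraction: "\<bar>clamp t - clamp s\<bar> \<le> \<bar>t - s\<bar>" by auto

text \<open>The drift from the decreasing weight \<open>(T - s) / T\<close> cancels the growth of
  the time average up to an error of order higher than \<open>\<bar>t - s\<bar>\<close>. This is why
  the representation has no Lebesgue integral beside the stochastic one.\<close>

lemma log_average_increment:
  assumes "s \<in> {0..T}" "t \<in> {0..T}"
  shows "\<bar>log_average F g T t - log_average F g T s - (T - s) / T * (g t - g s)\<bar> \<le> L / T * \<bar>t - s\<bar> powr (1 + \<gamma>)"
proof -
  have "\<bar>F t - F s - g t * (t - s)\<bar> / T \<le> L * \<bar>t - s\<bar> powr (1 + \<gamma>) / T"
    using T_pos by (intro divide_right_mono antiderivative_increment F) auto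
  moreover have "log_average F g T t - log_average F g T s - (T - s) / T * (g t - g s) = (F t - F s - g t * (t - s)) / T"
    using T_pos by (simp add: log_average_def field_simps)
  ultimately show ?thesis using T_pos by (simp add: abs_divide)
qed

lemma abs_y_diff_le: "\<bar>y t - y s\<bar> \<le> 2 * L * \<bar>t - s\<bar> powr \<gamma>"
proof -
  define s' t' where "s' = clamp s" and "t' = clamp t"
  have in0T: "s' \<in> {0..T}" "t' \<in> {0..T}" by (auto simp only: s'_def t'_def clamp_in)
  have "\<bar>t' - s'\<bar> powr (1 + \<gamma>) = \<bar>t' - s'\<bar> * \<bar>t' - s'\<bar> powr \<gamma>"
    by (simp add: powr_add)
  also have "\<dots> \<le> T * \<bar>t' - s'\<bar> powr \<gamma>"
    using in0T by (intro mult_right_mono) auto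
  finally have "L / T * \<bar>t' - s'\<bar> powr (1 + \<gamma>) \<le> L / T * (T * \<bar>t' - s'\<bar> powr \<gamma>)"
    using L_nonneg T_pos by (intro mult_left_mono) auto
  then have 1: "L / T * \<bar>t' - s'\<bar> powr (1 + \<gamma>) \<le> L * \<bar>t' - s'\<bar> powr \<gamma>" using T_pos by simp
  have 2: "\<bar>(T - s') / T * (g t' - g s')\<bar> \<le> 1 * (L * \<bar>t' - s'\<bar> powr \<gamma>)"
    unfolding abs_mult using in0T T_pos holder[of t' s'] by (intro mult_mono) auto
  have tri: "\<bar>p\<bar> \<le> 2 * k" if "\<bar>p - q\<bar> \<le> k" "\<bar>q\<bar> \<le> k" for p q k :: real using that by linarith
  have "\<bar>y t - y s\<bar> \<le> 2 * (L * \<bar>t' - s'\<bar> powr \<gamma>)"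
    unfolding y_def s'_def[symmetric] t'_def[symmetric]
    using 2 by (intro tri[OF order_trans[OF log_average_increment[OF in0T] 1]]) simp
  also have "\<dots> \<le> 2 * (L * \<bar>t - s\<bar> powr \<gamma>)"
    using clamp_contraction[of t s] L_nonneg \<gamma>_pos
    by (intro mult_left_mono powr_mono2) (simp_all only: s'_def t'_def abs_ge_zero less_imp_le zero_le_numeral)
  finally show ?thesis by simp
qed

sublocale y: holder_function y "2 * L" \<gamma>
  by unfold_locales (use abs_y_diff_le \<gamma>_pos in auto)

lemma continuous_G: "continuous_on UNIV G"
  unfolding G_def by (intro continuous_intros y.continuous)

lemma measurable_G [measurable]: "G \<in> borel_measurable borel"
  using continuous_G by (rule borel_measurable_continuous_onI)

lemma measurable_v [measurable]: "v \<in> borel_measurable borel"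
  using mono_v by (rule borel_measurable_mono)

lemma measurable_w [measurable]: "w \<in> borel_measurable borel"
  unfolding w_def[abs_def] by measurable

lemma measurable_X [measurable]: "X \<in> borel_measurable borel"
  unfolding X_def[abs_def] using y.measurable_g by measurable

lemma G_pos: "0 < G s" by (simp add: G_def)

lemma G_le_E: "G s \<le> E"
proof -
  have "G s = G (clamp s)" using T_pos by (simp add: G_def y_def)
  moreover have "compact (G ` {0..T})"
    by (intro compact_continuous_image continuous_on_subset[OF continuous_G]) auto
  then have "bdd_above (G ` {0..T})" by (intro bounded_imp_bdd_above compact_imp_bounded)
  then have "G (clamp s) \<le> E" unfolding E_def by (intro cSUP_upper clamp_in)
  ultimately show ?thesis by simp
qed

lemma E_pos: "0 < E" using G_pos[of 0] G_le_E[of 0] by linarith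

text \<open>Every point of the segment lies below one of its endpoints, so \<open>E\<close> bounds
  the derivative of \<open>exp\<close> on all of it.\<close>

lemma exp_remainder: 
  fixes p q :: real
  assumes "exp p \<le> E" "exp q \<le> E"
  shows "\<bar>exp q - exp p\<bar> \<le> E * \<bar>q - p\<bar>" and "\<bar>exp q - exp p - exp p * (q - p)\<bar> \<le> E * (q - p)\<^sup>2"
proof -
  have lip: "\<bar>exp q - exp p\<bar> \<le> E * \<bar>q - p\<bar>" if "exp p \<le> E" "exp q \<le> E" for p q :: real
  proof -
    have "norm (exp q - exp p) \<le> E * norm (q - p)"
    proof (rule field_differentiable_bound[of "closed_segment p q" exp exp])
      fix u assume "u \<in> closed_segment p q"
      then have "u \<le> p \<or> u \<le> q" by (auto simp: closed_segment_eq_real_ivl split: if_splits)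
      then show "norm (exp u) \<le> E" using that by (auto intro: order_trans[OF exp_le_cancel_iff[THEN iffD2]])
    qed (auto intro!: derivative_eq_intros)
    then show ?thesis by simp
  qed
  show "\<bar>exp q - exp p\<bar> \<le> E * \<bar>q - p\<bar>" using assms by (rule lip)
  have "norm ((exp q - exp p * q) - (exp p - exp p * p)) \<le> (E * \<bar>q - p\<bar>) * norm (q - p)"
  proof (rule field_differentiable_bound[of "closed_segment p q" "\<lambda>u. exp u - exp p * u" "\<lambda>u. exp u - exp p"])
    fix u assume u: "u \<in> closed_segment p q"
    then have "u \<le> p \<or> u \<le> q" "\<bar>u - p\<bar> \<le> \<bar>q - p\<bar>" by (auto simp: closed_segment_eq_real_ivl split: if_splits)
    then have "exp u \<le> E" using assms by (auto intro: order_trans[OF exp_le_cancel_iff[THEN iffD2]])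
    then have "\<bar>exp u - exp p\<bar> \<le> E * \<bar>u - p\<bar>" using assms by (intro lip)
    also have "\<dots> \<le> E * \<bar>q - p\<bar>" using E_pos \<open>\<bar>u - p\<bar> \<le> \<bar>q - p\<bar>\<close> by (intro mult_left_mono) auto
    finally show "norm (exp u - exp p) \<le> E * \<bar>q - p\<bar>" by simp
  qed (auto intro!: derivative_eq_intros)
  also have "(E * \<bar>q - p\<bar>) * norm (q - p) = E * (q - p)\<^sup>2"
    by (simp add: power2_eq_square abs_mult_self_eq mult.assoc)
  finally show "\<bar>exp q - exp p - exp p * (q - p)\<bar> \<le> E * (q - p)\<^sup>2"
    by (simp add: algebra_simps)
qed

lemma abs_G_diff_le: "\<bar>G t - G s\<bar> \<le> 2 * E * L * \<bar>t - s\<bar> powr \<gamma>"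
proof -
  have "\<bar>G t - G s\<bar> \<le> E * \<bar>y t - y s\<bar>"
    using exp_remainder(1)[of "y s" "y t"] G_le_E by (simp add: G_def)
  also have "\<dots> \<le> E * (2 * L * \<bar>t - s\<bar> powr \<gamma>)"
    using E_pos abs_y_diff_le by (intro mult_left_mono) auto
  finally show ?thesis by simp
qed

text \<open>A bound for the increments of \<open>y\<close> over a lag \<open>r\<close>;
  \<open>L + 1\<close> in place of \<open>L\<close> keeps it strictly positive when
  \<open>L = 0\<close>, as \<open>occupation\<close> asks for a positive argument.\<close>

definition \<delta> :: "real \<Rightarrow> real" where "\<delta> r = 2 * (L + 1) * r powr \<gamma>"
definition osc :: "real \<Rightarrow> real \<Rightarrow> real" where "osc r t = v (y t + \<delta> r) - v (y t - \<delta> r)"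

lemma osc_nonneg: "0 \<le> osc r t"
  using L_nonneg by (auto simp: osc_def \<delta>_def intro!: monoD[OF mono_v])

text \<open>By monotonicity of \<open>v\<close> the oscillation around \<open>y t\<close> alone
  controls all earlier and later times within the lag. This reduces two path values to one, whose
  law is what is known.\<close>

lemma abs_v_diff_le: "\<bar>v (y t) - v (y s)\<bar> \<le> osc \<bar>t - s\<bar> t"
proof -
  have "\<bar>y t - y s\<bar> \<le> \<delta> \<bar>t - s\<bar>"
    unfolding \<delta>_def by (rule order_trans[OF abs_y_diff_le]) (intro mult_right_mono, auto)
  moreover have "0 \<le> \<delta> \<bar>t - s\<bar>" using L_nonneg by (simp add: \<delta>_def)
  ultimately have "v (y s) \<le> v (y t + \<delta> \<bar>t - s\<bar>)" "v (y t - \<delta> \<bar>t - s\<bar>) \<le> v (y s)"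
    "v (y t) \<le> v (y t + \<delta> \<bar>t - s\<bar>)" "v (y t - \<delta> \<bar>t - s\<bar>) \<le> v (y t)"
    by (auto intro!: monoD[OF mono_v])
  then show ?thesis by (simp add: osc_def)
qed

lemma measurable_osc [measurable]: "(\<lambda>(r, t). osc r t) \<in> borel_measurable (borel \<Otimes>\<^sub>M borel)"
  unfolding osc_def \<delta>_def using y.measurable_g by measurable

lemma nn_integral_osc:
  assumes r: "0 < r"
  shows "(\<integral>\<^sup>+t\<in>{0..T}. ennreal (osc r t) \<partial>lborel) \<le> ennreal (C * (2 * (L + 1)) powr \<kappa> * r powr (\<gamma> * \<kappa>))"
proof -
  have "0 < \<delta> r" using r L_nonneg by (simp add: \<delta>_def)
  have "(\<integral>\<^sup>+t\<in>{0..T}. ennreal (osc r t) \<partial>lborel) =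
     (\<integral>\<^sup>+t\<in>{0..T}. ennreal (v (log_average F g T t + \<delta> r) - v (log_average F g T t - \<delta> r)) \<partial>lborel)"
    by (intro nn_integral_cong) (auto simp: indicator_def osc_def y_def)
  also have "\<dots> \<le> ennreal (C * \<delta> r powr \<kappa>)" by (rule occupation) fact
  also have "\<delta> r powr \<kappa> = (2 * (L + 1)) powr \<kappa> * r powr (\<gamma> * \<kappa>)"
    using L_nonneg by (simp add: \<delta>_def powr_mult powr_powr)
  finally show ?thesis by (simp add: mult.assoc)
qed

lemma w_bounds: "0 \<le> w s" "w s \<le> 1"
  using T_pos by (auto simp: w_def)

lemma abs_X_le: "\<bar>X s\<bar> \<le> V * E"
proof -
  have "\<bar>X s\<bar> = w s * (\<bar>v (y s)\<bar> * G s)"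
    using w_bounds[of s] G_pos[of s] by (simp add: X_def abs_mult)
  also have "\<dots> \<le> 1 * (V * E)"
    using w_bounds[of s] G_pos[of s] G_le_E[of s] bounded_v[of "y s"] V_nonneg E_pos
    by (intro mult_mono) auto
  finally show ?thesis by simp
qed

text \<open>The Hoelder constant of the factor \<open>w * G\<close> times \<open>V\<close>: the
  first summand comes from \<open>G\<close>, the second from the Lipschitz factor \<open>w\<close>,
  made \<open>\<gamma>\<close>-Hoelder on an interval of length \<open>T\<close>.\<close>

definition CX :: real where "CX = V * (2 * E * L + E * T powr (1 - \<gamma>) / T)"

lemma CX_nonneg: "0 \<le> CX" using V_nonneg E_pos L_nonneg T_pos by (simp add: CX_def)

text \<open>The product is split so that the increment of \<open>v\<close>, the only irregular one,
  carries the bounded factor \<open>w t * G t\<close>; the other increments are Hoelder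
  continuous.\<close>

lemma abs_X_diff_le:
  assumes "0 \<le> s" "s \<le> t" "t \<le> T"
  shows "\<bar>X t - X s\<bar> \<le> E * osc (t - s) t + CX * (t - s) powr \<gamma>"
proof -
  define r where "r = t - s"
  have r: "0 \<le> r" "r \<le> T" using assms by (auto simp: r_def)
  have "r = r powr \<gamma> * r powr (1 - \<gamma>)"
    using r by (cases "r = 0") (auto simp: powr_add[symmetric])
  also have "\<dots> \<le> r powr \<gamma> * T powr (1 - \<gamma>)"
    using r exponent_bounds by (intro mult_left_mono powr_mono2) auto
  finally have r_le: "r \<le> T powr (1 - \<gamma>) * r powr \<gamma>" by (simp add: mult.commute)
  have "\<bar>w t - w s\<bar> = r / T"
    using assms T_pos by (simp add: w_def r_def diff_divide_distrib[symmetric] abs_divide)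
  also have "\<dots> \<le> T powr (1 - \<gamma>) * r powr \<gamma> / T"
    using r_le T_pos by (intro divide_right_mono) auto
  finally have w_diff: "\<bar>w t - w s\<bar> \<le> T powr (1 - \<gamma>) / T * r powr \<gamma>" by simp
  have X_diff: "X t - X s = w t * G t * (v (y t) - v (y s)) + v (y s) * (w t * (G t - G s) + G s * (w t - w s))"
    by (simp add: X_def algebra_simps)
  have 1: "\<bar>w t * G t * (v (y t) - v (y s))\<bar> \<le> (1 * E) * osc r t"
    unfolding abs_mult using w_bounds[of t] G_pos[of t] G_le_E[of t] E_pos abs_v_diff_le[of t s] assms
    by (intro mult_mono) (auto simp: r_def)
  have 2: "\<bar>w t * (G t - G s)\<bar> \<le> 1 * (2 * E * L * r powr \<gamma>)"
    unfolding abs_mult using w_bounds[of t] abs_G_diff_le[of t s] assms E_pos L_nonneg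
    by (intro mult_mono) (auto simp: r_def)
  have 3: "\<bar>G s * (w t - w s)\<bar> \<le> E * (T powr (1 - \<gamma>) / T * r powr \<gamma>)"
    unfolding abs_mult using w_diff G_pos[of s] G_le_E[of s] E_pos
    by (intro mult_mono) auto
  have "\<bar>w t * (G t - G s) + G s * (w t - w s)\<bar> \<le> (2 * E * L + E * T powr (1 - \<gamma>) / T) * r powr \<gamma>"
    using abs_triangle_ineq[of "w t * (G t - G s)" "G s * (w t - w s)"] 2 3 by (simp add: algebra_simps)
  then have "\<bar>v (y s) * (w t * (G t - G s) + G s * (w t - w s))\<bar> \<le> V * ((2 * E * L + E * T powr (1 - \<gamma>) / T) * r powr \<gamma>)"
    unfolding abs_mult[of "v (y s)"] using bounded_v[of "y s"] V_nonneg by (intro mult_mono) auto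
  with 1 show ?thesis unfolding X_diff CX_def r_def[symmetric]
    using abs_triangle_ineq[of "w t * G t * (v (y t) - v (y s))" "v (y s) * (w t * (G t - G s) + G s * (w t - w s))"]
    by (simp add: mult.assoc)
qed

text \<open>The lag \<open>r = t - s\<close> becomes a variable and Tonelli puts the time integral
  inside, where \<open>nn_integral_osc\<close> applies. What remains is the integral of
  \<open>r powr (\<gamma> * \<kappa> - a - 1)\<close> and \<open>r powr (\<gamma> - a - 1)\<close>,
  finite because \<open>a < \<gamma> * \<kappa> \<le> \<gamma>\<close>.\<close>

lemma finite_double_integral:
  "(\<integral>\<^sup>+t\<in>{0..T}. (\<integral>\<^sup>+s\<in>{0..t}. ennreal (\<bar>X t - X s\<bar> / (t - s) powr (a + 1)) \<partial>lborel) \<partial>lborel) < \<infinity>"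
proof -
  define k where "k r t = ennreal ((E * osc r t + CX * r powr \<gamma>) / r powr (a + 1))" for r t
  have [measurable]: "(\<lambda>(r, t). k r t) \<in> borel_measurable (borel \<Otimes>\<^sub>M borel)"
    unfolding k_def by measurable
  have "a < \<gamma>"
  proof -
    have "\<gamma> * \<kappa> \<le> \<gamma> * 1" using exponent_bounds \<gamma>_pos by (intro mult_left_mono) auto
    then show ?thesis using exponent_bounds by simp
  qed
  have "(\<integral>\<^sup>+t\<in>{0..T}. (\<integral>\<^sup>+s\<in>{0..t}. ennreal (\<bar>X t - X s\<bar> / (t - s) powr (a + 1)) \<partial>lborel) \<partial>lborel)
     \<le> (\<integral>\<^sup>+t. (\<integral>\<^sup>+r. k r t * indicator {0..T} r * indicator {0..T} t \<partial>lborel) \<partial>lborel)"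
  proof (intro nn_integral_mono)
    fix t
    show "(\<integral>\<^sup>+s\<in>{0..t}. ennreal (\<bar>X t - X s\<bar> / (t - s) powr (a + 1)) \<partial>lborel) * indicator {0..T} t
      \<le> (\<integral>\<^sup>+r. k r t * indicator {0..T} r * indicator {0..T} t \<partial>lborel)"
    proof (cases "t \<in> {0..T}")
      case True
      have "(\<integral>\<^sup>+s\<in>{0..t}. ennreal (\<bar>X t - X s\<bar> / (t - s) powr (a + 1)) \<partial>lborel)
        \<le> (\<integral>\<^sup>+s. k (t - s) t * indicator {0..T} (t - s) \<partial>lborel)"
        using True abs_X_diff_le[of _ t]
        by (intro nn_integral_mono) (auto simp: indicator_def k_def intro!: ennreal_leI divide_right_mono)
      also have "\<dots> = (\<integral>\<^sup>+r. k r t * indicator {0..T} r \<partial>lborel)"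
        using nn_integral_real_affine[of "\<lambda>r. k r t * indicator {0..T} r" "-1" t] by simp
      finally show ?thesis using True by simp
    qed simp
  qed
  also have "\<dots> = (\<integral>\<^sup>+r. (\<integral>\<^sup>+t. k r t * indicator {0..T} r * indicator {0..T} t \<partial>lborel) \<partial>lborel)"
    by (rule lborel_pair.Fubini') measurable
  also have "\<dots> \<le> (\<integral>\<^sup>+r. ennreal (E * (C * (2 * (L + 1)) powr \<kappa>)) * (ennreal (r powr (\<gamma> * \<kappa> - a - 1)) * indicator {0..T} r)
       + ennreal (CX * T) * (ennreal (r powr (\<gamma> - a - 1)) * indicator {0..T} r) \<partial>lborel)"
  proof (rule nn_integral_mono_AE)
    show "AE r in lborel. (\<integral>\<^sup>+t. k r t * indicator {0..T} r * indicator {0..T} t \<partial>lborel) \<le>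
       ennreal (E * (C * (2 * (L + 1)) powr \<kappa>)) * (ennreal (r powr (\<gamma> * \<kappa> - a - 1)) * indicator {0..T} r)
       + ennreal (CX * T) * (ennreal (r powr (\<gamma> - a - 1)) * indicator {0..T} r)"
      using AE_lborel_singleton[of 0]
    proof eventually_elim
      case (elim r)
      show ?case
      proof (cases "r \<in> {0..T}")
        case True
        then have r: "0 < r" using elim by simp
        have "(\<integral>\<^sup>+t. k r t * indicator {0..T} r * indicator {0..T} t \<partial>lborel) =
          (\<integral>\<^sup>+t. ennreal (E * r powr (- a - 1)) * (ennreal (osc r t) * indicator {0..T} t) +
             ennreal (CX * r powr (\<gamma> - a - 1)) * indicator {0..T} t \<partial>lborel)"
        proof (intro nn_integral_cong)
          fix t
          have "(E * osc r t + CX * r powr \<gamma>) / r powr (a + 1) = E * r powr (- a - 1) * osc r t + CX * r powr (\<gamma> - a - 1)"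
            using powr_minus_divide[of r "a + 1"] powr_diff[of r \<gamma> "a + 1"] by (simp add: add_divide_distrib diff_diff_eq)
          then show "k r t * indicator {0..T} r * indicator {0..T} t =
            ennreal (E * r powr (- a - 1)) * (ennreal (osc r t) * indicator {0..T} t) +
             ennreal (CX * r powr (\<gamma> - a - 1)) * indicator {0..T} t"
            using True E_pos osc_nonneg[of r t] CX_nonneg
            by (auto simp: k_def indicator_def ennreal_mult'[symmetric] ennreal_plus[symmetric] simp del: ennreal_plus)
        qed
        also have "\<dots> = ennreal (E * r powr (- a - 1)) * (\<integral>\<^sup>+t\<in>{0..T}. ennreal (osc r t) \<partial>lborel) + ennreal (CX * r powr (\<gamma> - a - 1)) * ennreal T"
          using T_pos by (subst nn_integral_add) (auto simp: nn_integral_cmult emeasure_lborel_Icc_eq)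
        also have "\<dots> \<le> ennreal (E * r powr (- a - 1)) * ennreal (C * (2 * (L + 1)) powr \<kappa> * r powr (\<gamma> * \<kappa>)) + ennreal (CX * r powr (\<gamma> - a - 1)) * ennreal T"
          by (intro add_mono mult_left_mono nn_integral_osc r) auto
        also have "\<dots> = ennreal (E * (C * (2 * (L + 1)) powr \<kappa>)) * ennreal (r powr (\<gamma> * \<kappa> - a - 1)) + ennreal (CX * T) * ennreal (r powr (\<gamma> - a - 1))"
        proof -
          have "r powr (- a - 1) * r powr (\<gamma> * \<kappa>) = r powr (\<gamma> * \<kappa> - a - 1)"
            by (simp add: powr_add[symmetric] algebra_simps)
          then show ?thesis using E_pos C_nonneg CX_nonneg T_pos
            by (simp add: ennreal_mult'[symmetric] mult_ac)
        qed
        finally show ?thesis using True by simp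
      qed simp
    qed
  qed
  also have "\<dots> < \<infinity>"
  proof -
    have "(\<integral>\<^sup>+r. ennreal (r powr (b - 1)) * indicator {0..T} r \<partial>lborel) < \<infinity>" if "0 < b" for b
      using powr_left_lborel(1)[of b 0 T] that T_pos by simp
    from this[of "\<gamma> * \<kappa> - a"] this[of "\<gamma> - a"] show ?thesis
      using exponent_bounds \<open>a < \<gamma>\<close> by (subst nn_integral_add) (auto simp: nn_integral_cmult ennreal_mult_less_top)
  qed
  finally show ?thesis .
qed

sublocale gls_pair X a "V * E" T g L \<gamma>
  using abs_X_le exponent finite_double_integral T_pos clamped exponent_bounds by unfold_locales auto

text \<open>Three errors are collected: the subgradient gap gives the \<open>osc\<close> term, the
  quadratic remainder of \<open>exp\<close> gives
  \<open>4 * L\<^sup>2 * e powr (2 * \<gamma>)\<close> because \<open>y\<close> moves by at most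
  \<open>2 * L * e powr \<gamma>\<close>, and the increment of \<open>log_average\<close> gives the
  power \<open>1 + \<gamma>\<close>.\<close>

lemma chain_rule_remainder:
  assumes s: "s \<in> {0..T}" and e: "0 < e"
  shows "\<bar>f (G (s + e)) - f (G s) - X s * (g (s + e) - g s)\<bar> \<le>
     2 * E * L * e powr \<gamma> * osc e s + V * (E * (4 * L\<^sup>2 * e powr (2 * \<gamma>) + L / T * e powr (1 + \<gamma>)))"
proof -
  \<comment> \<open>The time \<open>s + e\<close> may exceed \<open>T\<close>; the increment of
    \<open>log_average\<close> is estimated at the clamped time, which is still within
    \<open>e\<close> of \<open>s\<close>.\<close>
  define u where "u = clamp (s + e)"
  have u: "u \<in> {0..T}" by (simp only: u_def clamp_in)
  have us: "0 \<le> u - s" "u - s \<le> e" using s e by (auto simp: u_def)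
  have gu: "g (s + e) = g u" using clamped[of "s + e"] by (simp add: u_def)
  have ys: "y s = log_average F g T s" "y (s + e) = log_average F g T u"
    using s by (auto simp: y_def u_def)
  have vD: "v (y t) = D (G t)" for t
    using v_eq[of "clamp t"] clamp_in[of t] unfolding G_def y_def by simp
  have sub1: "f (G s) + v (y s) * (G (s + e) - G s) \<le> f (G (s + e))"
    unfolding vD by (rule subgradient)
  have sub2: "f (G (s + e)) + v (y (s + e)) * (G s - G (s + e)) \<le> f (G s)"
    unfolding vD by (rule subgradient)
  have "f (G (s + e)) - f (G s) - v (y s) * (G (s + e) - G s) \<le> (v (y (s + e)) - v (y s)) * (G (s + e) - G s)"
    using sub2 by (simp add: algebra_simps)
  also have "\<dots> \<le> \<bar>v (y s) - v (y (s + e))\<bar> * \<bar>G (s + e) - G s\<bar>"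
    by (metis abs_ge_self abs_minus_commute abs_mult)
  also have "\<dots> \<le> osc e s * (2 * E * L * e powr \<gamma>)"
    using abs_v_diff_le[of s "s + e"] abs_G_diff_le[of "s + e" s] osc_nonneg[of e s] e
    by (intro mult_mono) auto
  finally have 1: "\<bar>f (G (s + e)) - f (G s) - v (y s) * (G (s + e) - G s)\<bar> \<le> 2 * E * L * e powr \<gamma> * osc e s"
    using sub1 by (simp add: mult.commute)
  have yd: "\<bar>y (s + e) - y s\<bar> \<le> 2 * L * e powr \<gamma>"
    using abs_y_diff_le[of "s + e" s] e by simp
  have "\<bar>G (s + e) - G s - G s * (y (s + e) - y s)\<bar> \<le> E * (y (s + e) - y s)\<^sup>2"
    unfolding G_def using G_le_E[of s] G_le_E[of "s + e"] by (intro exp_remainder(2)) (auto simp: G_def)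
  also have "\<dots> \<le> E * (2 * L * e powr \<gamma>)\<^sup>2"
    using yd E_pos by (intro mult_left_mono) (auto simp: abs_le_square_iff[symmetric])
  also have "\<dots> = E * (4 * L\<^sup>2 * e powr (2 * \<gamma>))"
    using e by (simp add: power_mult_distrib powr_power mult.commute)
  finally have 2: "\<bar>G (s + e) - G s - G s * (y (s + e) - y s)\<bar> \<le> E * (4 * L\<^sup>2 * e powr (2 * \<gamma>))" .
  have "\<bar>y (s + e) - y s - w s * (g (s + e) - g s)\<bar> \<le> L / T * \<bar>u - s\<bar> powr (1 + \<gamma>)"
    using log_average_increment[OF s u] s by (simp add: ys gu w_def)
  also have "\<dots> \<le> L / T * e powr (1 + \<gamma>)"
    using us L_nonneg T_pos \<gamma>_pos by (intro mult_left_mono powr_mono2) auto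
  finally have 3: "\<bar>G s * (y (s + e) - y s - w s * (g (s + e) - g s))\<bar> \<le> E * (L / T * e powr (1 + \<gamma>))"
    unfolding abs_mult using G_pos[of s] G_le_E[of s] E_pos by (intro mult_mono) auto
  have "\<bar>G (s + e) - G s - w s * G s * (g (s + e) - g s)\<bar> \<le> E * (4 * L\<^sup>2 * e powr (2 * \<gamma>) + L / T * e powr (1 + \<gamma>))"
  proof -
    have "G (s + e) - G s - w s * G s * (g (s + e) - g s) =
      (G (s + e) - G s - G s * (y (s + e) - y s)) + G s * (y (s + e) - y s - w s * (g (s + e) - g s))"
      by (simp add: algebra_simps)
    then show ?thesis using 2 3 by (simp only: distrib_left abs_triangle_ineq[THEN order_trans, OF add_mono])
  qed
  then have 4: "\<bar>v (y s) * (G (s + e) - G s - w s * G s * (g (s + e) - g s))\<bar> \<le>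
      V * (E * (4 * L\<^sup>2 * e powr (2 * \<gamma>) + L / T * e powr (1 + \<gamma>)))"
    unfolding abs_mult[of "v (y s)"] using bounded_v V_nonneg by (intro mult_mono) auto
  have "f (G (s + e)) - f (G s) - X s * (g (s + e) - g s) =
     (f (G (s + e)) - f (G s) - v (y s) * (G (s + e) - G s)) + v (y s) * (G (s + e) - G s - w s * G s * (g (s + e) - g s))"
    by (simp add: X_def algebra_simps)
  then show ?thesis using 1 4 by (simp only: abs_triangle_ineq[THEN order_trans, OF add_mono])
qed

text \<open>With a primitive \<open>\<Phi>\<close> of the continuous function
  \<open>f \<circ> G\<close> the integral of the increments reduces to difference quotients of
  \<open>\<Phi>\<close> at \<open>T\<close> and at 0. Differentiability of \<open>f\<close> does not
  enter.\<close>

lemma average_increment_limit: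
  assumes e: "\<And>n. 0 < e n" "e \<longlonglongrightarrow> 0"
  shows "set_integrable lborel {0..T} (\<lambda>s. (f (G (s + e n)) - f (G s)) / e n)"
    and "(\<lambda>n. LINT s:{0..T}|lborel. (f (G (s + e n)) - f (G s)) / e n) \<longlonglongrightarrow> f (G T) - f (G 0)"
proof -
  have cont: "continuous_on UNIV (\<lambda>s. f (G s))"
    by (intro continuous_on_compose2[OF continuous_f continuous_G]) auto
  then have isc: "isCont (\<lambda>s. f (G s)) s" for s by (simp add: continuous_on_eq_continuous_at)
  obtain \<Phi> where \<Phi>: "\<And>x. (\<Phi> has_real_derivative f (G x)) (at x)"
    using einterval_antiderivative[of "-\<infinity>" "\<infinity>" "\<lambda>s. f (G s)"] isc
    by (auto simp: has_real_derivative_iff_has_vector_derivative)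
  have d: "((\<lambda>s. (\<Phi> (s + e n) - \<Phi> s) / e n) has_real_derivative (f (G (s + e n)) - f (G s)) / e n) (at s)" for n s
    using e(1)[of n] by (auto intro!: derivative_eq_intros DERIV_chain2[OF \<Phi>] \<Phi>)
  have c: "isCont (\<lambda>s. (f (G (s + e n)) - f (G s)) / e n) s" for n s
    using e(1)[of n] by (intro continuous_intros isc isCont_o2[OF _ isc]) auto
  have hb: "has_bochner_integral lborel (\<lambda>s. (f (G (s + e n)) - f (G s)) / e n * indicator {0..T} s)
      ((\<Phi> (T + e n) - \<Phi> T) / e n - (\<Phi> (0 + e n) - \<Phi> 0) / e n)" for n
    using T_pos d c by (intro has_bochner_integral_FTC_Icc_real) auto
  show "set_integrable lborel {0..T} (\<lambda>s. (f (G (s + e n)) - f (G s)) / e n)"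
    using has_bochner_integral_integrable hb[of n] unfolding set_integrable_def by (simp add: has_bochner_integral_iff mult.commute)
  have eq: "(LINT s:{0..T}|lborel. (f (G (s + e n)) - f (G s)) / e n) = (\<Phi> (T + e n) - \<Phi> T) / e n - (\<Phi> (0 + e n) - \<Phi> 0) / e n" for n
    using hb[of n] unfolding set_lebesgue_integral_def by (simp add: has_bochner_integral_iff mult.commute)
  have e0: "filterlim e (at 0) sequentially"
    using e by (auto simp: filterlim_at less_imp_neq[THEN not_sym] intro: always_eventually)
  have "(\<lambda>n. (\<Phi> (x + e n) - \<Phi> x) / e n) \<longlonglongrightarrow> f (G x)" for x
    by (rule filterlim_compose[OF DERIV_D[OF \<Phi>] e0])
  then show "(\<lambda>n. LINT s:{0..T}|lborel. (f (G (s + e n)) - f (G s)) / e n) \<longlonglongrightarrow> f (G T) - f (G 0)"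
    unfolding eq by (intro tendsto_diff)
qed

lemma set_integral_osc:
  assumes "0 < r"
  shows "set_integrable lborel {0..T} (osc r)"
    and "(LINT t:{0..T}|lborel. osc r t) \<le> C * (2 * (L + 1)) powr \<kappa> * r powr (\<gamma> * \<kappa>)"
proof -
  have [measurable]: "osc r \<in> borel_measurable borel"
    unfolding osc_def[abs_def] \<delta>_def using y.measurable_g by measurable
  have nn: "(\<integral>\<^sup>+t. ennreal (indicator {0..T} t *\<^sub>R osc r t) \<partial>lborel) \<le> ennreal (C * (2 * (L + 1)) powr \<kappa> * r powr (\<gamma> * \<kappa>))"
  proof -
    have "(\<integral>\<^sup>+t. ennreal (indicator {0..T} t *\<^sub>R osc r t) \<partial>lborel) = (\<integral>\<^sup>+t\<in>{0..T}. ennreal (osc r t) \<partial>lborel)"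
      by (intro nn_integral_cong) (auto simp: indicator_def)
    then show ?thesis using nn_integral_osc[OF assms] by simp
  qed
  have pos: "AE t in lborel. 0 \<le> indicator {0..T} t *\<^sub>R osc r t"
    using osc_nonneg by auto
  show "set_integrable lborel {0..T} (osc r)"
    unfolding set_integrable_def using nn by (intro integrableI_nonneg pos) (auto simp: le_less_trans)
  show "(LINT t:{0..T}|lborel. osc r t) \<le> C * (2 * (L + 1)) powr \<kappa> * r powr (\<gamma> * \<kappa>)"
    unfolding set_lebesgue_integral_def using nn C_nonneg
    by (subst integral_eq_nn_integral[OF _ pos]) (auto intro!: enn2real_leI)
qed

text \<open>The averages of \<open>f \<circ> G\<close> and those of \<open>X\<close> against the
  increments of \<open>g\<close> have known limits, and their difference tends to 0; the two limits
  are therefore equal.\<close>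

theorem integral_kernel: "set_integrable lebesgue {0..T} kernel" "(LINT x:{0..T}|lebesgue. kernel x) = f (G T) - f (G 0)"
proof -
  define e where "e n = 1 / real (Suc n)" for n
  have e: "0 < e n" for n by (simp add: e_def)
  have e0: "e \<longlonglongrightarrow> 0" unfolding e_def using LIMSEQ_inverse_real_of_nat by (simp add: inverse_eq_divide)
  note [measurable] = continuous_f[THEN borel_measurable_continuous_onI]
  show "set_integrable lebesgue {0..T} kernel" using e e0 by (rule gls_limit)
  \<comment> \<open>The bound of \<open>chain_rule_remainder\<close>, integrated over
    \<open>{0..T}\<close> and divided by \<open>e n\<close>.\<close>
  define c where "c n = C * (2 * (L + 1)) powr \<kappa> * (2 * E * L) * e n powr (\<gamma> + \<gamma> * \<kappa> - 1) +
     T * (V * (E * (4 * L\<^sup>2 * e n powr (2 * \<gamma> - 1) + L / T * e n powr \<gamma>)))" for n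
  \<comment> \<open>From \<open>1 - \<gamma> < a < \<gamma> * \<kappa> \<le> \<gamma>\<close> one
    reads off \<open>1 < \<gamma> + \<gamma> * \<kappa>\<close> and \<open>1 < 2 * \<gamma>\<close>,
    so all powers of \<open>e n\<close> in \<open>c n\<close> tend to 0.\<close>
  have "\<gamma> * \<kappa> \<le> \<gamma> * 1" using exponent_bounds \<gamma>_pos by (intro mult_left_mono) auto
  then have ex: "0 < \<gamma> + \<gamma> * \<kappa> - 1" "0 < 2 * \<gamma> - 1" using exponent_bounds by auto
  have p0: "(\<lambda>n. e n powr p) \<longlonglongrightarrow> 0" if "0 < p" for p
    by (rule tendsto_zero_powrI[OF e0 tendsto_const always_eventually that]) (use e in \<open>auto intro: less_imp_le\<close>)
  have "c \<longlonglongrightarrow> C * (2 * (L + 1)) powr \<kappa> * (2 * E * L) * 0 + T * (V * (E * (4 * L\<^sup>2 * 0 + L / T * 0)))"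
    unfolding c_def by (intro tendsto_add tendsto_mult tendsto_const p0 ex \<gamma>_pos)
  then have c0: "c \<longlonglongrightarrow> 0" by simp
  have bound: "\<bar>(LINT s:{0..T}|lborel. (f (G (s + e n)) - f (G s)) / e n) - (LINT s:{0..T}|lborel. X s * ((g (s + e n) - g s) / e n))\<bar> \<le> c n" for n
  proof -
    define M where "M = V * (E * (4 * L\<^sup>2 * e n powr (2 * \<gamma>) + L / T * e n powr (1 + \<gamma>)))"
    let ?i1 = "\<lambda>s. (f (G (s + e n)) - f (G s)) / e n"
    let ?i2 = "\<lambda>s. X s * ((g (s + e n) - g s) / e n)"
    have i1: "set_integrable lborel {0..T} ?i1"
      by (rule average_increment_limit(1)[OF e e0])
    have i2: "set_integrable lborel {0..T} ?i2"
      unfolding set_integrable_def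
    proof (rule integrableI_bounded_set_indicator[where B="(V * E) * (L * e n powr \<gamma> / e n)"])
      show "AE s in lborel. s \<in> {0..T} \<longrightarrow> norm (?i2 s) \<le> (V * E) * (L * e n powr \<gamma> / e n)"
      proof (intro AE_I2 impI)
        fix s
        have "\<bar>g (s + e n) - g s\<bar> / e n \<le> L * e n powr \<gamma> / e n"
          using holder[of "s + e n" s] e[of n] by (intro divide_right_mono) auto
        then show "norm (?i2 s) \<le> (V * E) * (L * e n powr \<gamma> / e n)"
          using abs_X_le[of s] e[of n] V_nonneg E_pos
          unfolding real_norm_def abs_mult by (intro mult_mono) auto
      qed
    qed (auto simp: emeasure_lborel_Icc_eq)
    have i3: "set_integrable lborel {0..T} (\<lambda>s. (2 * E * L * e n powr \<gamma>) * osc (e n) s / e n + M / e n)"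
      by (intro set_integral_add(1) set_integrable_divide set_integrable_mult_right set_integral_osc(1) e)
        (auto simp: set_integrable_def emeasure_lborel_Icc_eq)
    have "\<bar>(LINT s:{0..T}|lborel. ?i1 s) - (LINT s:{0..T}|lborel. ?i2 s)\<bar> = \<bar>LINT s:{0..T}|lborel. ?i1 s - ?i2 s\<bar>"
      by (simp only: set_integral_diff(2)[OF i1 i2])
    also have "\<dots> \<le> (LINT s:{0..T}|lborel. (2 * E * L * e n powr \<gamma>) * osc (e n) s / e n + M / e n)"
      unfolding set_lebesgue_integral_def real_norm_def[symmetric]
    proof (rule Bochner_Integration.integral_norm_bound_integral)
      show "integrable lborel (\<lambda>s. indicator {0..T} s *\<^sub>R (?i1 s - ?i2 s))"
        using set_integral_diff(1)[OF i1 i2] by (simp add: set_integrable_def)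
      show "integrable lborel (\<lambda>s. indicator {0..T} s *\<^sub>R ((2 * E * L * e n powr \<gamma>) * osc (e n) s / e n + M / e n))"
        using i3 by (simp add: set_integrable_def)
      fix s
      show "norm (indicator {0..T} s *\<^sub>R (?i1 s - ?i2 s)) \<le> indicator {0..T} s *\<^sub>R ((2 * E * L * e n powr \<gamma>) * osc (e n) s / e n + M / e n)"
      proof (cases "s \<in> {0..T}")
        case True
        have "?i1 s - ?i2 s = (f (G (s + e n)) - f (G s) - X s * (g (s + e n) - g s)) / e n"
          by (simp add: diff_divide_distrib[of _ "X s * _"])
        then have "\<bar>?i1 s - ?i2 s\<bar> = \<bar>f (G (s + e n)) - f (G s) - X s * (g (s + e n) - g s)\<bar> / e n"
          using e[of n] by (simp only: abs_divide abs_of_pos)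
        also have "\<dots> \<le> (2 * E * L * e n powr \<gamma> * osc (e n) s + M) / e n"
          using chain_rule_remainder[OF True e[of n]] e[of n] by (intro divide_right_mono) (auto simp: M_def)
        finally show ?thesis using True by (simp add: add_divide_distrib)
      qed simp
    qed
    also have "\<dots> = (2 * E * L * e n powr \<gamma>) / e n * (LINT s:{0..T}|lborel. osc (e n) s) + T * M / e n"
    proof -
      have "(LINT s:{0..T}|lborel. (2 * E * L * e n powr \<gamma>) * osc (e n) s / e n + M / e n) =
         (LINT s:{0..T}|lborel. (2 * E * L * e n powr \<gamma>) * osc (e n) s / e n) + (LINT s:{0..T}|lborel. M / e n)"
        by (intro set_integral_add(2) set_integrable_divide set_integrable_mult_right set_integral_osc(1) e)
          (auto simp: set_integrable_def emeasure_lborel_Icc_eq)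
      also have "(LINT s:{0..T}|lborel. M / e n) = T * M / e n"
        using T_pos by (simp add: set_lebesgue_integral_def)
      finally show ?thesis by simp
    qed
    also have "\<dots> \<le> (2 * E * L * e n powr \<gamma>) / e n * (C * (2 * (L + 1)) powr \<kappa> * e n powr (\<gamma> * \<kappa>)) + T * M / e n"
      using E_pos L_nonneg e[of n] by (intro add_right_mono mult_left_mono set_integral_osc(2)) auto
    also have "\<dots> = c n"
    proof -
      have eqs: "e n powr (\<gamma> + \<gamma> * \<kappa> - 1) = e n powr \<gamma> * e n powr (\<gamma> * \<kappa>) / e n"
        "e n powr (2 * \<gamma> - 1) = e n powr (2 * \<gamma>) / e n" "e n powr (1 + \<gamma>) = e n * e n powr \<gamma>"
        using e[of n] by (simp_all add: powr_add powr_diff)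
      show ?thesis unfolding c_def M_def eqs
        using T_pos e[of n] by (simp add: field_simps)
    qed
    finally show ?thesis .
  qed
  have "(\<lambda>n. (LINT s:{0..T}|lborel. (f (G (s + e n)) - f (G s)) / e n) - (LINT s:{0..T}|lborel. X s * ((g (s + e n) - g s) / e n))) \<longlonglongrightarrow> 0"
    by (rule Lim_null_comparison[OF always_eventually c0]) (use bound in simp)
  moreover have "(\<lambda>n. (LINT s:{0..T}|lborel. (f (G (s + e n)) - f (G s)) / e n) - (LINT s:{0..T}|lborel. X s * ((g (s + e n) - g s) / e n)))
     \<longlonglongrightarrow> f (G T) - f (G 0) - (LINT x:{0..T}|lebesgue. kernel x)"
    by (intro tendsto_diff average_increment_limit(2) gls_limit(2) e e0)
  ultimately have "0 = f (G T) - f (G 0) - (LINT x:{0..T}|lebesgue. kernel x)" by (rule LIMSEQ_unique)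
  then show "(LINT x:{0..T}|lebesgue. kernel x) = f (G T) - f (G 0)" by simp
qed

end

section \<open>Besov membership and the generalized integral along the path\<close>

context averaged_path
begin

text \<open>Stated for a function that agrees with \<open>X\<close> on \<open>{0..T}\<close> only,
  since the integrand of the theorem is not clamped. The first part of the norm is finite because
  \<open>X\<close> is bounded and \<open>a < 1\<close>.\<close>

lemma besov2_integrand:
  assumes eq: "\<And>s. s \<in> {0..T} \<Longrightarrow> h s = X s"
  shows "h \<in> besov2 a T"
proof -
  have "set_borel_measurable lebesgue {0..T} h"
  proof -
    have "(\<lambda>s. indicator {0..T} s *\<^sub>R X s) \<in> borel_measurable lebesgue"
      by (intro measurable_completion) measurable
    moreover have "(\<lambda>s. indicator {0..T} s *\<^sub>R X s) = (\<lambda>s. indicator {0..T} s *\<^sub>R h s)"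
      using eq by (auto simp: indicator_def fun_eq_iff)
    ultimately show ?thesis by (simp add: set_borel_measurable_def)
  qed
  moreover have "besov2_norm a T h < \<infinity>"
  proof -
    have "(\<integral>\<^sup>+t\<in>{0..T}. ennreal (\<bar>h t\<bar> / t powr a) \<partial>lborel) \<le> (\<integral>\<^sup>+t. ennreal (V * E) * (ennreal ((t - 0) powr (1 - a - 1)) * indicator {0..T} t) \<partial>lborel)"
    proof (intro nn_integral_mono)
      fix t
      show "ennreal (\<bar>h t\<bar> / t powr a) * indicator {0..T} t \<le> ennreal (V * E) * (ennreal ((t - 0) powr (1 - a - 1)) * indicator {0..T} t)"
      proof (cases "t \<in> {0..T}")
        case True
        have "\<bar>h t\<bar> / t powr a \<le> V * E * t powr (- a)"
          using abs_X_le[of t] eq[OF True] by (auto simp: powr_minus divide_inverse intro!: mult_right_mono)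
        then show ?thesis using True V_nonneg E_pos by (simp add: ennreal_mult'[symmetric] ennreal_leI)
      qed simp
    qed
    also have "\<dots> = ennreal (V * E) * ennreal ((T - 0) powr (1 - a) / (1 - a))"
      using exponent T_pos by (subst nn_integral_cmult) (auto simp: powr_left_lborel(1)[of "1 - a" 0 T, simplified])
    finally have 1: "(\<integral>\<^sup>+t\<in>{0..T}. ennreal (\<bar>h t\<bar> / t powr a) \<partial>lborel) < \<infinity>"
      by (rule le_less_trans) (simp add: ennreal_mult_less_top)
    have 2: "(\<integral>\<^sup>+t\<in>{0..T}. (\<integral>\<^sup>+s\<in>{0..t}. ennreal (\<bar>h t - h s\<bar> / (t - s) powr (a + 1)) \<partial>lborel) \<partial>lborel) < \<infinity>"
    proof -
      have "(\<integral>\<^sup>+t\<in>{0..T}. (\<integral>\<^sup>+s\<in>{0..t}. ennreal (\<bar>h t - h s\<bar> / (t - s) powr (a + 1)) \<partial>lborel) \<partial>lborel) =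
         (\<integral>\<^sup>+t\<in>{0..T}. (\<integral>\<^sup>+s\<in>{0..t}. ennreal (\<bar>X t - X s\<bar> / (t - s) powr (a + 1)) \<partial>lborel) \<partial>lborel)"
      proof (intro nn_integral_cong)
        fix t
        have "(\<integral>\<^sup>+s\<in>{0..t}. ennreal (\<bar>h t - h s\<bar> / (t - s) powr (a + 1)) \<partial>lborel) =
          (\<integral>\<^sup>+s\<in>{0..t}. ennreal (\<bar>X t - X s\<bar> / (t - s) powr (a + 1)) \<partial>lborel)" if "t \<in> {0..T}"
          using that eq by (intro nn_integral_cong) (auto simp: indicator_def)
        then show "(\<integral>\<^sup>+s\<in>{0..t}. ennreal (\<bar>h t - h s\<bar> / (t - s) powr (a + 1)) \<partial>lborel) * indicator {0..T} t =
          (\<integral>\<^sup>+s\<in>{0..t}. ennreal (\<bar>X t - X s\<bar> / (t - s) powr (a + 1)) \<partial>lborel) * indicator {0..T} t"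
          by (simp add: indicator_def)
      qed
      then show ?thesis using finite_double_integral by simp
    qed
    from 1 2 show ?thesis by (simp add: besov2_norm_def nn_integral_completion)
  qed
  ultimately show ?thesis by (simp add: besov2_def)
qed

text \<open>Clamped and original functions differ only outside \<open>{0..T}\<close>, which affects
  neither the fractional derivatives at interior points nor the left limit at \<open>T\<close>; the
  latter is \<open>g T\<close> by continuity.\<close>

lemma has_gls_integral_integrand:
  assumes h: "\<And>s. s \<in> {0..T} \<Longrightarrow> h s = X s" and k: "\<And>s. s \<in> {0..T} \<Longrightarrow> k s = g s"
    and kb: "k \<in> besov1 (1 - a) T"
  shows "has_gls_integral h k T T (f (G T) - f (G 0))"
proof -
  have "(g \<longlongrightarrow> g T) (at_left T)"
    using continuous by (auto simp: continuous_on_eq_continuous_at isCont_def intro: filterlim_at_split[THEN iffD1, THEN conjunct1])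
  moreover have "\<forall>\<^sub>F s in at_left T. g s = k s"
    using T_pos k unfolding eventually_at_left_field by (intro exI[of _ 0]) auto
  ultimately have "(k \<longlongrightarrow> g T) (at_left T)"
    by (rule Lim_transform_eventually)
  then have Lim: "Lim (at_left T) k = g T" by (intro tendsto_Lim) auto
  let ?h = "\<lambda>x. frac_deriv_left a h x * frac_deriv_right (1 - a) T (\<lambda>y. Lim (at_left T) k - k y) x"
  have "AE x in lebesgue. x \<in> {0..T} \<longrightarrow> kernel x = ?h x"
    unfolding AE_completion_iff using AE_lborel_singleton[of 0] AE_lborel_singleton[of T]
  proof eventually_elim
    case (elim x)
    show ?case
    proof
      assume "x \<in> {0..T}"
      then have x: "0 < x" "x < T" using elim by auto
      have "frac_deriv_left a h x = frac_deriv_left a X x"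
        by (rule frac_deriv_left_cong[OF h x])
      moreover have "frac_deriv_right (1 - a) T (\<lambda>y. Lim (at_left T) k - k y) x = frac_deriv_right (1 - a) T (\<lambda>y. g T - g y) x"
        using k by (intro frac_deriv_right_cong[OF _ x]) (simp add: Lim)
      ultimately show "kernel x = ?h x" by (simp add: kernel_def)
    qed
  qed
  from set_integral_lebesgue_cong_AE[OF integral_kernel(1) this]
  have "set_integrable lebesgue {0..T} ?h" "(LINT x:{0..T}|lebesgue. ?h x) = f (G T) - f (G 0)"
    by (simp_all add: integral_kernel(2))
  then show ?thesis
    unfolding has_gls_integral_def Let_def
    using exponent besov2_integrand[OF h] kb by (intro exI[of _ a]) auto
qed

end

section \<open>Left derivatives of convex functions as subgradients\<close>

lemma left_deriv_subgradient:
  fixes f :: "real \<Rightarrow> real"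
  assumes f: "convex_on UNIV f"
  shows "f x + left_deriv f x * (z - x) \<le> f z"
proof -
  \<comment> \<open>As \<open>left_deriv\<close> is a \<open>vector_derivative\<close>, which is
    informative only once a derivative exists, existence comes first: the left slopes
    \<open>q\<close> increase towards \<open>x\<close>, are bounded by every right slope, and so
    converge to their supremum \<open>d\<close>.\<close>
  define q where "q t = (f x - f t) / (x - t)" for t
  have incr: "q s \<le> q t" if "s < t" "t < x" for s t
    using convex_on_slope_le(2)[OF f _ _ that] that
    by (simp add: q_def) (metis minus_diff_eq minus_divide_divide)
  have right: "q t \<le> (f u - f x) / (u - x)" if "t < x" "x < u" for t u
  proof -
    have "(f t - f x) / (t - x) \<le> (f x - f u) / (x - u)"
      using convex_on_slope_le[OF f _ _ that] by (meson UNIV_I order_trans)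
    then show ?thesis unfolding q_def by (metis minus_diff_eq minus_divide_divide)
  qed
  define d where "d = (SUP t\<in>{..<x}. q t)"
  have bdd: "bdd_above (q ` {..<x})"
    using right[of _ "x + 1"] by (intro bdd_aboveI2[of _ _ "(f (x + 1) - f x) / (x + 1 - x)"]) auto
  have q_le: "q t \<le> d" if "t < x" for t
    unfolding d_def using bdd that by (intro cSUP_upper) auto
  have d_le: "d \<le> (f u - f x) / (u - x)" if "x < u" for u
    unfolding d_def using right that by (intro cSUP_least) auto
  have "(q \<longlongrightarrow> d) (at_left x)"
  proof (rule order_tendstoI)
    fix c assume "c < d"
    then obtain t where t: "t < x" "c < q t"
      unfolding d_def using bdd by (subst (asm) less_cSUP_iff) auto
    have "c < q s" if "t < s" "s < x" for s
      using incr[OF that] t by simp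
    then show "\<forall>\<^sub>F s in at_left x. c < q s"
      using t eventually_at_left_field by blast
  next
    fix c assume "d < c"
    then have "q s < c" if "x - 1 < s" "s < x" for s
      using q_le[OF that(2)] by simp
    then show "\<forall>\<^sub>F s in at_left x. q s < c"
      unfolding eventually_at_left_field by (intro exI[of _ "x - 1"]) auto
  qed
  then have "((\<lambda>t. (f t - f x) / (t - x)) \<longlongrightarrow> d) (at_left x)"
  proof (rule filterlim_cong[THEN iffD1, OF refl refl, rotated])
    show "\<forall>\<^sub>F t in at_left x. q t = (f t - f x) / (t - x)"
      by (intro always_eventually allI) (metis minus_diff_eq minus_divide_divide q_def)
  qed
  then have "(f has_field_derivative d) (at_left x)"
    by (simp add: has_field_derivative_iff)
  then have ld: "left_deriv f x = d"
    unfolding left_deriv_def has_real_derivative_iff_has_vector_derivative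
    by (intro vector_derivative_within) auto
  show ?thesis
  proof (cases z x rule: linorder_cases)
    case less
    then have "(f x - f z) / (x - z) \<le> d" using q_le by (simp add: q_def)
    then have "f x - f z \<le> d * (x - z)" using less by (simp add: divide_le_eq)
    then show ?thesis by (simp add: ld algebra_simps)
  next
    case greater
    then have "d * (z - x) \<le> f z - f x" using d_le[of z] by (simp add: le_divide_eq)
    then show ?thesis by (simp add: ld)
  qed simp
qed

section \<open>Gaussian laws and occupation bounds\<close>

text \<open>On a truncated line the two shifted integrals cancel except on two boundary intervals of
  length \<open>2 * d\<close>, where \<open>v\<close> is at most \<open>V\<close> in absolute value.
  The bound does not depend on the truncation, and Fatou's lemma removes it.\<close>

lemma nn_integral_oscillation_le:
  fixes v :: "real \<Rightarrow> real"
  assumes v: "mono v" and V: "\<And>x. \<bar>v x\<bar> \<le> V" and d: "0 \<le> d"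
  shows "(\<integral>\<^sup>+x. ennreal (v (x + d) - v (x - d)) \<partial>lborel) \<le> ennreal (4 * V * d)"
proof -
  have [measurable]: "v \<in> borel_measurable borel" using v by (rule borel_measurable_mono)
  have V0: "0 \<le> V" using V[of 0] by linarith
  have osc0: "0 \<le> v (x + d) - v (x - d)" for x using d v by (auto simp: mono_def)
  define h where "h n x = ennreal (v (x + d) - v (x - d)) * indicator {- real n..real n} x" for n x
  have bound: "(\<integral>\<^sup>+x. h n x \<partial>lborel) \<le> ennreal (4 * V * d)" for n
  proof -
    define N where "N = real n"
    have i: "integrable lborel (\<lambda>x. indicator {a..b} x *\<^sub>R v (x + c))" for a b c
      by (rule integrableI_bounded_set_indicator[where B=V]) (use V in \<open>auto simp: emeasure_lborel_Icc_eq\<close>)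
    have j: "integrable lborel (\<lambda>x. V * indicator {a..b} x)" for a b :: real
      by (intro integrable_mult_right integrable_real_indicator) (auto simp: emeasure_lborel_Icc_eq)
    have sh: "(LINT x|lborel. indicator {- N..N} x *\<^sub>R v (x + c)) = (LINT x|lborel. indicator {- N + c..N + c} x *\<^sub>R v x)" for c
      by (subst lborel_integral_real_affine[where c=1 and t="-c"]) (auto intro!: Bochner_Integration.integral_cong simp: indicator_def)
    have "(\<integral>\<^sup>+x. h n x \<partial>lborel) = (\<integral>\<^sup>+x. ennreal (indicator {- N..N} x *\<^sub>R v (x + d) - indicator {- N..N} x *\<^sub>R v (x + (- d))) \<partial>lborel)"
      by (intro nn_integral_cong) (auto simp: h_def N_def indicator_def)
    also have "\<dots> = ennreal (LINT x|lborel. indicator {- N..N} x *\<^sub>R v (x + d) - indicator {- N..N} x *\<^sub>R v (x + (- d)))"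
      using osc0 by (intro nn_integral_eq_integral Bochner_Integration.integrable_diff i) (auto simp: indicator_def)
    finally have eq: "(\<integral>\<^sup>+x. h n x \<partial>lborel) = \<dots>" .
    have "(LINT x|lborel. indicator {- N..N} x *\<^sub>R v (x + d) - indicator {- N..N} x *\<^sub>R v (x + (- d))) =
       (LINT x|lborel. indicator {- N + d..N + d} x *\<^sub>R v (x + 0)) - (LINT x|lborel. indicator {- N - d..N - d} x *\<^sub>R v (x + 0))"
      by (simp add: Bochner_Integration.integral_diff[OF i i, simplified] sh[of d, simplified] sh[of "- d", simplified]
          Bochner_Integration.integral_diff[OF i[of _ _ d, simplified] i[of _ _ "- d", simplified]])
    also have "\<dots> = (LINT x|lborel. indicator {- N + d..N + d} x *\<^sub>R v (x + 0) - indicator {- N - d..N - d} x *\<^sub>R v (x + 0))"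
      by (rule Bochner_Integration.integral_diff[OF i i, symmetric])
    also have "\<dots> \<le> (LINT x|lborel. V * indicator {N - d..N + d} x + V * indicator {- N - d..- N + d} x)"
    proof (rule integral_mono)
      show "integrable lborel (\<lambda>x. indicator {- N + d..N + d} x *\<^sub>R v (x + 0) - indicator {- N - d..N - d} x *\<^sub>R v (x + 0))"
        by (intro Bochner_Integration.integrable_diff i)
      show "integrable lborel (\<lambda>x. V * indicator {N - d..N + d} x + V * indicator {- N - d..- N + d} x)"
        by (intro Bochner_Integration.integrable_add j)
      show "indicator {- N + d..N + d} x *\<^sub>R v (x + 0) - indicator {- N - d..N - d} x *\<^sub>R v (x + 0)
         \<le> V * indicator {N - d..N + d} x + V * indicator {- N - d..- N + d} x" for x
        using V[of x] V0 d by (auto simp: indicator_def abs_le_iff)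
    qed
    also have "\<dots> = 4 * V * d"
      unfolding Bochner_Integration.integral_add[OF j j] using d by simp
    finally show ?thesis unfolding eq by (rule ennreal_leI)
  qed
  have "(\<integral>\<^sup>+x. ennreal (v (x + d) - v (x - d)) \<partial>lborel) = (\<integral>\<^sup>+x. liminf (\<lambda>n. h n x) \<partial>lborel)"
  proof (intro nn_integral_cong)
    fix x
    obtain n0 :: nat where n0: "\<bar>x\<bar> \<le> real n0" using real_arch_simple by blast
    have "\<forall>\<^sub>F n in sequentially. h n x = ennreal (v (x + d) - v (x - d))"
      using eventually_ge_at_top[of n0] by eventually_elim (use n0 in \<open>auto simp: h_def indicator_def\<close>)
    then have "(\<lambda>n. h n x) \<longlonglongrightarrow> ennreal (v (x + d) - v (x - d))" by (rule tendsto_eventually)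
    then show "ennreal (v (x + d) - v (x - d)) = liminf (\<lambda>n. h n x)"
      by (simp add: lim_imp_Liminf)
  qed
  also have "\<dots> \<le> liminf (\<lambda>n. \<integral>\<^sup>+x. h n x \<partial>lborel)"
    by (intro nn_integral_liminf) (simp add: h_def)
  also have "\<dots> \<le> ennreal (4 * V * d)"
    by (rule order_trans[OF Liminf_le_Limsup Limsup_bounded]) (auto intro!: always_eventually bound)
  finally show ?thesis .
qed

text \<open>The law of \<open>Z\<close> is dominated by \<open>k\<close> times Lebesgue measure.
  Testing open sets only makes the property stable under almost sure limits, and outer regularity
  recovers all Borel sets.\<close>

definition small_law :: "'a measure \<Rightarrow> ('a \<Rightarrow> real) \<Rightarrow> real \<Rightarrow> bool" where
  "small_law M Z k \<longleftrightarrow> (\<forall>U. open U \<longrightarrow> emeasure M (Z -` U \<inter> space M) \<le> ennreal k * emeasure lborel U)"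

text \<open>A Borel set is enclosed in an open set whose excess has Lebesgue measure at most
  \<open>e / k\<close>, so the domination passes to all Borel sets and then to integrals.\<close>

lemma nn_integral_small_law:
  fixes Z :: "'a \<Rightarrow> real" and \<phi> :: "real \<Rightarrow> ennreal"
  assumes Z [measurable]: "Z \<in> borel_measurable M" and small: "small_law M Z k" and k: "0 < k"
    and [measurable]: "\<phi> \<in> borel_measurable borel"
  shows "(\<integral>\<^sup>+\<omega>. \<phi> (Z \<omega>) \<partial>M) \<le> ennreal k * (\<integral>\<^sup>+x. \<phi> x \<partial>lborel)"
proof -
  have le: "emeasure (distr M borel Z) A \<le> emeasure (scale_measure (ennreal k) lborel) A"
    if A: "A \<in> sets borel" for A
  proof (rule ennreal_le_epsilon)
    fix e :: real assume e: "0 < e"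
    obtain U where U: "open U" "A \<subseteq> U" "emeasure lborel (U - A) \<le> ennreal (e / k)"
      using outer_regular_lborel_le[OF A, of "e / k"] e k by auto
    have [measurable]: "U \<in> sets borel" using U by auto
    have "emeasure (distr M borel Z) A \<le> emeasure (distr M borel Z) U"
      using U by (intro emeasure_mono) auto
    also have "\<dots> \<le> ennreal k * emeasure lborel U"
      using small U by (auto simp: small_law_def emeasure_distr)
    also have "emeasure lborel U = emeasure lborel A + emeasure lborel (U - A)"
      using U A by (subst plus_emeasure) (auto simp: Un_absorb1)
    also have "ennreal k * \<dots> \<le> ennreal k * (emeasure lborel A + ennreal (e / k))"
      using U by (intro mult_left_mono add_left_mono) auto
    also have "\<dots> = emeasure (scale_measure (ennreal k) lborel) A + ennreal e"
      using k e by (simp add: distrib_left ennreal_mult[symmetric])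
    finally show "emeasure (distr M borel Z) A \<le> emeasure (scale_measure (ennreal k) lborel) A + ennreal e" .
  qed
  have "(\<integral>\<^sup>+\<omega>. \<phi> (Z \<omega>) \<partial>M) = (\<integral>\<^sup>+x. \<phi> x \<partial>distr M borel Z)"
    by (simp add: nn_integral_distr)
  also have "\<dots> \<le> (\<integral>\<^sup>+x. \<phi> x \<partial>scale_measure (ennreal k) lborel)"
  proof (rule nn_integral_mono_measure)
    have "emeasure (distr M borel Z) A \<le> emeasure (scale_measure (ennreal k) lborel) A" for A
      by (cases "A \<in> sets borel") (simp_all add: le emeasure_notin_sets del: emeasure_scale_measure)
    then show "distr M borel Z \<le> scale_measure (ennreal k) lborel"
      unfolding le_measure_iff by (simp add: le_fun_def space_scale_measure)
  qed simp
  also have "\<dots> = ennreal k * (\<integral>\<^sup>+x. \<phi> x \<partial>lborel)"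
    by (rule nn_integral_scale_measure) measurable
  finally show ?thesis .
qed

lemma nn_integral_indicator_vimage:
  assumes [measurable]: "Z \<in> measurable M N" "U \<in> sets N"
  shows "(\<integral>\<^sup>+\<omega>. indicator U (Z \<omega>) \<partial>M) = emeasure M (Z -` U \<inter> space M)"
proof -
  have "(\<integral>\<^sup>+\<omega>. indicator U (Z \<omega>) \<partial>M) = (\<integral>\<^sup>+\<omega>. indicator (Z -` U \<inter> space M) \<omega> \<partial>M)"
    by (intro nn_integral_cong) (auto simp: indicator_def)
  then show ?thesis by (simp add: measurable_sets)
qed

text \<open>The indicator of an open set is lower semicontinuous, so Fatou's lemma bounds the
  probability for the limit by the probabilities for the approximants.\<close>

lemma small_law_limit:
  fixes Z :: "'a \<Rightarrow> real" and Zn :: "nat \<Rightarrow> 'a \<Rightarrow> real"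
  assumes [measurable]: "Z \<in> borel_measurable M" "\<And>n. Zn n \<in> borel_measurable M"
    and lim: "AE \<omega> in M. (\<lambda>n. Zn n \<omega>) \<longlonglongrightarrow> Z \<omega>" and small: "\<And>n. small_law M (Zn n) k"
  shows "small_law M Z k"
  unfolding small_law_def
proof (intro allI impI)
  fix U :: "real set" assume U: "open U"
  have [measurable]: "U \<in> sets borel" using U by auto
  have "emeasure M (Z -` U \<inter> space M) = (\<integral>\<^sup>+\<omega>. indicator U (Z \<omega>) \<partial>M)"
    by (rule nn_integral_indicator_vimage[symmetric]) measurable
  also have "\<dots> \<le> (\<integral>\<^sup>+\<omega>. liminf (\<lambda>n. indicator U (Zn n \<omega>)) \<partial>M)"
  proof (rule nn_integral_mono_AE)
    show "AE \<omega> in M. indicator U (Z \<omega>) \<le> liminf (\<lambda>n. indicator U (Zn n \<omega>) :: ennreal)"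
      using lim
    proof eventually_elim
      case (elim \<omega>)
      show ?case
      proof (cases "Z \<omega> \<in> U")
        case True
        then have "\<forall>\<^sub>F n in sequentially. Zn n \<omega> \<in> U"
          using elim U by (auto dest: topological_tendstoD)
        then have "1 \<le> liminf (\<lambda>n. indicator U (Zn n \<omega>) :: ennreal)"
          by (intro Liminf_bounded) (auto elim!: eventually_mono)
        then show ?thesis using True by simp
      qed simp
    qed
  qed
  also have "\<dots> \<le> liminf (\<lambda>n. \<integral>\<^sup>+\<omega>. indicator U (Zn n \<omega>) \<partial>M)"
    by (intro nn_integral_liminf) measurable
  also have "\<dots> \<le> ennreal k * emeasure lborel U"
  proof (rule order_trans[OF Liminf_le_Limsup Limsup_bounded])
    have "(\<integral>\<^sup>+\<omega>. indicator U (Zn n \<omega>) \<partial>M) = emeasure M (Zn n -` U \<inter> space M)" for n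
      by (rule nn_integral_indicator_vimage) measurable
    then show "\<forall>\<^sub>F n in sequentially. (\<integral>\<^sup>+\<omega>. indicator U (Zn n \<omega>) \<partial>M) \<le> ennreal k * emeasure lborel U"
      using small U by (auto simp: small_law_def)
  qed simp
  finally show "emeasure M (Z -` U \<inter> space M) \<le> ennreal k * emeasure lborel U" .
qed

text \<open>The maximum of the density is \<open>1 / sqrt (2 * pi * \<sigma>\<^sup>2)\<close>, which
  is below \<open>1 / \<sigma>\<close>.\<close>

lemma small_law_normal:
  assumes X: "distributed M lborel X (normal_density \<mu> \<sigma>)" and \<sigma>: "0 < c" "c \<le> \<sigma>"
  shows "small_law M X (1 / c)"
  unfolding small_law_def
proof (intro allI impI)
  fix U :: "real set" assume U: "open U"
  have le: "normal_density \<mu> \<sigma> x \<le> 1 / c" for x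
  proof -
    have "c \<le> sqrt (2 * pi * \<sigma>\<^sup>2)"
    proof (rule real_le_rsqrt)
      have "c\<^sup>2 \<le> \<sigma>\<^sup>2" using \<sigma> by (intro power_mono) auto
      also have "\<sigma>\<^sup>2 \<le> 2 * pi * \<sigma>\<^sup>2" using pi_gt3 by (simp add: mult_le_cancel_right1)
      finally show "c\<^sup>2 \<le> 2 * pi * \<sigma>\<^sup>2" .
    qed
    then have "1 / sqrt (2 * pi * \<sigma>\<^sup>2) \<le> 1 / c" using \<sigma> by (intro divide_left_mono) auto
    moreover have "exp (- (x - \<mu>)\<^sup>2 / (2 * \<sigma>\<^sup>2)) \<le> 1" by simp
    ultimately have "1 / sqrt (2 * pi * \<sigma>\<^sup>2) * exp (- (x - \<mu>)\<^sup>2 / (2 * \<sigma>\<^sup>2)) \<le> 1 / c * 1"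
      using \<sigma> by (intro mult_mono) auto
    then show ?thesis by (simp add: normal_density_def)
  qed
  have "emeasure M (X -` U \<inter> space M) = (\<integral>\<^sup>+x. ennreal (normal_density \<mu> \<sigma> x) * indicator U x \<partial>lborel)"
    using X U by (intro distributed_emeasure) auto
  also have "\<dots> \<le> (\<integral>\<^sup>+x. ennreal (1 / c) * indicator U x \<partial>lborel)"
    using le by (intro nn_integral_mono mult_right_mono ennreal_leI) auto
  also have "\<dots> = ennreal (1 / c) * emeasure lborel U"
    using U by (intro nn_integral_cmult_indicator) auto
  finally show "emeasure M (X -` U \<inter> space M) \<le> ennreal (1 / c) * emeasure lborel U" .
qed


text \<open>For fixed \<open>d\<close> the mean is linear in \<open>d\<close>, as
  \<open>t powr (- H)\<close> is integrable on \<open>{0..T}\<close> for \<open>H < 1\<close>. One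
  null set has to serve all \<open>\<delta>\<close>, hence a weighted sum over dyadic values; its
  weights \<open>d n powr (- \<kappa>)\<close> are summable against \<open>d n\<close> only for
  \<open>\<kappa> < 1\<close>. Monotonicity in \<open>\<delta>\<close> fills the gaps.\<close>

lemma AE_occupation_bound:
  fixes Z :: "real \<Rightarrow> 'a \<Rightarrow> real" and v :: "real \<Rightarrow> real"
  assumes "prob_space M"
    and Z [measurable]: "(\<lambda>(\<omega>, t). Z t \<omega>) \<in> borel_measurable (M \<Otimes>\<^sub>M borel)"
    and T: "0 < T" and H: "H < 1" and c: "0 < c"
    and small: "\<And>t. 0 < t \<Longrightarrow> t \<le> T \<Longrightarrow> small_law M (Z t) (c * t powr (- H))"
    and v: "mono v" and V: "\<And>x. \<bar>v x\<bar> \<le> V" and \<kappa>: "0 < \<kappa>" "\<kappa> < 1"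
  shows "AE \<omega> in M. \<exists>C\<ge>0. \<forall>\<delta>>0.
    (\<integral>\<^sup>+t\<in>{0..T}. ennreal (v (Z t \<omega> + \<delta>) - v (Z t \<omega> - \<delta>)) \<partial>lborel) \<le> ennreal (C * \<delta> powr \<kappa>)"
proof -
  interpret prob_space M by fact
  interpret pair_sigma_finite M lborel by unfold_locales
  have [measurable]: "v \<in> borel_measurable borel" using v by (rule borel_measurable_mono)
  have [measurable]: "Z t \<in> borel_measurable M" for t
    using measurable_compose[OF measurable_Pair2' Z, of t] by simp
  have V0: "0 \<le> V" using V[of 0] by linarith
  have osc0: "0 \<le> v (x + d) - v (x - d)" if "0 < d" for x d using that v by (auto simp: mono_def)
  define A where "A d \<omega> = (\<integral>\<^sup>+t\<in>{0..T}. ennreal (v (Z t \<omega> + d) - v (Z t \<omega> - d)) \<partial>lborel)" for d \<omega>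
  have [measurable]: "A d \<in> borel_measurable M" for d
    unfolding A_def[abs_def] by measurable
  \<comment> \<open>The factors are the constant of the law, the oscillation bound per unit of
    \<open>d\<close>, and the integral of \<open>t powr (- H)\<close> over
    \<open>{0..T}\<close>.\<close>
  define K where "K = c * (4 * V) * (T powr (1 - H) / (1 - H))"
  have K0: "0 \<le> K" using c V0 H by (simp add: K_def)
  have EA: "(\<integral>\<^sup>+\<omega>. A d \<omega> \<partial>M) \<le> ennreal (K * d)" if d: "0 < d" for d
  proof -
    have "(\<integral>\<^sup>+\<omega>. A d \<omega> \<partial>M) = (\<integral>\<^sup>+t. (\<integral>\<^sup>+\<omega>. ennreal (v (Z t \<omega> + d) - v (Z t \<omega> - d)) * indicator {0..T} t \<partial>M) \<partial>lborel)"
      unfolding A_def by (rule Fubini'[symmetric]) measurable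
    also have "\<dots> \<le> (\<integral>\<^sup>+t. ennreal (c * (4 * V * d)) * (ennreal (t powr (1 - H - 1)) * indicator {0..T} t) \<partial>lborel)"
    proof (rule nn_integral_mono_AE)
      show "AE t in lborel. (\<integral>\<^sup>+\<omega>. ennreal (v (Z t \<omega> + d) - v (Z t \<omega> - d)) * indicator {0..T} t \<partial>M)
         \<le> ennreal (c * (4 * V * d)) * (ennreal (t powr (1 - H - 1)) * indicator {0..T} t)"
        using AE_lborel_singleton[of 0]
      proof eventually_elim
        case (elim t)
        show ?case
        proof (cases "t \<in> {0..T}")
          case True
          with elim have t: "0 < t" "t \<le> T" by auto
          have "(\<integral>\<^sup>+\<omega>. ennreal (v (Z t \<omega> + d) - v (Z t \<omega> - d)) \<partial>M) \<le>
             ennreal (c * t powr (- H)) * (\<integral>\<^sup>+x. ennreal (v (x + d) - v (x - d)) \<partial>lborel)"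
            using small[OF t] c t by (intro nn_integral_small_law[where \<phi>="\<lambda>x. ennreal (v (x + d) - v (x - d))"]) auto
          also have "\<dots> \<le> ennreal (c * t powr (- H)) * ennreal (4 * V * d)"
            using d by (intro mult_left_mono nn_integral_oscillation_le v V) auto
          also have "\<dots> = ennreal (c * (4 * V * d)) * ennreal (t powr (1 - H - 1))"
            using c V0 d by (simp add: ennreal_mult'[symmetric] mult_ac)
          finally show ?thesis using True by simp
        qed simp
      qed
    qed
    also have "\<dots> = ennreal (c * (4 * V * d)) * ennreal (T powr (1 - H) / (1 - H))"
      using powr_left_lborel(1)[of "1 - H" 0 T] T H by (subst nn_integral_cmult) auto
    also have "\<dots> = ennreal (K * d)"
      using c V0 d H by (simp add: ennreal_mult'[symmetric] K_def mult_ac)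
    finally show ?thesis .
  qed
  define d :: "nat \<Rightarrow> real" where "d n = (1 / 2) ^ n" for n
  have d_pos: "0 < d n" for n by (simp add: d_def)
  define \<rho> where "\<rho> = (1 / 2 :: real) powr (1 - \<kappa>)"
  have \<rho>: "0 < \<rho>" "\<rho> < 1"
    using \<kappa> powr_less_mono2[of "1 - \<kappa>" "1 / 2" 1] by (auto simp: \<rho>_def)
  have d_powr: "d n powr (- \<kappa>) * d n = \<rho> ^ n" for n
  proof -
    have "d n powr (- \<kappa>) * d n = d n powr (1 - \<kappa>)"
      using d_pos[of n] powr_add[of "d n" "- \<kappa>" 1] by (simp add: algebra_simps)
    also have "\<dots> = \<rho> ^ n"
      by (simp add: d_def \<rho>_def powr_realpow[symmetric] powr_powr mult.commute)
    finally show ?thesis .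
  qed
  define S where "S \<omega> = (\<Sum>n. ennreal (d n powr (- \<kappa>)) * A (d n) \<omega>)" for \<omega>
  have [measurable]: "S \<in> borel_measurable M" unfolding S_def[abs_def] by measurable
  have "(\<integral>\<^sup>+\<omega>. S \<omega> \<partial>M) = (\<Sum>n. \<integral>\<^sup>+\<omega>. ennreal (d n powr (- \<kappa>)) * A (d n) \<omega> \<partial>M)"
    unfolding S_def by (rule nn_integral_suminf) measurable
  also have "\<dots> \<le> (\<Sum>n. ennreal (K * \<rho> ^ n))"
  proof (intro suminf_le allI summableI)
    fix n
    have "(\<integral>\<^sup>+\<omega>. ennreal (d n powr (- \<kappa>)) * A (d n) \<omega> \<partial>M) \<le> ennreal (d n powr (- \<kappa>)) * ennreal (K * d n)"
      by (subst nn_integral_cmult) (auto intro!: mult_left_mono EA d_pos)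
    also have "\<dots> = ennreal (K * (d n powr (- \<kappa>) * d n))"
      using K0 d_pos[of n] by (simp add: ennreal_mult'[symmetric] mult_ac)
    finally show "(\<integral>\<^sup>+\<omega>. ennreal (d n powr (- \<kappa>)) * A (d n) \<omega> \<partial>M) \<le> ennreal (K * \<rho> ^ n)"
      by (simp only: d_powr)
  qed
  also have "\<dots> < \<infinity>"
  proof -
    have "summable (\<lambda>n. K * \<rho> ^ n)" using \<rho> by (intro summable_mult summable_geometric) auto
    then have "(\<Sum>n. ennreal (K * \<rho> ^ n)) \<noteq> \<infinity>" unfolding infinity_ennreal_def by (rule ennreal_suminf_neq_top) (use K0 \<rho> in simp)
    then show ?thesis by (simp add: less_top)
  qed
  finally have "AE \<omega> in M. S \<omega> \<noteq> \<infinity>"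
    by (intro nn_integral_noteq_infinite) auto
  then show ?thesis
  proof eventually_elim
    case (elim \<omega>)
    define s where "s = enn2real (S \<omega>)"
    have s: "S \<omega> = ennreal s" "0 \<le> s" using elim by (auto simp: s_def less_top)
    have A_d: "A (d n) \<omega> \<le> ennreal (s * d n powr \<kappa>)" for n
    proof -
      have "ennreal (d n powr (- \<kappa>)) * A (d n) \<omega> \<le> S \<omega>"
        unfolding S_def using sum_le_suminf[of "\<lambda>n. ennreal (d n powr (- \<kappa>)) * A (d n) \<omega>" "{n}"] by simp
      then have le: "ennreal (d n powr \<kappa>) * (ennreal (d n powr (- \<kappa>)) * A (d n) \<omega>) \<le> ennreal (d n powr \<kappa>) * ennreal s"
        unfolding s by (rule mult_left_mono) simp
      have "d n powr \<kappa> * d n powr (- \<kappa>) = 1"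
        unfolding powr_add[symmetric] using d_pos[of n] by simp
      then have one: "ennreal (d n powr \<kappa>) * ennreal (d n powr (- \<kappa>)) = 1"
        by (simp only: ennreal_mult'[symmetric] powr_ge_zero ennreal_1)
      have "A (d n) \<omega> = ennreal (d n powr \<kappa>) * (ennreal (d n powr (- \<kappa>)) * A (d n) \<omega>)"
        by (simp only: mult.assoc[symmetric] one mult_1_left)
      also note le
      also have "ennreal (d n powr \<kappa>) * ennreal s = ennreal (s * d n powr \<kappa>)"
        by (simp only: ennreal_mult'[OF s(2)] mult.commute)
      finally show ?thesis .
    qed
    have A_mono: "A r \<omega> \<le> A r' \<omega>" if "0 < r" "r \<le> r'" for r r'
      unfolding A_def using that v
      by (intro nn_integral_mono mult_right_mono ennreal_leI diff_mono) (auto simp: mono_def)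
    \<comment> \<open>\<open>2 * s\<close> serves lags up to 1, where passing to a dyadic number
      costs \<open>2 powr \<kappa> \<le> 2\<close>; \<open>2 * V * T\<close> is the trivial bound
      for larger lags.\<close>
    define C where "C = 2 * s + 2 * V * T"
    have "A r \<omega> \<le> ennreal (C * r powr \<kappa>)" if r: "0 < r" for r
    proof (cases "r \<le> 1")
      case False
      have "A r \<omega> \<le> (\<integral>\<^sup>+t\<in>{0..T}. ennreal (2 * V) \<partial>lborel)"
        unfolding A_def
      proof (intro nn_integral_mono mult_right_mono ennreal_leI)
        fix t show "v (Z t \<omega> + r) - v (Z t \<omega> - r) \<le> 2 * V"
          using V[of "Z t \<omega> + r"] V[of "Z t \<omega> - r"] by linarith
      qed simp
      also have "\<dots> = ennreal (2 * V * T)"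
        using T V0 by (simp add: nn_integral_cmult_indicator ennreal_mult'[symmetric])
      also have "\<dots> \<le> ennreal (C * r powr \<kappa>)"
      proof (rule ennreal_leI)
        have "1 \<le> r powr \<kappa>" using False \<kappa> by (intro ge_one_powr_ge_zero) auto
        then have "C * 1 \<le> C * r powr \<kappa>" using s V0 T by (intro mult_left_mono) (auto simp: C_def)
        then show "2 * V * T \<le> C * r powr \<kappa>" using s by (simp add: C_def)
      qed
      finally show ?thesis .
    next
      case True
      have "\<exists>n. (1 / 2) ^ n < r" using r by (intro real_arch_pow_inv) auto
      then obtain m where m: "d m < r" "\<And>k. k < m \<Longrightarrow> \<not> d k < r"
        using exists_least_iff[of "\<lambda>n. d n < r"] by (auto simp: d_def)
      then obtain n where n: "m = Suc n" using True by (cases m) (auto simp: d_def)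
      have r_le: "r \<le> d n" using m(2)[of n] n by simp
      have "d n \<le> 2 * r" using m(1) n by (simp add: d_def)
      have "A r \<omega> \<le> ennreal (s * d n powr \<kappa>)"
        using A_mono[OF r r_le] A_d[of n] by (rule order_trans)
      also have "\<dots> \<le> ennreal (C * r powr \<kappa>)"
      proof (rule ennreal_leI)
        have "d n powr \<kappa> \<le> (2 * r) powr \<kappa>"
          using \<open>d n \<le> 2 * r\<close> d_pos[of n] \<kappa> by (intro powr_mono2) auto
        also have "\<dots> = 2 powr \<kappa> * r powr \<kappa>" using r by (simp add: powr_mult)
        also have "\<dots> \<le> 2 * r powr \<kappa>" using powr_mono[of \<kappa> 1 2] \<kappa> by (intro mult_right_mono) auto
        finally have "s * d n powr \<kappa> \<le> s * (2 * r powr \<kappa>)" using s by (intro mult_left_mono)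
        also have "\<dots> \<le> C * r powr \<kappa>" using V0 T by (simp add: C_def distrib_right)
        finally show "s * d n powr \<kappa> \<le> C * r powr \<kappa>" .
      qed
      finally show ?thesis .
    qed
    moreover have "0 \<le> C" using s V0 T by (simp add: C_def)
    ultimately show ?case unfolding A_def by blast
  qed
qed

text \<open>Time is rounded down to multiples of \<open>1 / Suc n\<close>; the rounded process takes
  countably many times and is jointly measurable, and continuity of the paths gives the limit.
  Tonelli in \<open>(\<omega>, t)\<close> rests on this.\<close>

lemma borel_measurable_continuous_process:
  fixes Z :: "real \<Rightarrow> 'a \<Rightarrow> real"
  assumes [measurable]: "\<And>t. Z t \<in> borel_measurable M"
    and cont: "\<And>\<omega>. continuous_on UNIV (\<lambda>t. Z t \<omega>)"
  shows "(\<lambda>(\<omega>, t). Z t \<omega>) \<in> borel_measurable (M \<Otimes>\<^sub>M borel)"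
proof -
  let ?r = "\<lambda>n t. real_of_int \<lfloor>real (Suc n) * t\<rfloor> / real (Suc n)"
  have meas: "(\<lambda>z. Z (?r n (snd z)) (fst z)) \<in> borel_measurable (M \<Otimes>\<^sub>M borel)" for n
  proof -
    have "(\<lambda>z. (\<lambda>k z. Z (real_of_int k / real (Suc n)) (fst z)) \<lfloor>real (Suc n) * snd z\<rfloor> z) \<in> borel_measurable (M \<Otimes>\<^sub>M borel)"
      by (rule measurable_compose_countable) measurable
    then show ?thesis by simp
  qed
  have r: "(\<lambda>n. ?r n t) \<longlonglongrightarrow> t" for t
  proof (rule LIM_zero_cancel)
    show "(\<lambda>n. ?r n t - t) \<longlonglongrightarrow> 0"
    proof (rule Lim_null_comparison[OF always_eventually])
      show "\<forall>n. norm (?r n t - t) \<le> inverse (real (Suc n))"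
      proof
        fix n
        have "t - ?r n t = (real (Suc n) * t - \<lfloor>real (Suc n) * t\<rfloor>) / real (Suc n)"
          by (simp add: diff_divide_distrib)
        moreover have "0 \<le> real (Suc n) * t - \<lfloor>real (Suc n) * t\<rfloor>" "real (Suc n) * t - \<lfloor>real (Suc n) * t\<rfloor> \<le> 1"
          by linarith+
        ultimately have "norm (t - ?r n t) \<le> inverse (real (Suc n))"
          by (simp add: divide_inverse mult_le_cancel_right1 abs_mult)
        then show "norm (?r n t - t) \<le> inverse (real (Suc n))" by (simp only: norm_minus_commute)
      qed
    qed (rule LIMSEQ_inverse_real_of_nat)
  qed
  have lim: "(\<lambda>n. Z (?r n (snd z)) (fst z)) \<longlonglongrightarrow> (case z of (\<omega>, t) \<Rightarrow> Z t \<omega>)" for z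
  proof -
    have "isCont (\<lambda>t. Z t (fst z)) (snd z)"
      using cont[of "fst z"] by (simp add: continuous_on_eq_continuous_at)
    then show ?thesis
      using isCont_tendsto_compose[OF _ r[of "snd z"]] by (simp add: case_prod_unfold)
  qed
  show ?thesis by (rule borel_measurable_LIMSEQ_real[OF lim meas])
qed

text \<open>Bochner integrals of nonintegrable functions are 0, so a covariance formula alone says
  nothing about moments; they have to come from the Gaussian law, degenerate case included.\<close>

lemma (in prob_space) gaussian_rv_integrable:
  assumes "gaussian_rv M X"
  shows "integrable M X" and "integrable M (\<lambda>\<omega>. (X \<omega>)\<^sup>2)"
proof -
  have [measurable]: "X \<in> borel_measurable M" using assms by (simp add: gaussian_rv_def)
  from assms consider \<mu> where "AE \<omega> in M. X \<omega> = \<mu>"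
    | \<mu> \<sigma> where "0 < \<sigma>" "distributed M lborel X (normal_density \<mu> \<sigma>)"
    by (auto simp: gaussian_rv_def)
  then have "integrable M X \<and> integrable M (\<lambda>\<omega>. (X \<omega>)\<^sup>2)"
  proof cases
    case 1
    have "integrable M X \<longleftrightarrow> integrable M (\<lambda>\<omega>. \<mu>)" "integrable M (\<lambda>\<omega>. (X \<omega>)\<^sup>2) \<longleftrightarrow> integrable M (\<lambda>\<omega>. \<mu>\<^sup>2)"
      using 1 by (intro integrable_cong_AE; auto)+
    then show ?thesis by simp
  next
    case 2
    have 1: "integrable M X"
      using distributed_integrable[OF 2(2), of "\<lambda>x. x"] integrable_normal_moment_nz_1[OF 2(1), of \<mu>] by simp
    have "integrable M (\<lambda>\<omega>. (X \<omega> - \<mu>)\<^sup>2)"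
      using distributed_integrable[OF 2(2), of "\<lambda>x. (x - \<mu>)\<^sup>2"] integrable_normal_moment[OF 2(1), of \<mu> 2] by simp
    then have "integrable M (\<lambda>\<omega>. (X \<omega> - \<mu>)\<^sup>2 + (2 * \<mu> * X \<omega> - \<mu>\<^sup>2))"
      using 1 by (intro Bochner_Integration.integrable_add Bochner_Integration.integrable_diff integrable_mult_right) auto
    then show ?thesis using 1 by (simp add: power2_diff algebra_simps)
  qed
  then show "integrable M X" "integrable M (\<lambda>\<omega>. (X \<omega>)\<^sup>2)" by auto
qed

lemma integrable_mult_of_squares:
  fixes X Y :: "'a \<Rightarrow> real"
  assumes [measurable]: "X \<in> borel_measurable M" "Y \<in> borel_measurable M"
    and "integrable M (\<lambda>\<omega>. (X \<omega>)\<^sup>2)" "integrable M (\<lambda>\<omega>. (Y \<omega>)\<^sup>2)"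
  shows "integrable M (\<lambda>\<omega>. X \<omega> * Y \<omega>)"
proof (rule Bochner_Integration.integrable_bound)
  show "integrable M (\<lambda>\<omega>. (X \<omega>)\<^sup>2 + (Y \<omega>)\<^sup>2)" using assms by simp
  show "AE \<omega> in M. norm (X \<omega> * Y \<omega>) \<le> norm ((X \<omega>)\<^sup>2 + (Y \<omega>)\<^sup>2)"
  proof (intro AE_I2)
    fix \<omega>
    have "0 \<le> (\<bar>X \<omega>\<bar> - \<bar>Y \<omega>\<bar>)\<^sup>2" by simp
    then have "2 * (\<bar>X \<omega>\<bar> * \<bar>Y \<omega>\<bar>) \<le> (X \<omega>)\<^sup>2 + (Y \<omega>)\<^sup>2" by (simp add: power2_diff)
    moreover have "0 \<le> \<bar>X \<omega>\<bar> * \<bar>Y \<omega>\<bar>" by simp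
    ultimately have "\<bar>X \<omega>\<bar> * \<bar>Y \<omega>\<bar> \<le> (X \<omega>)\<^sup>2 + (Y \<omega>)\<^sup>2" by linarith
    then show "norm (X \<omega> * Y \<omega>) \<le> norm ((X \<omega>)\<^sup>2 + (Y \<omega>)\<^sup>2)" by (simp add: abs_mult)
  qed
qed measurable

section \<open>Laws of nonnegative linear combinations of fractional Brownian motion\<close>

locale fbm = prob_space M for M :: "'a measure" +
  fixes H :: real and B :: "real \<Rightarrow> 'a \<Rightarrow> real"
  assumes H: "0 < H" and fbm: "fractional_brownian_motion M H B"
begin

lemma gaussian_combination: "finite J \<Longrightarrow> J \<subseteq> {0..} \<Longrightarrow> gaussian_rv M (\<lambda>\<omega>. \<Sum>t\<in>J. c t * B t \<omega>)"
  using fbm by (auto simp: fractional_brownian_motion_def gaussian_process_def)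

lemma gaussian_B: "0 \<le> t \<Longrightarrow> gaussian_rv M (B t)"
  using gaussian_combination[of "{t}" "\<lambda>_. 1"] by simp

lemma measurable_B: "0 \<le> t \<Longrightarrow> B t \<in> borel_measurable M"
  using gaussian_B by (simp add: gaussian_rv_def)

definition centered :: "real \<Rightarrow> 'a \<Rightarrow> real" where
  "centered t \<omega> = B t \<omega> - expectation (B t)"

lemma integrable_centered_mult:
  assumes "0 \<le> s" "0 \<le> t"
  shows "integrable M (\<lambda>\<omega>. centered s \<omega> * centered t \<omega>)"
proof (rule integrable_mult_of_squares)
  have "integrable M (\<lambda>\<omega>. (centered t \<omega>)\<^sup>2)" if "0 \<le> t" for t
  proof -
    note i = gaussian_rv_integrable[OF gaussian_B[OF that]]
    have "integrable M (\<lambda>\<omega>. (B t \<omega>)\<^sup>2 - 2 * expectation (B t) * B t \<omega> + (expectation (B t))\<^sup>2)"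
      by (intro Bochner_Integration.integrable_add Bochner_Integration.integrable_diff integrable_mult_right i) auto
    then show ?thesis by (simp add: centered_def power2_diff algebra_simps)
  qed
  then show "integrable M (\<lambda>\<omega>. (centered s \<omega>)\<^sup>2)" "integrable M (\<lambda>\<omega>. (centered t \<omega>)\<^sup>2)"
    using assms by auto
qed (use assms measurable_B in \<open>auto simp: centered_def\<close>)

text \<open>Since \<open>\<bar>s - t\<bar>\<close> is at most the larger time, half the power of the
  smaller time survives in the covariance. The case \<open>\<tau> = 0\<close> gives
  nonnegativity.\<close>

lemma covariance_lower_bound:
  assumes "0 \<le> \<tau>" "\<tau> \<le> s" "\<tau> \<le> t"
  shows "\<tau> powr (2 * H) / 2 \<le> expectation (\<lambda>\<omega>. centered s \<omega> * centered t \<omega>)"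
proof -
  have cov: "expectation (\<lambda>\<omega>. centered s \<omega> * centered t \<omega>) = (s powr (2 * H) + t powr (2 * H) - \<bar>s - t\<bar> powr (2 * H)) / 2"
    using fbm assms by (simp add: fractional_brownian_motion_def covariance_def centered_def)
  have "\<bar>s - t\<bar> powr (2 * H) \<le> (max s t) powr (2 * H)"
    using assms H by (intro powr_mono2) auto
  moreover have "\<tau> powr (2 * H) \<le> (min s t) powr (2 * H)"
    using assms H by (intro powr_mono2) auto
  ultimately have "\<tau> powr (2 * H) \<le> s powr (2 * H) + t powr (2 * H) - \<bar>s - t\<bar> powr (2 * H)"
    by (auto simp: max_def min_def split: if_splits)
  then show ?thesis unfolding cov by simp
qed

lemma variance_lower_bound:
  assumes J: "finite J" "J \<subseteq> {0..}" and c: "\<And>t. t \<in> J \<Longrightarrow> 0 \<le> c t" and \<tau>: "0 \<le> \<tau>"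
  shows "\<tau> powr (2 * H) / 2 * (\<Sum>t\<in>{t\<in>J. \<tau> \<le> t}. c t)\<^sup>2 \<le> variance (\<lambda>\<omega>. \<Sum>t\<in>J. c t * B t \<omega>)"
proof -
  let ?J = "{t\<in>J. \<tau> \<le> t}"
  let ?R = "\<lambda>s t. expectation (\<lambda>\<omega>. centered s \<omega> * centered t \<omega>)"
  have "expectation (\<lambda>\<omega>. \<Sum>t\<in>J. c t * B t \<omega>) = (\<Sum>t\<in>J. c t * expectation (B t))"
    using J by (subst Bochner_Integration.integral_sum) (auto intro!: gaussian_rv_integrable gaussian_B)
  then have Z: "(\<Sum>t\<in>J. c t * B t \<omega>) - expectation (\<lambda>\<omega>. \<Sum>t\<in>J. c t * B t \<omega>) = (\<Sum>t\<in>J. c t * centered t \<omega>)" for \<omega>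
    by (simp add: centered_def sum_subtractf right_diff_distrib)
  have "variance (\<lambda>\<omega>. \<Sum>t\<in>J. c t * B t \<omega>) = expectation (\<lambda>\<omega>. \<Sum>s\<in>J. \<Sum>t\<in>J. c s * c t * (centered s \<omega> * centered t \<omega>))"
    unfolding Z power2_eq_square sum_product by (simp add: mult_ac)
  also have "\<dots> = (\<Sum>s\<in>J. \<Sum>t\<in>J. c s * c t * ?R s t)"
  proof -
    have "expectation (\<lambda>\<omega>. \<Sum>s\<in>J. \<Sum>t\<in>J. c s * c t * (centered s \<omega> * centered t \<omega>)) =
       (\<Sum>s\<in>J. expectation (\<lambda>\<omega>. \<Sum>t\<in>J. c s * c t * (centered s \<omega> * centered t \<omega>)))"
      using J by (intro Bochner_Integration.integral_sum Bochner_Integration.integrable_sum integrable_mult_right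
          integrable_centered_mult) auto
    also have "\<dots> = (\<Sum>s\<in>J. \<Sum>t\<in>J. c s * c t * ?R s t)"
    proof (rule sum.cong[OF refl])
      fix s assume "s \<in> J"
      then show "expectation (\<lambda>\<omega>. \<Sum>t\<in>J. c s * c t * (centered s \<omega> * centered t \<omega>)) = (\<Sum>t\<in>J. c s * c t * ?R s t)"
        using J by (subst Bochner_Integration.integral_sum) (auto intro!: integrable_mult_right integrable_centered_mult)
    qed
    finally show ?thesis .
  qed
  also have "\<dots> \<ge> (\<Sum>s\<in>?J. \<Sum>t\<in>?J. c s * c t * (\<tau> powr (2 * H) / 2))"
  proof -
    have R0: "0 \<le> ?R s t" if "s \<in> J" "t \<in> J" for s t
      using covariance_lower_bound[of 0 s t] that J H by auto
    have "(\<Sum>s\<in>?J. \<Sum>t\<in>?J. c s * c t * (\<tau> powr (2 * H) / 2)) \<le> (\<Sum>s\<in>?J. \<Sum>t\<in>?J. c s * c t * ?R s t)"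
      using c \<tau> by (intro sum_mono mult_left_mono covariance_lower_bound) auto
    also have "\<dots> \<le> (\<Sum>s\<in>?J. \<Sum>t\<in>J. c s * c t * ?R s t)"
      using J c R0 by (intro sum_mono sum_mono2) auto
    also have "\<dots> \<le> (\<Sum>s\<in>J. \<Sum>t\<in>J. c s * c t * ?R s t)"
      using J c R0 by (intro sum_mono2 sum_nonneg) auto
    finally show ?thesis .
  qed
  also have "(\<Sum>s\<in>?J. \<Sum>t\<in>?J. c s * c t * (\<tau> powr (2 * H) / 2)) = \<tau> powr (2 * H) / 2 * (\<Sum>t\<in>?J. c t)\<^sup>2"
    by (simp add: power2_eq_square sum_product sum_distrib_left mult_ac)
  finally show ?thesis .
qed

text \<open>The constant 3 comes from \<open>1 / 9 < 1 / 8\<close>: the variance strictly exceeds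
  the square of \<open>\<tau> powr H / 3\<close>. In particular it is positive, which excludes the
  degenerate Gaussian law.\<close>

lemma small_law_combination:
  assumes J: "finite J" "J \<subseteq> {0..}" and c: "\<And>t. t \<in> J \<Longrightarrow> 0 \<le> c t" and \<tau>: "0 < \<tau>"
    and half: "1 / 2 \<le> (\<Sum>t\<in>{t\<in>J. \<tau> \<le> t}. c t)"
  shows "small_law M (\<lambda>\<omega>. \<Sum>t\<in>J. c t * B t \<omega>) (3 * \<tau> powr (- H))"
proof -
  let ?Z = "\<lambda>\<omega>. \<Sum>t\<in>J. c t * B t \<omega>"
  have "(\<tau> powr H)\<^sup>2 = \<tau> powr (2 * H)"
    unfolding power2_eq_square powr_add[symmetric] by simp
  then have "(\<tau> powr H / 3)\<^sup>2 = \<tau> powr (2 * H) / 9" by (simp add: power_divide)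
  also have "\<dots> < \<tau> powr (2 * H) / 2 * (1 / 2)\<^sup>2"
    using \<tau> by (simp add: power_divide)
  also have "\<dots> \<le> \<tau> powr (2 * H) / 2 * (\<Sum>t\<in>{t\<in>J. \<tau> \<le> t}. c t)\<^sup>2"
    using half by (intro mult_left_mono power_mono) auto
  also have "\<dots> \<le> variance ?Z" using J c \<tau> by (intro variance_lower_bound) auto
  finally have var: "(\<tau> powr H / 3)\<^sup>2 < variance ?Z" .
  have g: "gaussian_rv M ?Z" using J by (rule gaussian_combination)
  then have [measurable]: "?Z \<in> borel_measurable M" by (simp add: gaussian_rv_def)
  from g consider \<mu> where "AE \<omega> in M. ?Z \<omega> = \<mu>"
    | \<mu> \<sigma> where "0 < \<sigma>" "distributed M lborel ?Z (normal_density \<mu> \<sigma>)"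
    by (auto simp: gaussian_rv_def)
  then show ?thesis
  proof cases
    case 1
    have E: "expectation ?Z = \<mu>"
    proof -
      have "expectation ?Z = expectation (\<lambda>\<omega>. \<mu>)" by (rule integral_cong_AE) (use 1 in auto)
      then show ?thesis by (simp add: prob_space)
    qed
    have "variance ?Z = expectation (\<lambda>\<omega>. 0)"
      unfolding E by (rule integral_cong_AE) (use 1 in auto)
    then show ?thesis using var by (simp add: not_less[symmetric])
  next
    case 2
    have "(\<tau> powr H / 3)\<^sup>2 < \<sigma>\<^sup>2" using var unfolding normal_distributed_variance[OF 2] .
    then have "\<tau> powr H / 3 \<le> \<sigma>"
      by (rule power2_le_imp_le[OF less_imp_le less_imp_le[OF 2(1)]])
    then have "small_law M ?Z (1 / (\<tau> powr H / 3))" using \<tau> by (intro small_law_normal[OF 2(2)]) auto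
    then show ?thesis by (simp add: powr_minus_divide)
  qed
qed

end

section \<open>Riemann sums for the averaged logarithm\<close>

definition riemann_log_average :: "(real \<Rightarrow> real) \<Rightarrow> real \<Rightarrow> real \<Rightarrow> nat \<Rightarrow> real" where
  "riemann_log_average x T s n =
     (\<Sum>i=1..n. s / real n * x (real i * (s / real n))) / T + (T - s) / T * x s"

text \<open>Right endpoints make \<open>s\<close> itself a grid point, where the weight
  \<open>(T - s) / T\<close> is added. The grid times from \<open>s / 2\<close> on carry at least
  half of the total weight \<open>s / T\<close>, so the late weight is at least
  \<open>1 - s / (2 * T) \<ge> 1 / 2\<close>, uniformly in \<open>s\<close>.\<close>

lemma riemann_log_average_combination:
  assumes s: "0 < s" "s \<le> T" and n: "0 < n"
  obtains J c where "finite J" "J \<subseteq> {0..s}" "\<And>t. t \<in> J \<Longrightarrow> 0 \<le> c t"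
    "1 / 2 \<le> (\<Sum>t\<in>{t\<in>J. s / 2 \<le> t}. c t)"
    "\<And>x. riemann_log_average x T s n = (\<Sum>t\<in>J. c t * x t)"
proof -
  define h where "h = s / real n"
  have h: "0 < h" "real n * h = s" using s n by (auto simp: h_def)
  define J where "J = (\<lambda>i. real i * h) ` {1..n}"
  define c where "c t = h / T + (if t = s then (T - s) / T else 0)" for t
  have inj: "inj_on (\<lambda>i. real i * h) A" for A using h by (auto simp: inj_on_def)
  have sJ: "s \<in> J" unfolding J_def using n h by (auto intro!: image_eqI[of _ _ n])
  show thesis
  proof
    show fin: "finite J" by (simp add: J_def)
    show "J \<subseteq> {0..s}"
      using h by (auto simp: J_def)
    show "0 \<le> c t" for t using s h by (auto simp: c_def)
    show "riemann_log_average x T s n = (\<Sum>t\<in>J. c t * x t)" for x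
    proof -
      have "(\<Sum>t\<in>J. c t * x t) = (\<Sum>t\<in>J. h / T * x t) + (\<Sum>t\<in>J. if t = s then (T - s) / T * x t else 0)"
        by (simp add: c_def distrib_right sum.distrib if_distrib[of "\<lambda>u. u * _"] cong: if_cong)
      also have "(\<Sum>t\<in>J. if t = s then (T - s) / T * x t else 0) = (T - s) / T * x s"
        using fin sJ by (simp add: sum.delta)
      also have "(\<Sum>t\<in>J. h / T * x t) = (\<Sum>i=1..n. h * x (real i * h)) / T"
        unfolding J_def sum.reindex[OF inj] by (simp add: sum_divide_distrib)
      finally show ?thesis by (simp add: riemann_log_average_def h_def)
    qed
    \<comment> \<open>Rounding up ensures \<open>n \<le> 2 * i\<close> for all members and still
      leaves at least \<open>n / 2\<close> of them.\<close>
    define I where "I = {(n + 1) div 2..n}"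
    have "(\<lambda>i. real i * h) ` I \<subseteq> {t\<in>J. s / 2 \<le> t}"
    proof
      fix t assume "t \<in> (\<lambda>i. real i * h) ` I"
      then obtain i where "i \<in> I" and t: "t = real i * h" by blast
      then have i: "t = real i * h" "(n + 1) div 2 \<le> i" "i \<le> n" by (simp_all add: I_def)
      then have "n \<le> 2 * i" by linarith
      then have "real n * h \<le> real (2 * i) * h" using h by (intro mult_right_mono) auto
      then show "t \<in> {t\<in>J. s / 2 \<le> t}" using i n h \<open>n \<le> 2 * i\<close> by (auto simp: J_def)
    qed
    then have "card I \<le> card {t\<in>J. s / 2 \<le> t}"
      using card_mono[of "{t\<in>J. s / 2 \<le> t}" "(\<lambda>i. real i * h) ` I"] fin card_image[OF inj, of I] by simp
    moreover have "real n \<le> 2 * real (card I)" unfolding I_def using n by simp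
    ultimately have "real n / 2 * (h / T) \<le> real (card {t\<in>J. s / 2 \<le> t}) * (h / T)"
      using h s by (intro mult_right_mono) auto
    moreover have "(\<Sum>t\<in>{t\<in>J. s / 2 \<le> t}. c t) = real (card {t\<in>J. s / 2 \<le> t}) * (h / T) + (T - s) / T"
      using fin sJ s by (simp add: c_def sum.distrib sum.delta)
    moreover have "1 / 2 \<le> real n / 2 * (h / T) + (T - s) / T"
      using s h by (simp add: field_simps)
    ultimately show "1 / 2 \<le> (\<Sum>t\<in>{t\<in>J. s / 2 \<le> t}. c t)" by linarith
  qed
qed

text \<open>Each cell contributes an error of at most \<open>L * h n powr (1 + \<gamma>)\<close> by
  \<open>antiderivative_increment\<close>, and \<open>Suc n\<close> cells of length
  \<open>h n\<close> add up to length \<open>s\<close>.\<close>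

lemma (in holder_function) riemann_log_average_tendsto:
  assumes F: "\<And>x. (F has_real_derivative g x) (at x)" and s: "0 \<le> s"
  shows "(\<lambda>n. riemann_log_average g T s (Suc n)) \<longlonglongrightarrow> log_average F g T s"
proof -
  define h where "h n = s / real (Suc n)" for n
  have h: "0 \<le> h n" "real (Suc n) * h n = s" for n using s by (auto simp: h_def)
  have h0: "h \<longlonglongrightarrow> 0"
  proof -
    have "(\<lambda>n. s * inverse (real (Suc n))) \<longlonglongrightarrow> s * 0"
      by (intro tendsto_mult tendsto_const LIMSEQ_inverse_real_of_nat)
    then show ?thesis by (simp add: h_def[abs_def] divide_inverse)
  qed
  have bound: "\<bar>(\<Sum>i=1..Suc n. h n * g (real i * h n)) - (F s - F 0)\<bar> \<le> s * L * h n powr \<gamma>" for n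
  proof -
    have "F s - F 0 = (\<Sum>i=1..Suc n. F (real i * h n) - F (real (i - 1) * h n))"
      using sum_telescope''[of 0 "Suc n" "\<lambda>i. F (real i * h n)"] h(2)[of n]
      by (simp add: sum.atLeast_Suc_atMost del: of_nat_Suc) 
    then have "\<bar>(\<Sum>i=1..Suc n. h n * g (real i * h n)) - (F s - F 0)\<bar> =
        \<bar>\<Sum>i=1..Suc n. h n * g (real i * h n) - (F (real i * h n) - F (real (i - 1) * h n))\<bar>"
      by (simp only: sum_subtractf)
    also have "\<dots> \<le> (\<Sum>i=1..Suc n. \<bar>h n * g (real i * h n) - (F (real i * h n) - F (real (i - 1) * h n))\<bar>)"
      by (rule sum_abs)
    also have "\<dots> \<le> (\<Sum>i=1..Suc n. L * h n powr (1 + \<gamma>))"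
    proof (rule sum_mono)
      fix i assume i: "i \<in> {1..Suc n}"
      have d: "real i * h n - real (i - 1) * h n = h n"
        using i by (simp add: of_nat_diff algebra_simps)
      show "\<bar>h n * g (real i * h n) - (F (real i * h n) - F (real (i - 1) * h n))\<bar> \<le> L * h n powr (1 + \<gamma>)"
        using antiderivative_increment[OF F, of "real i * h n" "real (i - 1) * h n"] h(1)[of n]
        unfolding d by (simp add: abs_minus_commute mult.commute)
    qed
    also have "\<dots> = real (Suc n) * (L * (h n * h n powr \<gamma>))"
      using h(1)[of n] by (simp add: powr_add)
    also have "\<dots> = s * L * h n powr \<gamma>"
      using h(2)[of n] by (simp only: mult_ac) (simp only: mult.assoc[symmetric])
    finally show ?thesis .
  qed
  have "(\<lambda>n. s * L * h n powr \<gamma>) \<longlonglongrightarrow> 0"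
    by (intro tendsto_mult_right_zero tendsto_zero_powrI[OF h0 tendsto_const always_eventually \<gamma>_pos]) (use h(1) in simp)
  then have "(\<lambda>n. (\<Sum>i=1..Suc n. h n * g (real i * h n)) - (F s - F 0)) \<longlonglongrightarrow> 0"
    by (rule Lim_null_comparison[OF always_eventually, rotated]) (use bound in simp)
  then have "(\<lambda>n. \<Sum>i=1..Suc n. h n * g (real i * h n)) \<longlonglongrightarrow> F s - F 0"
    by (rule LIM_zero_cancel)
  then have "(\<lambda>n. (\<Sum>i=1..Suc n. h n * g (real i * h n)) * inverse T + (T - s) / T * g s) \<longlonglongrightarrow> (F s - F 0) * inverse T + (T - s) / T * g s"
    by (intro tendsto_add tendsto_mult tendsto_const)
  then show ?thesis by (simp only: riemann_log_average_def log_average_def h_def divide_inverse)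
qed

text \<open>Two versions of the process are kept apart: \<open>b\<close> has Hoelder paths for every
  \<open>\<omega>\<close>, as joint measurability requires, while the laws are known for
  \<open>B\<close>. Almost sure equality on \<open>{0..T}\<close> suffices to pass the density bound
  from one to the other.\<close>

lemma (in fbm) AE_occupation_log_average:
  fixes b F :: "real \<Rightarrow> 'a \<Rightarrow> real" and v :: "real \<Rightarrow> real"
  assumes T: "0 < T" and H1: "H < 1"
    and [measurable]: "\<And>t. b t \<in> borel_measurable M"
    and hol: "\<And>\<omega>. \<exists>L. holder_function (\<lambda>t. b t \<omega>) L \<gamma>"
    and F: "\<And>\<omega> x. ((\<lambda>t. F t \<omega>) has_real_derivative b x \<omega>) (at x)"
    and eq: "AE \<omega> in M. \<forall>t\<in>{0..T}. b t \<omega> = B t \<omega>"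
    and v: "mono v" "\<And>x. \<bar>v x\<bar> \<le> V" and \<kappa>: "0 < \<kappa>" "\<kappa> < 1"
  shows "AE \<omega> in M. \<exists>C\<ge>0. \<forall>\<delta>>0.
    (\<integral>\<^sup>+t\<in>{0..T}. ennreal (v (log_average (\<lambda>t. F t \<omega>) (\<lambda>t. b t \<omega>) T t + \<delta>)
       - v (log_average (\<lambda>t. F t \<omega>) (\<lambda>t. b t \<omega>) T t - \<delta>)) \<partial>lborel) \<le> ennreal (C * \<delta> powr \<kappa>)"
proof -
  define Y where "Y t \<omega> = log_average (\<lambda>t. F t \<omega>) (\<lambda>t. b t \<omega>) T t" for t \<omega>
  \<comment> \<open>Joint measurability is available for processes on the whole line with continuous
    paths, hence the clamped time.\<close>
  define Z where "Z t = Y (max 0 (min T t))" for t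
  have lim: "(\<lambda>n. riemann_log_average (\<lambda>t. b t \<omega>) T t (Suc n)) \<longlonglongrightarrow> Y t \<omega>" if "0 \<le> t" for t \<omega>
    using hol[of \<omega>] that unfolding Y_def by (auto intro: holder_function.riemann_log_average_tendsto F)
  have Ym: "Y t \<in> borel_measurable M" if "0 \<le> t" for t
    by (rule borel_measurable_LIMSEQ_real[OF lim[OF that]]) (simp add: riemann_log_average_def)
  have Zm: "Z t \<in> borel_measurable M" for t
    unfolding Z_def by (intro Ym) simp
  have Zc: "continuous_on UNIV (\<lambda>t. Z t \<omega>)" for \<omega>
  proof -
    have "continuous_on UNIV (\<lambda>t. F t \<omega>)"
      using F by (auto intro!: continuous_at_imp_continuous_on DERIV_isCont)
    moreover have "continuous_on UNIV (\<lambda>t. b t \<omega>)"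
      using hol[of \<omega>] by (auto intro: holder_function.continuous)
    ultimately have "continuous_on UNIV (\<lambda>t. Y t \<omega>)"
      unfolding Y_def log_average_def using T by (intro continuous_intros) auto
    then show ?thesis unfolding Z_def
      by (rule continuous_on_compose2) (auto intro!: continuous_intros)
  qed
  have small: "small_law M (Z s) (3 * 2 powr H * s powr (- H))" if s: "0 < s" "s \<le> T" for s
  proof -
    have ZY: "Z s = Y s" using s by (simp add: Z_def)
    show ?thesis unfolding ZY
    proof (rule small_law_limit)
      show "Y s \<in> borel_measurable M" using s by (intro Ym) auto
      \<comment> \<open>The sums are formed with \<open>B\<close>, so that they are Gaussian by
        hypothesis, but they converge along the paths of \<open>b\<close>.\<close>
      let ?Zn = "\<lambda>n \<omega>. riemann_log_average (\<lambda>t. B t \<omega>) T s (Suc n)"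
      have *: "?Zn n \<in> borel_measurable M \<and> small_law M (?Zn n) (3 * 2 powr H * s powr (- H)) \<and>
          (\<forall>\<omega>. (\<forall>t\<in>{0..T}. b t \<omega> = B t \<omega>) \<longrightarrow> ?Zn n \<omega> = riemann_log_average (\<lambda>t. b t \<omega>) T s (Suc n))" for n
      proof -
        obtain J c where J: "finite J" "J \<subseteq> {0..s}" "\<And>t. t \<in> J \<Longrightarrow> 0 \<le> c t"
          "1 / 2 \<le> (\<Sum>t\<in>{t\<in>J. s / 2 \<le> t}. c t)"
          "\<And>x. riemann_log_average x T s (Suc n) = (\<Sum>t\<in>J. c t * x t)"
          using riemann_log_average_combination[OF s, of "Suc n"] by blast
        have J0: "J \<subseteq> {0..}" using J(2) by auto
        have "gaussian_rv M (?Zn n)" unfolding J(5) using J(1) J0 by (rule gaussian_combination)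
        moreover have "small_law M (?Zn n) (3 * (s / 2) powr (- H))"
          unfolding J(5) using J s by (intro small_law_combination J0) auto
        moreover have "3 * (s / 2) powr (- H) = 3 * 2 powr H * s powr (- H)"
          using s by (simp add: powr_divide powr_minus_divide)
        moreover have "?Zn n \<omega> = riemann_log_average (\<lambda>t. b t \<omega>) T s (Suc n)" if "\<forall>t\<in>{0..T}. b t \<omega> = B t \<omega>" for \<omega>
          unfolding J(5) using that J(2) s by (intro sum.cong) auto
        ultimately show ?thesis by (auto simp: gaussian_rv_def)
      qed
      show "?Zn n \<in> borel_measurable M" "small_law M (?Zn n) (3 * 2 powr H * s powr (- H))" for n
        using * by auto
      show "AE \<omega> in M. (\<lambda>n. ?Zn n \<omega>) \<longlonglongrightarrow> Y s \<omega>"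
        using eq by eventually_elim (use * lim[of s] s in auto)
    qed
  qed
  have joint: "(\<lambda>(\<omega>, t). Z t \<omega>) \<in> borel_measurable (M \<Otimes>\<^sub>M borel)"
    using Zm Zc by (rule borel_measurable_continuous_process)
  have "AE \<omega> in M. \<exists>C\<ge>0. \<forall>\<delta>>0. (\<integral>\<^sup>+t\<in>{0..T}. ennreal (v (Z t \<omega> + \<delta>) - v (Z t \<omega> - \<delta>)) \<partial>lborel) \<le> ennreal (C * \<delta> powr \<kappa>)"
    by (rule AE_occupation_bound[OF prob_space_axioms joint T H1 _ small v \<kappa>]) auto
  moreover have "(\<integral>\<^sup>+t\<in>{0..T}. ennreal (v (Z t \<omega> + \<delta>) - v (Z t \<omega> - \<delta>)) \<partial>lborel) =
      (\<integral>\<^sup>+t\<in>{0..T}. ennreal (v (Y t \<omega> + \<delta>) - v (Y t \<omega> - \<delta>)) \<partial>lborel)" for \<omega> \<delta>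
    by (intro nn_integral_cong) (auto simp: Z_def indicator_def)
  ultimately show ?thesis by (simp add: Y_def)
qed

section \<open>Representation of the functional\<close>

text \<open>The first summand of the norm is the Hoelder quotient, so the norm itself serves as the
  Hoelder constant.\<close>

lemma besov1_holder:
  assumes "f \<in> besov1 \<gamma> T"
  obtains L where "0 \<le> L" "\<And>s t. s \<in> {0..T} \<Longrightarrow> t \<in> {0..T} \<Longrightarrow> \<bar>f t - f s\<bar> \<le> L * \<bar>t - s\<bar> powr \<gamma>"
proof
  define L where "L = enn2real (besov1_norm \<gamma> T f)"
  have fin: "besov1_norm \<gamma> T f = ennreal L"
    using assms by (simp add: besov1_def L_def less_top)
  show "0 \<le> L" by (simp add: L_def)
  have lt: "\<bar>f t - f s\<bar> \<le> L * (t - s) powr \<gamma>" if st: "0 \<le> s" "s < t" "t \<le> T" for s t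
  proof -
    have "ennreal (\<bar>f t - f s\<bar> / (t - s) powr \<gamma>) \<le>
       ennreal (\<bar>f t - f s\<bar> / (t - s) powr \<gamma>) + (\<integral>\<^sup>+u\<in>{s..t}. ennreal (\<bar>f u - f s\<bar> / (u - s) powr (\<gamma> + 1)) \<partial>lebesgue)"
      by simp
    also have "\<dots> \<le> ennreal L"
      unfolding fin[symmetric] besov1_norm_def by (rule SUP_upper2[of "(s, t)"]) (use st in auto)
    finally have "\<bar>f t - f s\<bar> / (t - s) powr \<gamma> \<le> L" using \<open>0 \<le> L\<close> by simp
    then show ?thesis using st by (simp add: divide_le_eq)
  qed
  show "\<bar>f t - f s\<bar> \<le> L * \<bar>t - s\<bar> powr \<gamma>" if "s \<in> {0..T}" "t \<in> {0..T}" for s t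
    using lt[of s t] lt[of t s] that by (cases s t rule: linorder_cases) (auto simp: abs_minus_commute)
qed

lemma holder_function_clamped:
  fixes f :: "real \<Rightarrow> real"
  assumes hol: "\<And>s t. s \<in> {0..T} \<Longrightarrow> t \<in> {0..T} \<Longrightarrow> \<bar>f t - f s\<bar> \<le> L * \<bar>t - s\<bar> powr \<gamma>"
    and "0 \<le> L" "0 < \<gamma>" "0 < T"
  shows "holder_function (\<lambda>s. f (max 0 (min T s))) L \<gamma>"
proof
  fix s t :: real
  let ?c = "\<lambda>s. max 0 (min T s)"
  have "\<bar>f (?c t) - f (?c s)\<bar> \<le> L * \<bar>?c t - ?c s\<bar> powr \<gamma>"
    using assms by (intro hol) auto
  also have "\<dots> \<le> L * \<bar>t - s\<bar> powr \<gamma>"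
    using assms by (intro mult_left_mono powr_mono2) auto
  finally show "\<bar>f (?c t) - f (?c s)\<bar> \<le> L * \<bar>t - s\<bar> powr \<gamma>" .
qed fact

theorem corollary2p9:
  fixes M :: "'a measure" and F :: "real \<Rightarrow> 'a measure"
    and B S G :: "real \<Rightarrow> 'a \<Rightarrow> real"
    and f :: "real \<Rightarrow> real" and H T :: real
  assumes "complete_filtered_prob_space M F"
    and "0 < T"
    and "1 / 2 < H" and "H < 1"
    and "fractional_brownian_motion M H B"
    and "\<And>\<beta>. 0 < \<beta> \<Longrightarrow> \<beta> < H \<Longrightarrow> AE \<omega> in M. (\<lambda>t. B t \<omega>) \<in> besov1 \<beta> T"
    and "\<And>t \<omega>. S t \<omega> = exp (B t \<omega>)"
    and "\<And>s \<omega>. G s \<omega> =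
           exp (1 / T * (LINT u:{0..s}|lebesgue. ln (S u \<omega>))) * S s \<omega> powr ((T - s) / T)"
    and "convex_on UNIV f"
  shows "AE \<omega> in M. \<exists>I.
           has_gls_integral (\<lambda>s. (T - s) / T * left_deriv f (G s \<omega>) * G s \<omega>)
             (\<lambda>s. B s \<omega>) T T I \<and>
           f (exp (1 / T * (LINT s:{0..T}|lebesgue. B s \<omega>))) = f (S 0 \<omega>) + I"
proof -
  interpret complete_filtered_prob_space M F by fact
  interpret fbm M H B
    using assms(3,5) by unfold_locales auto
  note T = assms(2) and S = assms(7) and G = assms(8)
  \<comment> \<open>\<open>\<gamma>\<close> is the midpoint of 1/2 and \<open>H\<close>, and
    \<open>\<kappa>\<close> is determined by \<open>\<gamma> * \<kappa> = 1 / 2\<close>; from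
    \<open>1 / 2 < \<gamma>\<close> follows \<open>\<kappa> < 1\<close>, as the occupation bound
    demands.\<close>
  define \<gamma> where "\<gamma> = (1 / 2 + H) / 2"
  define \<kappa> where "\<kappa> = 1 / (2 * \<gamma>)"
  \<comment> \<open>The midpoint of \<open>1 - \<gamma>\<close> and
    \<open>\<gamma> * \<kappa> = 1 / 2\<close>, the ends of the interval of admissible
    orders.\<close>
  define a where "a = 3 / 4 - \<gamma> / 2"
  have \<gamma>: "1 / 2 < \<gamma>" "\<gamma> < H" "\<gamma> < 1" using assms(3,4) by (auto simp: \<gamma>_def)
  have \<kappa>: "0 < \<kappa>" "\<kappa> < 1" "\<gamma> * \<kappa> = 1 / 2" using \<gamma> by (auto simp: \<kappa>_def)
  have a: "0 < a" "a < 1" "1 < \<gamma> + a" "a < \<gamma> * \<kappa>" using \<gamma> unfolding \<kappa>(3) by (auto simp: a_def)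
  have a': "0 < 1 - a" "1 - a < H" using a \<gamma> by (auto simp: a_def)
  obtain N where N: "N \<in> null_sets M" "{\<omega> \<in> space M. (\<lambda>t. B t \<omega>) \<notin> besov1 \<gamma> T} \<subseteq> N"
    using assms(6)[of \<gamma>] \<gamma> by (auto simp: eventually_ae_filter)
  define \<Omega> where "\<Omega> = space M - N"
  have [measurable]: "\<Omega> \<in> sets M" using N by (auto simp: \<Omega>_def)
  have AE_\<Omega>: "AE \<omega> in M. \<omega> \<in> \<Omega>"
    using N(1) unfolding \<Omega>_def by (intro AE_I'[OF N(1)]) auto
  \<comment> \<open>Setting the path to 0 on the exceptional null set makes every path Hoelder
    continuous without affecting measurability in \<open>\<omega>\<close>.\<close>
  define b where "b t \<omega> = (if \<omega> \<in> \<Omega> then B (max 0 (min T t)) \<omega> else 0)" for t \<omega>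
  have bm: "b t \<in> borel_measurable M" for t
  proof -
    have [measurable]: "B (max 0 (min T t)) \<in> borel_measurable M" by (intro measurable_B) auto
    show ?thesis unfolding b_def[abs_def] by measurable
  qed
  have hol: "\<exists>L. holder_function (\<lambda>t. b t \<omega>) L \<gamma>" for \<omega>
  proof (cases "\<omega> \<in> \<Omega>")
    case True
    then have "(\<lambda>t. B t \<omega>) \<in> besov1 \<gamma> T" using N by (auto simp: \<Omega>_def)
    then obtain L where "0 \<le> L" "\<And>s t. s \<in> {0..T} \<Longrightarrow> t \<in> {0..T} \<Longrightarrow> \<bar>B t \<omega> - B s \<omega>\<bar> \<le> L * \<bar>t - s\<bar> powr \<gamma>"
      by (rule besov1_holder) blast
    then have "holder_function (\<lambda>s. B (max 0 (min T s)) \<omega>) L \<gamma>"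
      using \<gamma> T by (intro holder_function_clamped) auto
    then show ?thesis using True by (auto simp: b_def)
  next
    case False
    have "holder_function (\<lambda>t. 0) 0 \<gamma>" using \<gamma> by unfold_locales auto
    then show ?thesis using False by (auto simp: b_def)
  qed
  have "\<exists>\<Phi>. \<forall>x. (\<Phi> has_real_derivative b x \<omega>) (at x)" for \<omega>
  proof -
    obtain L where "holder_function (\<lambda>t. b t \<omega>) L \<gamma>" using hol by blast
    then have "continuous_on UNIV (\<lambda>t. b t \<omega>)" by (rule holder_function.continuous)
    then show ?thesis
      using einterval_antiderivative[of "-\<infinity>" "\<infinity>" "\<lambda>t. b t \<omega>"]
      by (auto simp: continuous_on_eq_continuous_at has_real_derivative_iff_has_vector_derivative)
  qed
  \<comment> \<open>The antiderivatives are chosen separately for each \<open>\<omega>\<close>;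
    measurability of \<open>log_average\<close> in \<open>\<omega>\<close> comes from the Riemann
    sums.\<close>
  then obtain \<Psi> where \<Psi>: "\<And>\<omega> x. (\<Psi> \<omega> has_real_derivative b x \<omega>) (at x)" by metis
  define Y where "Y \<omega> = log_average (\<Psi> \<omega>) (\<lambda>t. b t \<omega>) T" for \<omega>
  define D where "D = left_deriv f"
  have sub: "f x + D x * (z - x) \<le> f z" for x z
    unfolding D_def by (rule left_deriv_subgradient) fact
  have mono_D: "D x \<le> D z" if "x \<le> z" for x z
  proof (cases "x = z")
    case False
    have "(D x - D z) * (z - x) \<le> 0" using sub[of x z] sub[of z x] by (simp add: algebra_simps)
    then show ?thesis using that False by (simp add: mult_le_0_iff)
  qed simp
  \<comment> \<open>The range of \<open>Y\<close> depends on \<open>\<omega>\<close>, while the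
    occupation bound concerns one bounded function at a time. Countably many truncation levels share
    one null set, and afterwards \<open>n\<close> is taken above the bound of the given
    path.\<close>
  define v where "v n x = D (exp (max (- real n) (min (real n) x)))" for n :: nat and x
  have mono_v: "mono (v n)" for n unfolding v_def by (intro monoI mono_D) auto
  have bounded_v: "\<bar>v n x\<bar> \<le> max \<bar>v n (- real n)\<bar> \<bar>v n (real n)\<bar>" for n x
  proof -
    have "v n (- real n) \<le> v n x" "v n x \<le> v n (real n)" unfolding v_def by (intro mono_D; simp)+
    then show ?thesis by linarith
  qed
  have eqB: "AE \<omega> in M. \<forall>t\<in>{0..T}. b t \<omega> = B t \<omega>"
    using AE_\<Omega> by eventually_elim (auto simp: b_def)
  have "AE \<omega> in M. \<forall>n. \<exists>C\<ge>0. \<forall>\<delta>>0. (\<integral>\<^sup>+t\<in>{0..T}. ennreal (v n (Y \<omega> t + \<delta>) - v n (Y \<omega> t - \<delta>)) \<partial>lborel) \<le> ennreal (C * \<delta> powr \<kappa>)"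
    unfolding AE_all_countable Y_def
    using AE_occupation_log_average[OF T assms(4) bm hol _ eqB mono_v bounded_v \<kappa>(1,2), of "\<lambda>t \<omega>. \<Psi> \<omega> t"] \<Psi> by simp
  then show ?thesis
    \<comment> \<open>Path regularity is used at two orders: at \<open>\<gamma>\<close> for the
      Hoelder estimates, through \<open>\<Omega>\<close>, and at \<open>1 - a\<close> for the
      membership of the integrator in the Besov space.\<close>
    using AE_\<Omega> assms(6)[OF a']
  proof eventually_elim
    case (elim \<omega>)
    obtain L where L: "holder_function (\<lambda>t. b t \<omega>) L \<gamma>" using hol by blast
    have b_cont: "continuous_on UNIV (\<lambda>t. b t \<omega>)" using L by (rule holder_function.continuous)
    have b_eq: "b t \<omega> = B t \<omega>" if "t \<in> {0..T}" for t using elim(2) that by (simp add: b_def)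
    have "continuous_on {0..T} (Y \<omega>)"
    proof -
      have "continuous_on {0..T} (\<Psi> \<omega>)" using \<Psi>[of \<omega>] by (auto intro!: continuous_at_imp_continuous_on DERIV_isCont)
      then show ?thesis unfolding Y_def log_average_def[abs_def]
        using T by (intro continuous_intros continuous_on_subset[OF b_cont]) auto
    qed
    then have "bounded (Y \<omega> ` {0..T})" by (intro compact_imp_bounded compact_continuous_image) auto
    then obtain R where R: "\<forall>t\<in>{0..T}. \<bar>Y \<omega> t\<bar> \<le> R" by (auto simp: bounded_iff)
    obtain n :: nat where n: "R \<le> real n" using real_arch_simple by blast
    have v_eq: "v n (Y \<omega> t) = D (exp (Y \<omega> t))" if "t \<in> {0..T}" for t
    proof -
      have "max (- real n) (min (real n) (Y \<omega> t)) = Y \<omega> t" using bspec[OF R that] n by auto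
      then show ?thesis by (simp add: v_def)
    qed
    obtain C where C: "0 \<le> C" "\<And>\<delta>. 0 < \<delta> \<Longrightarrow> (\<integral>\<^sup>+t\<in>{0..T}. ennreal (v n (Y \<omega> t + \<delta>) - v n (Y \<omega> t - \<delta>)) \<partial>lborel) \<le> ennreal (C * \<delta> powr \<kappa>)"
      using elim(1) by blast
    interpret hb: holder_function "\<lambda>t. b t \<omega>" L \<gamma> by fact
    interpret P: averaged_path "\<lambda>t. b t \<omega>" L \<gamma> T a \<kappa> "max \<bar>v n (- real n)\<bar> \<bar>v n (real n)\<bar>" C "\<Psi> \<omega>" f D "v n"
    proof
      show "b s \<omega> = b (max 0 (min T s)) \<omega>" for s using T by (simp add: b_def)
      show "continuous_on UNIV f" using assms(9) by (intro convex_on_continuous) auto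
      show "v n (log_average (\<Psi> \<omega>) (\<lambda>t. b t \<omega>) T t) = D (exp (log_average (\<Psi> \<omega>) (\<lambda>t. b t \<omega>) T t))" if "0 \<le> t" "t \<le> T" for t
        using v_eq[of t] that by (simp add: Y_def)
      show "(\<integral>\<^sup>+t\<in>{0..T}. ennreal (v n (log_average (\<Psi> \<omega>) (\<lambda>t. b t \<omega>) T t + \<delta>) - v n (log_average (\<Psi> \<omega>) (\<lambda>t. b t \<omega>) T t - \<delta>)) \<partial>lborel)
         \<le> ennreal (C * \<delta> powr \<kappa>)" if "0 < \<delta>" for \<delta>
        using C(2)[OF that] by (simp add: Y_def)
    qed (use T \<Psi> a \<kappa> \<gamma> sub mono_v bounded_v C in auto)
    have int_B: "(LINT u:{0..s}|lebesgue. B u \<omega>) = \<Psi> \<omega> s - \<Psi> \<omega> 0" if s: "s \<in> {0..T}" for s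
    proof -
      have "(LINT u:{0..s}|lebesgue. B u \<omega>) = (LINT u:{0..s}|lebesgue. b u \<omega>)"
        using s b_eq by (intro set_lebesgue_integral_cong) auto
      also have "\<dots> = (LINT u:{0..s}|lborel. b u \<omega>)"
        by (intro set_lebesgue_integral_lebesgue) (use hb.measurable_g in \<open>simp add: set_borel_measurable_def\<close>)
      also have "\<dots> = (LINT u|lborel. b u \<omega> * indicator {0..s} u)"
        by (simp add: set_lebesgue_integral_def mult.commute)
      also have "\<dots> = \<Psi> \<omega> s - \<Psi> \<omega> 0"
        using s \<Psi> b_cont by (intro integral_FTC_Icc_real) (auto simp: continuous_on_eq_continuous_at)
      finally show ?thesis .
    qed
    have G_eq: "G s \<omega> = P.G s" if s: "s \<in> {0..T}" for s
    proof -
      have "P.G s = exp ((\<Psi> \<omega> s - \<Psi> \<omega> 0) / T + (T - s) / T * B s \<omega>)"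
        using s b_eq[OF s] by (simp add: P.G_def P.y_def log_average_def)
      moreover have "S s \<omega> powr ((T - s) / T) = exp ((T - s) / T * B s \<omega>)"
        by (simp add: S powr_def)
      moreover have "(LINT u:{0..s}|lebesgue. ln (S u \<omega>)) = \<Psi> \<omega> s - \<Psi> \<omega> 0"
        using int_B[OF s] by (simp add: S)
      ultimately show ?thesis unfolding G by (simp add: exp_add)
    qed
    have X_eq: "(T - s) / T * left_deriv f (G s \<omega>) * G s \<omega> = P.X s" if s: "s \<in> {0..T}" for s
    proof -
      have "P.y s = Y \<omega> s" using s by (simp add: P.y_def Y_def)
      then have "v n (P.y s) = D (P.G s)" using v_eq[OF s] by (simp add: P.G_def)
      then show ?thesis using s by (simp add: G_eq[OF s] P.X_def P.w_def D_def)
    qed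
    have "has_gls_integral (\<lambda>s. (T - s) / T * left_deriv f (G s \<omega>) * G s \<omega>) (\<lambda>s. B s \<omega>) T T (f (P.G T) - f (P.G 0))"
      using X_eq b_eq elim(3) by (intro P.has_gls_integral_integrand) auto
    moreover have "P.G T = exp (1 / T * (LINT s:{0..T}|lebesgue. B s \<omega>))"
      using T int_B[of T] by (simp add: P.G_def P.y_def log_average_def)
    moreover have "P.G 0 = S 0 \<omega>"
      using T b_eq[of 0] by (simp add: P.G_def P.y_def log_average_def S)
    ultimately show ?case
      by (intro exI[of _ "f (P.G T) - f (P.G 0)"]) simp
  qed
qed

end
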